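(* Let $G=\mathrm{Isom}(\mathbf{H})$ and let $G_\xi$ be the stabilizer of a point $\xi\in\partial\mathbf{H}$. The universal proximal minimal flow of $G$ is $\overline{\mathbf{H}}$ with its weak topology, and $\overline{\mathbf{H}}\simeq\widehat{G/G_\xi}$ as $G$-flows.
   Context: Let $\mathcal{H}$ be an infinite-dimensional separable real Hilbert space with Hilbert basis $(e_i)_{i\in\mathbb{N}}$ and $Q(x)=x_0^2-\sum_{i\ge1}x_i^2$, with polarized symmetric bilinear form $(\cdot,\cdot)$. The hyperbolic space is $\mathbf{H}=\{x\in\mathcal{H}: Q(x)=1,\ x_0>0\}$ with $\cosh d(x,y)=(x,y)$, identified with the set of lines of $\mathcal{H}$ on which $Q$ is positive; $\partial\mathbf{H}$ is the set of $Q$-isotropic lines and $\overline{\mathbf{H}}=\mathbf{H}\cup\partial\mathbf{H}$. $G=\mathrm{Isom}(\mathbf{H})=\mathrm{O}(1,\infty)/\{\pm\mathrm{Id}\}$ carries the (Polish) topology of pointwise convergence on $\mathbf{H}$ and acts on $\overline{\mathbf{H}}$ through its linear action on lines. Weak topology on $\overline{\mathbf{H}}$: with $\mathcal{H}_-=\{x\in\mathcal{H}:x_0=0\}$ and $\overline{\mathbf{D}}$ its closed unit ball, the map sending $x\in\overline{\mathbf{D}}$ to the line spanned by $e_0+x$ is a bijection $\overline{\mathbf{D}}\to\overline{\mathbf{H}}$; the weak topology on $\overline{\mathbf{H}}$ is the one corresponding to the weak topology of $\overline{\mathbf{D}}$. $\widehat{G/G_\xi}$ is the completion of $G/G_\xi$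 for the uniform structure induced by the right uniform structure of $G$ (basic entourages $\{(g,h): gh^{-1}\in V\}$, $V$ an identity neighborhood), with the $G$-action extending left multiplication. A $G$-flow is a continuous action of $G$ on a non-empty compact Hausdorff space $X$; it is minimal if every orbit is dense, and proximal if for all $x,y\in X$ there is a net $(g_\alpha)$ in $G$ such that $g_\alpha x$ and $g_\alpha y$ converge to the same point. The universal proximal minimal flow is the (unique up to isomorphism) proximal minimal $G$-flow having a continuous surjective $G$-equivariant map onto every proximal minimal $G$-flow. *)

theory Defs
  imports "HOL-Analysis.Analysis" "HOL-Algebra.Group_Action" "HOL-Algebra.Left_Coset"
begin

no_notation eq_closure_of (\<open>closure'_of\<index>\<close>)

section \<open>Flows of a topological group\<close>

text \<open>
  A topological group is given by a group \<open>G\<close> together with a topology \<open>T\<close> on its carrier,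
  a \<open>G\<close>-space by a topology \<open>X\<close> together with an action \<open>\<phi>\<close> of \<open>G\<close> on the set \<open>topspace X\<close>.
\<close>

definition G_flow ::
  "('g, 'm) monoid_scheme \<Rightarrow> 'g topology \<Rightarrow> 'x topology \<Rightarrow> ('g \<Rightarrow> 'x \<Rightarrow> 'x) \<Rightarrow> bool" where
  "G_flow G T X \<phi> \<longleftrightarrow>
     topspace X \<noteq> {} \<and> compact_space X \<and> Hausdorff_space X \<and>
     group_action G (topspace X) \<phi> \<and>
     continuous_map (prod_topology T X) X (\<lambda>(g, x). \<phi> g x)"

definition minimal_flow ::
  "('g, 'm) monoid_scheme \<Rightarrow> 'g topology \<Rightarrow> 'x topology \<Rightarrow> ('g \<Rightarrow> 'x \<Rightarrow> 'x) \<Rightarrow> bool" where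
  "minimal_flow G T X \<phi> \<longleftrightarrow>
     G_flow G T X \<phi> \<and> (\<forall>x\<in>topspace X. X closure_of (orbit G \<phi> x) = topspace X)"

text \<open>
  A net in \<open>G\<close> is represented by its filter of tails, a proper filter containing \<open>carrier G\<close>;
  every such filter arises from a net.
\<close>

definition proximal_flow ::
  "('g, 'm) monoid_scheme \<Rightarrow> 'g topology \<Rightarrow> 'x topology \<Rightarrow> ('g \<Rightarrow> 'x \<Rightarrow> 'x) \<Rightarrow> bool" where
  "proximal_flow G T X \<phi> \<longleftrightarrow>
     G_flow G T X \<phi> \<and>
     (\<forall>x\<in>topspace X. \<forall>y\<in>topspace X. \<exists>F z. F \<noteq> bot \<and> F \<le> principal (carrier G) \<and>
        limitin X (\<lambda>g. \<phi> g x) z F \<and> limitin X (\<lambda>g. \<phi> g y) z F)"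

definition equivariant_on ::
  "('g, 'm) monoid_scheme \<Rightarrow> 'x set \<Rightarrow> ('g \<Rightarrow> 'x \<Rightarrow> 'x) \<Rightarrow> ('g \<Rightarrow> 'y \<Rightarrow> 'y) \<Rightarrow> ('x \<Rightarrow> 'y) \<Rightarrow> bool" where
  "equivariant_on G A \<phi> \<psi> f \<longleftrightarrow> (\<forall>g\<in>carrier G. \<forall>x\<in>A. f (\<phi> g x) = \<psi> g (f x))"

definition isomorphic_flows ::
  "('g, 'm) monoid_scheme \<Rightarrow> 'g topology \<Rightarrow> 'x topology \<Rightarrow> ('g \<Rightarrow> 'x \<Rightarrow> 'x)
    \<Rightarrow> 'y topology \<Rightarrow> ('g \<Rightarrow> 'y \<Rightarrow> 'y) \<Rightarrow> bool" where
  "isomorphic_flows G T X \<phi> Y \<psi> \<longleftrightarrow>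
     G_flow G T X \<phi> \<and> G_flow G T Y \<psi> \<and>
     (\<exists>f. homeomorphic_map X Y f \<and> equivariant_on G (topspace X) \<phi> \<psi> f)"

text \<open>
  A definition cannot quantify over types. The first argument names the type in which the
  competing flows \<open>Y\<close> live; a theorem in which \<open>'y\<close> is a free type variable speaks about all
  proximal minimal flows.
\<close>

definition universal_proximal_minimal_flow ::
  "'y itself \<Rightarrow> ('g, 'm) monoid_scheme \<Rightarrow> 'g topology \<Rightarrow> 'x topology
    \<Rightarrow> ('g \<Rightarrow> 'x \<Rightarrow> 'x) \<Rightarrow> bool" where
  "universal_proximal_minimal_flow _ G T X \<phi> \<longleftrightarrow>
     proximal_flow G T X \<phi> \<and> minimal_flow G T X \<phi> \<and>
     (\<forall>(Y :: 'y topology) \<psi>. proximal_flow G T Y \<psi> \<and> minimal_flow G T Y \<psi> \<longrightarrow>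
        (\<exists>f. continuous_map X Y f \<and> f ` topspace X = topspace Y \<and>
             equivariant_on G (topspace X) \<phi> \<psi> f))"


section \<open>Completion of a uniform space\<close>

text \<open>
  A uniform structure on a set \<open>X\<close> is represented, as in the class \<^class>\<open>uniform_space\<close>, by its
  filter of entourages \<open>U\<close>, here with \<open>U \<le> principal (X \<times> X)\<close>. The (Hausdorff) completion is
  Bourbaki's: its points are the minimal Cauchy filters on \<open>X\<close>, and a basic entourage consists of
  the pairs of minimal Cauchy filters that have a common \<open>E\<close>-small member. In the order of
  \<^typ>\<open>'a filter\<close> the coarser filter is the larger one.
\<close>

definition topology_of_uniformity :: "'a set \<Rightarrow> ('a \<times> 'a) filter \<Rightarrow> 'a topology" where
  "topology_of_uniformity X U =
     topology (\<lambda>S. S \<subseteq> X \<and> (\<forall>x\<in>S. eventually (\<lambda>(x', y). x' = x \<longrightarrow> y \<in> S) U))"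

lemma openin_topology_of_uniformity:
  "openin (topology_of_uniformity X U) S \<longleftrightarrow>
     S \<subseteq> X \<and> (\<forall>x\<in>S. eventually (\<lambda>(x', y). x' = x \<longrightarrow> y \<in> S) U)"
proof -
  have "istopology (\<lambda>S. S \<subseteq> X \<and> (\<forall>x\<in>S. eventually (\<lambda>(x', y). x' = x \<longrightarrow> y \<in> S) U))"
    unfolding istopology_def
  proof (intro conjI allI impI ballI)
    fix S T x
    assume S: "S \<subseteq> X \<and> (\<forall>x\<in>S. eventually (\<lambda>(x', y). x' = x \<longrightarrow> y \<in> S) U)"
      and T: "T \<subseteq> X \<and> (\<forall>x\<in>T. eventually (\<lambda>(x', y). x' = x \<longrightarrow> y \<in> T) U)"
    show "S \<inter> T \<subseteq> X" using S by blast
    assume "x \<in> S \<inter> T"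
    then have "eventually (\<lambda>(x', y). x' = x \<longrightarrow> y \<in> S) U" "eventually (\<lambda>(x', y). x' = x \<longrightarrow> y \<in> T) U"
      using S T by auto
    then show "eventually (\<lambda>(x', y). x' = x \<longrightarrow> y \<in> S \<inter> T) U"
      by eventually_elim auto
  next
    fix K x
    assume K: "\<forall>S\<in>K. S \<subseteq> X \<and> (\<forall>x\<in>S. eventually (\<lambda>(x', y). x' = x \<longrightarrow> y \<in> S) U)"
    show "\<Union>K \<subseteq> X" using K by blast
    assume "x \<in> \<Union>K"
    then obtain S where S: "S \<in> K" "x \<in> S" by blast
    then have "eventually (\<lambda>(x', y). x' = x \<longrightarrow> y \<in> S) U"
      using K by blast
    then show "eventually (\<lambda>(x', y). x' = x \<longrightarrow> y \<in> \<Union>K) U"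
      by eventually_elim (use S in auto)
  qed
  then show ?thesis
    by (simp add: topology_of_uniformity_def)
qed

definition cauchy_filter_on :: "'a set \<Rightarrow> ('a \<times> 'a) filter \<Rightarrow> 'a filter \<Rightarrow> bool" where
  "cauchy_filter_on X U F \<longleftrightarrow> F \<noteq> bot \<and> F \<le> principal X \<and> F \<times>\<^sub>F F \<le> U"

definition completion :: "'a set \<Rightarrow> ('a \<times> 'a) filter \<Rightarrow> 'a filter set" where
  "completion X U =
     {F. cauchy_filter_on X U F \<and> (\<forall>F'. cauchy_filter_on X U F' \<and> F \<le> F' \<longrightarrow> F' = F)}"

definition completion_uniformity ::
  "'a set \<Rightarrow> ('a \<times> 'a) filter \<Rightarrow> ('a filter \<times> 'a filter) filter" where
  "completion_uniformity X U =
     (INF E\<in>{E. eventually (\<lambda>p. p \<in> E) U}.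
        principal {(F, F'). F \<in> completion X U \<and> F' \<in> completion X U \<and>
          (\<exists>M. M \<times> M \<subseteq> E \<and> eventually (\<lambda>x. x \<in> M) F \<and> eventually (\<lambda>x. x \<in> M) F')})"

definition completion_topology :: "'a set \<Rightarrow> ('a \<times> 'a) filter \<Rightarrow> 'a filter topology" where
  "completion_topology X U = topology_of_uniformity (completion X U) (completion_uniformity X U)"


section \<open>The completion of a coset space\<close>

definition right_uniformity ::
  "('g, 'm) monoid_scheme \<Rightarrow> 'g topology \<Rightarrow> ('g \<times> 'g) filter" where
  "right_uniformity G T =
     (INF V\<in>{V. openin T V \<and> \<one>\<^bsub>G\<^esub> \<in> V}.
        principal {(g, h). g \<in> carrier G \<and> h \<in> carrier G \<and> g \<otimes>\<^bsub>G\<^esub> inv\<^bsub>G\<^esub> h \<in> V})"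

text \<open>
  The uniform structure induced on the set of left cosets \<open>G/H\<close>: the entourages are the images
  of those of \<open>G\<close> under the projection \<open>g \<mapsto> gH\<close>.
\<close>

definition coset_uniformity ::
  "('g, 'm) monoid_scheme \<Rightarrow> 'g topology \<Rightarrow> 'g set \<Rightarrow> ('g set \<times> 'g set) filter" where
  "coset_uniformity G T H =
     filtermap (\<lambda>(g, h). (g <#\<^bsub>G\<^esub> H, h <#\<^bsub>G\<^esub> H)) (right_uniformity G T)"

definition coset_completion_topology ::
  "('g, 'm) monoid_scheme \<Rightarrow> 'g topology \<Rightarrow> 'g set \<Rightarrow> 'g set filter topology" where
  "coset_completion_topology G T H = completion_topology (lcosets\<^bsub>G\<^esub> H) (coset_uniformity G T H)"

text \<open>
  Left multiplication by \<open>g\<close> is an automorphism of the uniform space \<open>G/H\<close>; its continuous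
  extension to the completion is the push-forward of minimal Cauchy filters.
\<close>

definition coset_completion_action ::
  "('g, 'm) monoid_scheme \<Rightarrow> 'g topology \<Rightarrow> 'g set \<Rightarrow> 'g \<Rightarrow> 'g set filter \<Rightarrow> 'g set filter" where
  "coset_completion_action G T H g =
     (\<lambda>F \<in> completion (lcosets\<^bsub>G\<^esub> H) (coset_uniformity G T H). filtermap (\<lambda>C. g <#\<^bsub>G\<^esub> C) F)"


section \<open>Infinite-dimensional hyperbolic space\<close>

definition Hilbert_basis :: "(nat \<Rightarrow> 'a::{real_inner, complete_space}) \<Rightarrow> bool" where
  "Hilbert_basis e \<longleftrightarrow>
     (\<forall>i j. e i \<bullet> e j = (if i = j then 1 else 0)) \<and> closure (span (range e)) = UNIV"

definition hyp_Q :: "(nat \<Rightarrow> 'a::{real_inner, complete_space}) \<Rightarrow> 'a \<Rightarrow> real" where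
  "hyp_Q e x = (x \<bullet> e 0)\<^sup>2 - (\<Sum>i. (x \<bullet> e (Suc i))\<^sup>2)"

definition hyp_form :: "(nat \<Rightarrow> 'a::{real_inner, complete_space}) \<Rightarrow> 'a \<Rightarrow> 'a \<Rightarrow> real" where
  "hyp_form e x y = (hyp_Q e (x + y) - hyp_Q e x - hyp_Q e y) / 2"

definition hyp_space :: "(nat \<Rightarrow> 'a::{real_inner, complete_space}) \<Rightarrow> 'a set" where
  "hyp_space e = {x. hyp_Q e x = 1 \<and> x \<bullet> e 0 > 0}"

text \<open>
  The value \<open>0\<close> outside of the hyperbolic space is a convention: \<^locale>\<open>Metric_space\<close> requires
  nonnegativity and symmetry on the whole type.
\<close>

definition hyp_dist :: "(nat \<Rightarrow> 'a::{real_inner, complete_space}) \<Rightarrow> 'a \<Rightarrow> 'a \<Rightarrow> real" where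
  "hyp_dist e x y =
     (if x \<in> hyp_space e \<and> y \<in> hyp_space e then arcosh (hyp_form e x y) else 0)"

definition hyp_Isom ::
  "(nat \<Rightarrow> 'a::{real_inner, complete_space}) \<Rightarrow> ('a \<Rightarrow> 'a) monoid" where
  "hyp_Isom e = (BijGroup (hyp_space e))
     \<lparr>carrier := {g \<in> Bij (hyp_space e).
        \<forall>x\<in>hyp_space e. \<forall>y\<in>hyp_space e. hyp_dist e (g x) (g y) = hyp_dist e x y}\<rparr>"

text \<open>Pointwise convergence is convergence in the product of copies of the metric space.\<close>

definition hyp_Isom_topology ::
  "(nat \<Rightarrow> 'a::{real_inner, complete_space}) \<Rightarrow> ('a \<Rightarrow> 'a) topology" where
  "hyp_Isom_topology e =
     subtopology
       (product_topology (\<lambda>_. Metric_space.mtopology (hyp_space e) (hyp_dist e)) (hyp_space e))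
       (carrier (hyp_Isom e))"

definition hyp_positive_lines :: "(nat \<Rightarrow> 'a::{real_inner, complete_space}) \<Rightarrow> 'a set set" where
  "hyp_positive_lines e = {span {x} | x. hyp_Q e x > 0}"

definition hyp_boundary :: "(nat \<Rightarrow> 'a::{real_inner, complete_space}) \<Rightarrow> 'a set set" where
  "hyp_boundary e = {span {x} | x. x \<noteq> 0 \<and> hyp_Q e x = 0}"

definition hyp_closure :: "(nat \<Rightarrow> 'a::{real_inner, complete_space}) \<Rightarrow> 'a set set" where
  "hyp_closure e = hyp_positive_lines e \<union> hyp_boundary e"

definition hyp_orthogonal_group ::
  "(nat \<Rightarrow> 'a::{real_inner, complete_space}) \<Rightarrow> ('a \<Rightarrow> 'a) set" where
  "hyp_orthogonal_group e = {A. linear A \<and> bij A \<and> (\<forall>x. hyp_Q e (A x) = hyp_Q e x)}"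

text \<open>
  The identification of the isometry group with \<open>O(1,\<infinity>)/{\<plusminus>Id}\<close>: every isometry \<open>g\<close> is the
  restriction of exactly one \<open>A \<in> O(1,\<infinity>)\<close>. The other representative \<open>-A\<close> of the class exchanges
  the two sheets of the hyperboloid and acts in the same way on lines.
\<close>

definition hyp_linear_lift ::
  "(nat \<Rightarrow> 'a::{real_inner, complete_space}) \<Rightarrow> ('a \<Rightarrow> 'a) \<Rightarrow> 'a \<Rightarrow> 'a" where
  "hyp_linear_lift e g =
     (THE A. A \<in> hyp_orthogonal_group e \<and> (\<forall>x\<in>hyp_space e. A x = g x))"

definition hyp_action ::
  "(nat \<Rightarrow> 'a::{real_inner, complete_space}) \<Rightarrow> ('a \<Rightarrow> 'a) \<Rightarrow> 'a set \<Rightarrow> 'a set" where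
  "hyp_action e g = (\<lambda>L \<in> hyp_closure e. hyp_linear_lift e g ` L)"

definition weak_topology :: "'a::real_normed_vector topology" where
  "weak_topology = topology_generated_by {f -` U | (f :: 'a \<Rightarrow> real) U. bounded_linear f \<and> open U}"

definition hyp_disc :: "(nat \<Rightarrow> 'a::{real_inner, complete_space}) \<Rightarrow> 'a set" where
  "hyp_disc e = {x. x \<bullet> e 0 = 0 \<and> norm x \<le> 1}"

text \<open>
  The closed unit ball of the hyperplane \<open>x\<^sub>0 = 0\<close> carries the subspace topology of the weak
  topology of the whole space, since every continuous functional on the hyperplane extends. Its
  topology is transported along the bijection that sends \<open>x\<close> to the line spanned by \<open>e\<^sub>0 + x\<close>.
\<close>

definition hyp_closure_topology ::
  "(nat \<Rightarrow> 'a::{real_inner, complete_space}) \<Rightarrow> 'a set topology" where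
  "hyp_closure_topology e =
     pullback_topology (hyp_closure e) (inv_into (hyp_disc e) (\<lambda>x. span {e 0 + x}))
       (subtopology weak_topology (hyp_disc e))"

end

theory Submission
  imports Defs
begin

text \<open>
  Let \<open>P\<close> be the stabilizer of a boundary point. Boundary points that are weakly close to each
  other differ by a small isometry, a reflection or a rotation, so the weak topology of the closed
  ball induces on the boundary the uniformity of \<open>G/P\<close>; since the boundary is weakly dense, the ball
  is the completion of \<open>G/P\<close>, and a \<open>P\<close>-fixed point \<open>y\<close> of a minimal flow \<open>Y\<close> yields a factor map
  onto \<open>Y\<close>, the closure of \<open>g\<xi> \<mapsto> gy\<close>.

  It remains to find a \<open>P\<close>-fixed point in a proximal flow. The stabilizer \<open>K\<close> of a point of the
  hyperbolic space is the orthogonal group of a Hilbert space and has a fixed point in every flow, by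
  concentration of measure. Let the point of the hyperbolic space tend to the boundary: a cluster
  point of \<open>K\<close>-fixed points is fixed by the kernel \<open>P\<^sub>1\<close> of the Busemann character of \<open>P\<close>. Finally
  \<open>P/P\<^sub>1\<close> is abelian, and a proximal flow of \<open>G\<close> is proximal for \<open>P\<close>. If \<open>p\<^sub>\<alpha>y\<close> and \<open>p\<^sub>\<alpha>py\<close> have
  the same limit \<open>z\<close>, and \<open>y\<close> is fixed by \<open>P\<^sub>1\<close>, then \<open>pz = z\<close>.
\<close>

section \<open>Flows\<close>

text \<open>The substitute is \<open>small_transitive\<close>: it compares boundary points only, but
  near every point of the ball, interior points included. The completion, the factor map and
  proximality for the stabilizer all rest on it and are proved for an abstract
  \<open>homogeneous_flow\<close>. Isometries are handled through their linear lifts in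
  \<open>OG\<close>. The elements that the argument needs are built from reflections: these give
  transitivity, small moves of the sphere, contractions towards the boundary, and a subgroup dense
  in \<open>K\<close>. Infinite dimension matters in two places: the sphere is weakly dense in the
  ball, and there is room for arbitrarily many orthogonal copies of a finite-dimensional space. The
  second provides the long products on which concentration occurs; it is measured by counting words
  over a finite alphabet.\<close>

lemma closure_of_image_meets:
  assumes "x \<in> X closure_of (q ` S)" "openin X W" "x \<in> W"
  obtains s where "s \<in> S" "q s \<in> W"
  using assms by (auto simp: in_closure_of)

lemma compact_space_fip_image:
  assumes "compact_space X" "\<And>i. i \<in> I \<Longrightarrow> closedin X (K i)"
    and "\<And>J. finite J \<Longrightarrow> J \<subseteq> I \<Longrightarrow> (\<Inter>i\<in>J. K i) \<noteq> {}"
  shows "(\<Inter>i\<in>I. K i) \<noteq> {}"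
proof -
  have "\<forall>C\<in>K ` I. closedin X C" using assms(2) by blast
  moreover have "\<forall>\<F>. finite \<F> \<and> \<F> \<subseteq> K ` I \<longrightarrow> \<Inter>\<F> \<noteq> {}"
    using assms(3) by (metis finite_subset_image)
  ultimately show ?thesis
    using assms(1)[unfolded compact_space_fip, THEN spec, of "K ` I"] by simp
qed

text \<open>A \<open>group_action\<close> is a homomorphism into \<open>BijGroup\<close>, whose
  elements are extensional bijections. The inverse of \<open>g\<close> supplies bijectivity, so
  extensionality and the pointwise laws are enough.\<close>

lemma group_actionI:
  fixes G (structure)
  assumes "group G"
    and ext: "\<And>g. g \<in> carrier G \<Longrightarrow> \<phi> g \<in> extensional E"
    and closed: "\<And>g x. g \<in> carrier G \<Longrightarrow> x \<in> E \<Longrightarrow> \<phi> g x \<in> E"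
    and one: "\<And>x. x \<in> E \<Longrightarrow> \<phi> \<one>\<^bsub>G\<^esub> x = x"
    and mult: "\<And>g h x. g \<in> carrier G \<Longrightarrow> h \<in> carrier G \<Longrightarrow> x \<in> E \<Longrightarrow> \<phi> (g \<otimes>\<^bsub>G\<^esub> h) x = \<phi> g (\<phi> h x)"
  shows "group_action G E \<phi>"
proof -
  interpret group G by fact
  have Bij: "\<phi> g \<in> Bij E" if g: "g \<in> carrier G" for g
  proof -
    have "bij_betw (\<phi> g) E E"
      by (rule bij_betw_byWitness[where f' = "\<phi> (inv g)"])
        (use g closed one mult[symmetric] in auto)
    then show ?thesis using ext[OF g] unfolding Bij_def by blast
  qed
  have "\<phi> (g \<otimes> h) = compose E (\<phi> g) (\<phi> h)" if "g \<in> carrier G" "h \<in> carrier G" for g h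
    using that mult ext[of "g \<otimes> h"] by (intro extensionalityI[where A = E]) (auto simp: compose_def)
  then have "\<phi> \<in> hom G (BijGroup E)"
    using Bij by (auto simp: hom_def BijGroup_def)
  then show ?thesis
    using group_BijGroup by (simp add: group_action_def group_hom_def group_hom_axioms_def assms(1))
qed

text \<open>Needed twice: from the disc to the set of lines, and from \<open>X\<close> to its copy
  made of filters. Joint continuity holds because \<open>\<psi>\<close> is \<open>\<phi>\<close>
  composed with \<open>f\<close> on one side and with the inverse of \<open>f\<close> in the second
  argument on the other.\<close>

lemma G_flow_transport:
  fixes G (structure)
  assumes flow: "G_flow G T X \<phi>" and f: "homeomorphic_map X Y f"
    and eq: "\<And>g x. g \<in> carrier G \<Longrightarrow> x \<in> topspace X \<Longrightarrow> f (\<phi> g x) = \<psi> g (f x)"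
    and ext: "\<And>g. g \<in> carrier G \<Longrightarrow> \<psi> g \<in> extensional (topspace Y)"
    and T: "topspace T = carrier G"
  shows "G_flow G T Y \<psi>"
proof -
  interpret A: group_action G "topspace X" \<phi> using flow unfolding G_flow_def by blast
  interpret group G using A.group_hom group_hom.axioms(1) by blast
  obtain f' where f': "homeomorphic_maps X Y f f'" using f homeomorphic_map_maps by blast
  have cf: "continuous_map X Y f" "continuous_map Y X f'"
    and inv: "\<And>x. x \<in> topspace X \<Longrightarrow> f' (f x) = x" "\<And>y. y \<in> topspace Y \<Longrightarrow> f (f' y) = y"
    using f' unfolding homeomorphic_maps_def by auto
  have cl: "f' y \<in> topspace X" if "y \<in> topspace Y" for y using cf(2) that by (auto simp: continuous_map_def)
  have clf: "f x \<in> topspace Y" if "x \<in> topspace X" for x using cf(1) that by (auto simp: continuous_map_def)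
  have act: "\<phi> g x \<in> topspace X" if "g \<in> carrier G" "x \<in> topspace X" for g x
    using A.element_image that by blast
  have \<psi>: "\<psi> g y = f (\<phi> g (f' y))" if "g \<in> carrier G" "y \<in> topspace Y" for g y
    using eq[OF that(1) cl[OF that(2)]] inv(2) that(2) by simp
  have hs: "X homeomorphic_space Y" using f' homeomorphic_space_def by blast
  have "continuous_map (prod_topology T Y) Y (f \<circ> (\<lambda>(g, x). \<phi> g x) \<circ> (\<lambda>(g, y). (g, f' y)))"
  proof (intro continuous_map_compose[OF _ continuous_map_compose[OF _ cf(1)]])
    show "continuous_map (prod_topology T Y) (prod_topology T X) (\<lambda>(g, y). (g, f' y))"
      using continuous_map_fst continuous_map_compose[OF continuous_map_snd cf(2), of T]
      by (auto simp: continuous_map_pairwise comp_def case_prod_beta)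
    show "continuous_map (prod_topology T X) X (\<lambda>(g, x). \<phi> g x)"
      using flow unfolding G_flow_def by blast
  qed
  then have "continuous_map (prod_topology T Y) Y (\<lambda>(g, y). \<psi> g y)"
    by (rule continuous_map_eq) (auto simp: \<psi> T)
  moreover have "group_action G (topspace Y) \<psi>"
  proof (rule group_actionI)
    fix y assume y: "y \<in> topspace Y"
    show "\<psi> \<one> y = y" using \<psi>[OF one_closed y] A.id_eq_one cl[OF y] inv(2)[OF y] by (metis restrict_apply)
  qed (auto simp: ext \<psi> clf cl act inv A.composition_rule is_group)
  moreover have "topspace X \<noteq> {}" "compact_space X" "Hausdorff_space X"
    using flow unfolding G_flow_def by auto
  moreover have "topspace Y \<noteq> {}" using calculation(3) clf by blast
  ultimately show ?thesis
    using homeomorphic_compact_space[OF hs] homeomorphic_Hausdorff_space[OF hs]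
    unfolding G_flow_def by simp
qed

locale flow =
  fixes G (structure) and T and X and \<phi>
  assumes flow: "G_flow G T X \<phi>" and topspace_T: "topspace T = carrier G"
begin

sublocale group_action G "topspace X" \<phi>
  using flow unfolding G_flow_def by blast

sublocale group G
  using group_hom group_hom.axioms(1) by blast

lemma compact: "compact_space X" and Hausdorff: "Hausdorff_space X" and nonempty: "topspace X \<noteq> {}"
  and continuous: "continuous_map (prod_topology T X) X (\<lambda>(g, x). \<phi> g x)"
  using flow unfolding G_flow_def by auto

lemma act_closed: "g \<in> carrier G \<Longrightarrow> x \<in> topspace X \<Longrightarrow> \<phi> g x \<in> topspace X"
  using element_image by blast

lemma act_one: "x \<in> topspace X \<Longrightarrow> \<phi> \<one> x = x"
  using id_eq_one by (metis restrict_apply)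

lemma act_mult: "g \<in> carrier G \<Longrightarrow> h \<in> carrier G \<Longrightarrow> x \<in> topspace X \<Longrightarrow> \<phi> (g \<otimes> h) x = \<phi> g (\<phi> h x)"
  using composition_rule by blast

lemma act_inv: "g \<in> carrier G \<Longrightarrow> x \<in> topspace X \<Longrightarrow> \<phi> (inv g) (\<phi> g x) = x"
  "g \<in> carrier G \<Longrightarrow> x \<in> topspace X \<Longrightarrow> \<phi> g (\<phi> (inv g) x) = x"
  by (simp_all add: act_mult[symmetric] act_one)

lemma nbhd:
  assumes "g \<in> carrier G" "x \<in> topspace X" "openin X U" "\<phi> g x \<in> U"
  obtains V O' where "openin T V" "g \<in> V" "openin X O'" "x \<in> O'"
    "\<And>h z. h \<in> V \<Longrightarrow> z \<in> O' \<Longrightarrow> \<phi> h z \<in> U"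
proof -
  have "openin (prod_topology T X) {p \<in> topspace (prod_topology T X). (\<lambda>(g, x). \<phi> g x) p \<in> U}"
    by (rule openin_continuous_map_preimage[OF continuous assms(3)])
  moreover have "(g, x) \<in> {p \<in> topspace (prod_topology T X). (\<lambda>(g, x). \<phi> g x) p \<in> U}"
    using assms topspace_T by simp
  ultimately obtain V O' where VO: "openin T V" "openin X O'" "g \<in> V" "x \<in> O'"
    "V \<times> O' \<subseteq> {p \<in> topspace (prod_topology T X). (\<lambda>(g, x). \<phi> g x) p \<in> U}"
    unfolding openin_prod_topology_alt by meson
  have "\<phi> h z \<in> U" if "h \<in> V" "z \<in> O'" for h z using VO(5) that by auto
  with VO that show ?thesis by blast
qed

lemma nbhd_one:
  assumes "openin X U" "x \<in> U"
  obtains V O' where "openin T V" "\<one> \<in> V" "openin X O'" "x \<in> O'"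
    "\<And>h z. h \<in> V \<Longrightarrow> z \<in> O' \<Longrightarrow> \<phi> h z \<in> U"
proof -
  have "x \<in> topspace X" using assms openin_subset by blast
  then show ?thesis using nbhd[of \<one> x U] assms act_one that by (metis one_closed)
qed

lemma continuous_act: "g \<in> carrier G \<Longrightarrow> continuous_map X X (\<phi> g)"
  unfolding continuous_map_def
proof (intro conjI allI impI)
  fix U assume g: "g \<in> carrier G" and U: "openin X U"
  show "openin X {x \<in> topspace X. \<phi> g x \<in> U}"
  proof (subst openin_subopen, clarify)
    fix x assume x: "x \<in> topspace X" "\<phi> g x \<in> U"
    obtain V O' where VO: "openin T V" "g \<in> V" "openin X O'" "x \<in> O'"
      "\<And>h z. h \<in> V \<Longrightarrow> z \<in> O' \<Longrightarrow> \<phi> h z \<in> U" using nbhd[OF g x(1) U x(2)] by blast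
    then have "O' \<subseteq> {x \<in> topspace X. \<phi> g x \<in> U}" using openin_subset by blast
    then show "\<exists>T. openin X T \<and> x \<in> T \<and> T \<subseteq> {x \<in> topspace X. \<phi> g x \<in> U}" using VO by blast
  qed
qed (use act_closed in auto)

lemma openin_preimage:
  "g \<in> carrier G \<Longrightarrow> openin X U \<Longrightarrow> openin X {x \<in> topspace X. \<phi> g x \<in> U}"
  using openin_continuous_map_preimage[OF continuous_act] .

lemma closedin_fix: "g \<in> carrier G \<Longrightarrow> closedin X {x \<in> topspace X. \<phi> g x = x}"
  using closedin_continuous_maps_eq[OF Hausdorff continuous_act continuous_map_id] by simp

text \<open>Joint continuity at \<open>\<one>\<close> fattens a Hausdorff separation by a
  neighbourhood of the identity. Several later contradictions consist in a small element
  \<open>v\<close> that carries a point of \<open>U\<close> into \<open>U'\<close>.\<close>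

lemma separation:
  assumes "x \<in> topspace X" "y \<in> topspace X" "x \<noteq> y"
  obtains V U U' where "openin T V" "\<one> \<in> V" "openin X U" "x \<in> U" "openin X U'" "y \<in> U'"
    "\<And>v z. v \<in> V \<Longrightarrow> z \<in> U \<Longrightarrow> \<phi> v z \<notin> U'"
proof -
  obtain U1 U' where U: "openin X U1" "openin X U'" "x \<in> U1" "y \<in> U'" "disjnt U1 U'"
    using Hausdorff assms unfolding Hausdorff_space_def by blast
  obtain V O' where "openin T V" "\<one> \<in> V" "openin X O'" "x \<in> O'"
    "\<And>h z. h \<in> V \<Longrightarrow> z \<in> O' \<Longrightarrow> \<phi> h z \<in> U1" using nbhd_one[OF U(1) U(3)] by blast
  then show ?thesis using that[of V O' U'] U unfolding disjnt_def by blast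
qed

lemma common_fixed_point:
  assumes "S \<subseteq> carrier G" and "S \<noteq> {}"
    and "\<And>F. finite F \<Longrightarrow> F \<subseteq> S \<Longrightarrow> \<exists>x\<in>topspace X. \<forall>g\<in>F. \<phi> g x = x"
  shows "\<exists>x\<in>topspace X. \<forall>g\<in>S. \<phi> g x = x"
proof -
  define Fx where "Fx g = {x \<in> topspace X. \<phi> g x = x}" for g
  have "(\<Inter>g\<in>S. Fx g) \<noteq> {}"
  proof (rule compact_space_fip_image[OF compact])
    show "closedin X (Fx g)" if "g \<in> S" for g
      using closedin_fix[of g] assms(1) that unfolding Fx_def by blast
    show "(\<Inter>g\<in>F. Fx g) \<noteq> {}" if F: "finite F" "F \<subseteq> S" for F
    proof -
      obtain x where x: "x \<in> topspace X" "\<forall>g\<in>F. \<phi> g x = x" using assms(3)[OF F] by blast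
      then have "x \<in> (\<Inter>g\<in>F. Fx g)" unfolding Fx_def by blast
      then show ?thesis by blast
    qed
  qed
  then obtain x where "x \<in> \<Inter>(Fx ` S)" by blast
  then show ?thesis using assms(2) unfolding Fx_def by blast
qed

end

text \<open>
  Points of the orbit of \<open>x\<^sub>0\<close> that are close to each other in \<open>X\<close> differ by a small element of the
  group: the uniformity of \<open>X\<close> induces on the orbit the uniformity of \<open>G/G\<^sub>x\<^sub>0\<close>.
\<close>
locale homogeneous_flow = flow +
  fixes x0
  assumes minimal: "minimal_flow G T X \<phi>" and x0: "x0 \<in> topspace X"
    and small_transitive: "\<And>x V. \<lbrakk>x \<in> topspace X; openin T V; \<one> \<in> V\<rbrakk> \<Longrightarrow>
      \<exists>W. openin X W \<and> x \<in> W \<and>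
        (\<forall>g\<in>carrier G. \<forall>h\<in>carrier G. \<phi> g x0 \<in> W \<longrightarrow> \<phi> h x0 \<in> W \<longrightarrow> (\<exists>v\<in>V. \<phi> v (\<phi> g x0) = \<phi> h x0))"
begin

abbreviation "P \<equiv> stabilizer G \<phi> x0"

lemma closure_of_orbit: "x \<in> topspace X \<Longrightarrow> X closure_of (orbit G \<phi> x) = topspace X"
  using minimal unfolding minimal_flow_def by simp

lemma closed_invariant:
  assumes "closedin X D" "D \<noteq> {}" "\<And>g x. g \<in> carrier G \<Longrightarrow> x \<in> D \<Longrightarrow> \<phi> g x \<in> D"
  shows "D = topspace X"
proof -
  obtain x where x: "x \<in> D" using assms(2) by blast
  have DX: "D \<subseteq> topspace X" using assms(1) by (rule closedin_subset)
  have "X closure_of (orbit G \<phi> x) = topspace X" using closure_of_orbit x DX by blast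
  moreover have "orbit G \<phi> x \<subseteq> D" using assms(3) x unfolding orbit_def by blast
  then have "X closure_of (orbit G \<phi> x) \<subseteq> D" using assms(1) by (rule closure_of_minimal)
  ultimately show ?thesis using DX by simp
qed

lemma orbit_dense:
  assumes "openin X W" "W \<noteq> {}"
  obtains g where "g \<in> carrier G" "\<phi> g x0 \<in> W"
proof -
  obtain x where x: "x \<in> W" using assms(2) by blast
  have "x \<in> X closure_of (orbit G \<phi> x0)"
    using closure_of_orbit[OF x0] x openin_subset[OF assms(1)] by auto
  moreover have "orbit G \<phi> x0 = (\<lambda>g. \<phi> g x0) ` carrier G" unfolding orbit_def by blast
  ultimately show ?thesis using closure_of_image_meets assms(1) x that by metis
qed

lemma P_closed: "p \<in> P \<Longrightarrow> p \<in> carrier G" and P_fix: "p \<in> P \<Longrightarrow> \<phi> p x0 = x0"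
  unfolding stabilizer_def by auto

lemma subgroup_P: "subgroup P G"
  by (rule stabilizer_subgroup[OF x0])

text \<open>
  Glasner's observation that a proximal flow is proximal for a cocompact subgroup, here with
  \<open>G/P\<close> merely precompact.
\<close>
lemma stabilizer_proximal:
  assumes Y: "proximal_flow G T Y \<psi>" and y: "y1 \<in> topspace Y" "y2 \<in> topspace Y"
  shows "\<exists>z\<in>topspace Y. \<forall>U. openin Y U \<and> z \<in> U \<longrightarrow> (\<exists>p\<in>P. \<psi> p y1 \<in> U \<and> \<psi> p y2 \<in> U)"
proof -
  interpret Y: flow G T Y \<psi>
    using Y topspace_T unfolding proximal_flow_def by unfold_locales auto
  let ?Z = "prod_topology (prod_topology Y Y) X"
  define q where "q g = ((\<psi> g y1, \<psi> g y2), \<phi> g x0)" for g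
  define \<Omega> where "\<Omega> = ?Z closure_of (q ` carrier G)"
  have q: "q g \<in> \<Omega>" if "g \<in> carrier G" for g
  proof -
    have "q ` carrier G \<subseteq> topspace ?Z"
      unfolding q_def using Y.act_closed act_closed y x0 by auto
    then show ?thesis using that closure_of_subset unfolding \<Omega>_def by blast
  qed
  have closed\<Omega>: "closedin ?Z \<Omega>" unfolding \<Omega>_def by simp
  have cZ: "compact_space ?Z"
    by (simp add: compact_space_prod_topology Y.compact compact)
  have inv: "((\<psi> g a, \<psi> g b), \<phi> g x) \<in> \<Omega>" if g: "g \<in> carrier G" and abx: "((a, b), x) \<in> \<Omega>" for g a b x
  proof -
    define h where "h p = ((\<psi> g (fst (fst p)), \<psi> g (snd (fst p))), \<phi> g (snd p))" for p
    have "continuous_map ?Z ?Z h"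
      unfolding h_def continuous_map_pairwise comp_def fst_conv snd_conv
      by (intro conjI continuous_map_compose[OF _ Y.continuous_act[OF g], unfolded comp_def]
          continuous_map_compose[OF _ continuous_act[OF g], unfolded comp_def]
          continuous_map_fst continuous_map_snd
          continuous_map_compose[OF continuous_map_fst continuous_map_fst, unfolded comp_def]
          continuous_map_compose[OF continuous_map_fst continuous_map_snd, unfolded comp_def])
    then have "h ` \<Omega> \<subseteq> ?Z closure_of (h ` (q ` carrier G))"
      unfolding \<Omega>_def by (rule continuous_map_image_closure_subset)
    also have "h (q k) = q (g \<otimes> k)" if "k \<in> carrier G" for k
      unfolding h_def q_def using g that y x0 by (simp add: act_mult Y.act_mult)
    then have "h ` (q ` carrier G) \<subseteq> q ` carrier G" using g by (auto simp: image_iff)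
    then have "?Z closure_of (h ` (q ` carrier G)) \<subseteq> \<Omega>"
      unfolding \<Omega>_def by (rule closure_of_mono)
    finally have "h ((a, b), x) \<in> \<Omega>" using abx by blast
    then show ?thesis unfolding h_def by simp
  qed
  \<comment> \<open>The part of \<open>\<Omega>\<close> over the diagonal consists of the limits at
    which the two points have merged. Its projection to \<open>X\<close> is closed, invariant, and
    nonempty by proximality for \<open>G\<close>, hence all of \<open>X\<close> by minimality. So
    the points also merge along elements \<open>g\<close> for which \<open>\<phi> g x0\<close> tends
    to \<open>x0\<close>.\<close>
  define \<Delta> where "\<Delta> = {p \<in> topspace ?Z. fst (fst p) = snd (fst p)}"
  have "closedin ?Z \<Delta>"
    unfolding \<Delta>_def
    by (rule closedin_continuous_maps_eq[OF Y.Hausdorff];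
        intro continuous_map_compose[OF continuous_map_fst continuous_map_fst, unfolded comp_def]
          continuous_map_compose[OF continuous_map_fst continuous_map_snd, unfolded comp_def])
  then have "compactin ?Z (\<Omega> \<inter> \<Delta>)"
    using closed\<Omega> cZ by (intro closedin_compact_space closedin_Int)
  then have "compactin X (snd ` (\<Omega> \<inter> \<Delta>))"
    by (rule image_compactin) (rule continuous_map_snd)
  then have "closedin X (snd ` (\<Omega> \<inter> \<Delta>))"
    using Hausdorff compactin_imp_closedin by blast
  moreover have "snd ` (\<Omega> \<inter> \<Delta>) \<noteq> {}"
  proof -
    obtain F z where F: "F \<noteq> bot" "F \<le> principal (carrier G)"
      and lim: "limitin Y (\<lambda>g. \<psi> g y1) z F" "limitin Y (\<lambda>g. \<psi> g y2) z F"
      using Y y unfolding proximal_flow_def by meson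
    have "compactin ?Z \<Omega>" using closed\<Omega> cZ by (rule closedin_compact_space[rotated])
    then have "compactin (prod_topology Y Y) (fst ` \<Omega>)"
      by (rule image_compactin) (rule continuous_map_fst)
    then have cl: "closedin (prod_topology Y Y) (fst ` \<Omega>)"
      using Y.Hausdorff by (intro compactin_imp_closedin) (auto simp: Hausdorff_space_prod_topology)
    have "limitin (prod_topology Y Y) (\<lambda>g. (\<psi> g y1, \<psi> g y2)) (z, z) F"
      unfolding limitin_pairwise using lim by (simp add: comp_def)
    moreover have "\<forall>\<^sub>F g in F. (\<psi> g y1, \<psi> g y2) \<in> fst ` \<Omega>"
    proof -
      have "\<forall>\<^sub>F g in F. g \<in> carrier G" using F(2) by (simp add: le_principal)
      then show ?thesis
      proof eventually_elim
        case (elim g)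
        then show ?case using q[of g] unfolding q_def by (metis fst_conv image_eqI)
      qed
    qed
    ultimately have "(z, z) \<in> fst ` \<Omega>" using cl F(1) by (metis limitin_closedin)
    then obtain x where "((z, z), x) \<in> \<Omega>" by auto
    moreover then have "((z, z), x) \<in> \<Delta>" unfolding \<Delta>_def using closed\<Omega> closedin_subset by fastforce
    ultimately show ?thesis by blast
  qed
  moreover have "\<phi> g x \<in> snd ` (\<Omega> \<inter> \<Delta>)" if g: "g \<in> carrier G" and x: "x \<in> snd ` (\<Omega> \<inter> \<Delta>)" for g x
  proof -
    obtain a where a: "((a, a), x) \<in> \<Omega>" using x unfolding \<Delta>_def by auto
    have "((\<psi> g a, \<psi> g a), \<phi> g x) \<in> \<Omega>" by (rule inv[OF g a])
    moreover then have "((\<psi> g a, \<psi> g a), \<phi> g x) \<in> \<Delta>"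
      unfolding \<Delta>_def using closed\<Omega> closedin_subset by fastforce
    ultimately show ?thesis by force
  qed
  ultimately have "snd ` (\<Omega> \<inter> \<Delta>) = topspace X" by (rule closed_invariant)
  then have "x0 \<in> snd ` (\<Omega> \<inter> \<Delta>)" using x0 by blast
  then obtain z where z: "((z, z), x0) \<in> \<Omega>" unfolding \<Delta>_def by auto
  have "z \<in> topspace Y" using z closed\<Omega> closedin_subset by fastforce
  \<comment> \<open>The element \<open>g\<close> found by density only moves \<open>x0\<close> to a
    nearby point. A small \<open>v\<close> brings that point back, so that
    \<open>v \<otimes> g\<close> lies in \<open>P\<close>; \<open>O'\<close> is chosen so that
    \<open>v\<close> does no harm in \<open>Y\<close>.\<close>
  moreover have "\<exists>p\<in>P. \<psi> p y1 \<in> U \<and> \<psi> p y2 \<in> U" if U: "openin Y U" "z \<in> U" for U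
  proof -
    obtain V O' where VO: "openin T V" "\<one> \<in> V" "openin Y O'" "z \<in> O'"
      "\<And>h y. h \<in> V \<Longrightarrow> y \<in> O' \<Longrightarrow> \<psi> h y \<in> U" using Y.nbhd_one[OF U] by blast
    obtain W where W: "openin X W" "x0 \<in> W"
      "\<And>g h. g \<in> carrier G \<Longrightarrow> h \<in> carrier G \<Longrightarrow> \<phi> g x0 \<in> W \<Longrightarrow> \<phi> h x0 \<in> W \<Longrightarrow> \<exists>v\<in>V. \<phi> v (\<phi> g x0) = \<phi> h x0"
      using small_transitive[OF x0 VO(1,2)] by blast
    have "openin ?Z ((O' \<times> O') \<times> W)" using VO(3) W(1) by (simp add: openin_prod_Times_iff)
    moreover have "((z, z), x0) \<in> (O' \<times> O') \<times> W" using VO W by simp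
    ultimately obtain g where g: "g \<in> carrier G" "q g \<in> (O' \<times> O') \<times> W"
      using closure_of_image_meets[OF z[unfolded \<Omega>_def]] by metis
    obtain v where v: "v \<in> V" "\<phi> v (\<phi> g x0) = x0"
      using W(3)[OF g(1) one_closed] g(2) W(2) act_one[OF x0] unfolding q_def by auto
    have vG: "v \<in> carrier G" using v(1) VO(1) openin_subset topspace_T by blast
    have "v \<otimes> g \<in> P" using v(2) vG g(1) x0 unfolding stabilizer_def by (simp add: act_mult)
    moreover have "\<psi> (v \<otimes> g) y1 \<in> U" "\<psi> (v \<otimes> g) y2 \<in> U"
      using VO(5)[OF v(1)] g vG y unfolding q_def by (auto simp: Y.act_mult)
    ultimately show ?thesis by blast
  qed
  ultimately show ?thesis by blast
qed

text \<open>On points fixed by \<open>P1\<close> the group \<open>P\<close> acts as an abelian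
  group. One element \<open>p\<close> of a finite set is treated at a time, by passing from
  \<open>y\<close> to a point \<open>z\<close> at which \<open>y\<close> and its translate by
  \<open>p\<close> merge under \<open>P\<close>; compactness then passes from finite sets to
  \<open>P\<close>.\<close>

lemma stabilizer_fixed_point:
  assumes Y: "proximal_flow G T Y \<psi>" and P1: "P1 \<subseteq> P"
    and comm: "\<And>p q. p \<in> P \<Longrightarrow> q \<in> P \<Longrightarrow> inv (q \<otimes> p) \<otimes> (p \<otimes> q) \<in> P1"
    and fix1: "\<exists>y\<in>topspace Y. \<forall>p\<in>P1. \<psi> p y = y"
  shows "\<exists>y\<in>topspace Y. \<forall>p\<in>P. \<psi> p y = y"
proof -
  interpret Y: flow G T Y \<psi>
    using Y topspace_T unfolding proximal_flow_def by unfold_locales auto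
  have commute: "\<psi> p (\<psi> q y) = \<psi> q (\<psi> p y)"
    if pq: "p \<in> P" "q \<in> P" and y: "y \<in> topspace Y" "\<forall>c\<in>P1. \<psi> c y = y" for p q y
  proof -
    define c where "c = inv (q \<otimes> p) \<otimes> (p \<otimes> q)"
    have G: "p \<in> carrier G" "q \<in> carrier G" using pq P_closed by auto
    then have cG: "c \<in> carrier G" unfolding c_def by simp
    have eq: "(q \<otimes> p) \<otimes> c = p \<otimes> q"
      unfolding c_def using G by (simp add: m_assoc[symmetric])
    have "\<psi> p (\<psi> q y) = \<psi> ((q \<otimes> p) \<otimes> c) y" unfolding eq using G y(1) by (simp add: Y.act_mult)
    also have "\<dots> = \<psi> (q \<otimes> p) (\<psi> c y)" using G cG y(1) by (intro Y.act_mult) auto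
    also have "\<psi> c y = y" using comm[OF pq] y(2) unfolding c_def by blast
    also have "\<psi> (q \<otimes> p) y = \<psi> q (\<psi> p y)" using G y(1) by (simp add: Y.act_mult)
    finally show ?thesis .
  qed
  have fin: "\<exists>y\<in>topspace Y. (\<forall>p\<in>P1. \<psi> p y = y) \<and> (\<forall>p\<in>F. \<psi> p y = y)" if "finite F" "F \<subseteq> P" for F
    using that
  proof (induction F rule: finite_induct)
    case empty
    then show ?case using fix1 by simp
  next
    case (insert p F)
    then obtain y where y: "y \<in> topspace Y" "\<forall>p\<in>P1. \<psi> p y = y" "\<forall>p\<in>F. \<psi> p y = y" by auto
    have p: "p \<in> P" and pG: "p \<in> carrier G" using insert.prems P_closed by auto
    obtain z where z: "z \<in> topspace Y"
      and near: "\<And>U. openin Y U \<Longrightarrow> z \<in> U \<Longrightarrow> \<exists>q\<in>P. \<psi> q y \<in> U \<and> \<psi> q (\<psi> p y) \<in> U"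
      using stabilizer_proximal[OF Y y(1) Y.act_closed[OF pG y(1)]] by blast
    \<comment> \<open>Nothing gained earlier is lost: an \<open>s\<close> fixing \<open>y\<close>
      commutes at \<open>y\<close> with the elements \<open>q\<close> moving \<open>y\<close>
      towards \<open>z\<close>, so it fixes every \<open>\<psi> q y\<close>, and the fixed point set
      is closed. This covers both \<open>P1\<close> and the elements of \<open>F\<close>.\<close>
    have "\<psi> s z = z" if s: "s \<in> P" "\<psi> s y = y" for s
    proof -
      define C where "C = {x \<in> topspace Y. \<psi> s x = x}"
      have clC: "closedin Y C" unfolding C_def by (rule Y.closedin_fix[OF P_closed[OF s(1)]])
      have "\<psi> q y \<in> C" if q: "q \<in> P" for q
        using commute[OF s(1) q y(1,2)] s(2) Y.act_closed[OF P_closed[OF q] y(1)] unfolding C_def by simp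
      then have "z \<in> Y closure_of C"
        unfolding in_closure_of using z near by metis
      then show ?thesis using clC closure_of_closedin unfolding C_def by fastforce
    qed
    then have "\<forall>s\<in>P1. \<psi> s z = z" "\<forall>s\<in>F. \<psi> s z = z" using P1 insert.prems y by auto
    moreover have "\<psi> p z = z"
    proof (rule ccontr)
      assume "\<psi> p z \<noteq> z"
      then obtain U1 U2 where U: "openin Y U1" "openin Y U2" "z \<in> U1" "\<psi> p z \<in> U2" "disjnt U1 U2"
        using Y.Hausdorff z Y.act_closed[OF pG z] unfolding Hausdorff_space_def by metis
      define O' where "O' = {x \<in> topspace Y. \<psi> p x \<in> U2} \<inter> U1"
      have "openin Y O'" "z \<in> O'" unfolding O'_def using Y.openin_preimage[OF pG U(2)] U z by auto
      then obtain q where q: "q \<in> P" "\<psi> q y \<in> O'" "\<psi> q (\<psi> p y) \<in> O'" using near by blast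
      have "\<psi> p (\<psi> q y) = \<psi> q (\<psi> p y)" by (rule commute[OF p q(1) y(1,2)])
      then show False using q U(5) unfolding O'_def disjnt_def by auto
    qed
    ultimately show ?case using z by auto
  qed
  show ?thesis
  proof (rule Y.common_fixed_point)
    show "P \<subseteq> carrier G" using P_closed by blast
    show "P \<noteq> {}" using subgroup.one_closed[OF subgroup_P] by blast
    show "\<exists>x\<in>topspace Y. \<forall>g\<in>F. \<psi> g x = x" if "finite F" "F \<subseteq> P" for F
      using fin[OF that] by blast
  qed
qed

text \<open>The closure \<open>\<Gamma>\<close> of the graph of the orbit map is again a graph.
  Compactness of the product makes projections of its closed subsets closed, which yields totality
  (the orbit is dense) and continuity of \<open>f\<close>.\<close>

lemma factor_map:
  assumes Y: "minimal_flow G T Y \<psi>" and y0: "y0 \<in> topspace Y" "\<And>p. p \<in> P \<Longrightarrow> \<psi> p y0 = y0"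
  shows "\<exists>f. continuous_map X Y f \<and> f ` topspace X = topspace Y \<and> equivariant_on G (topspace X) \<phi> \<psi> f"
proof -
  interpret Y: flow G T Y \<psi>
    using Y topspace_T unfolding minimal_flow_def by unfold_locales auto
  let ?Z = "prod_topology X Y"
  define q where "q g = (\<phi> g x0, \<psi> g y0)" for g
  define \<Gamma> where "\<Gamma> = ?Z closure_of (q ` carrier G)"
  have q: "q g \<in> \<Gamma>" if "g \<in> carrier G" for g
  proof -
    have "q ` carrier G \<subseteq> topspace ?Z"
      unfolding q_def using Y.act_closed act_closed y0 x0 by auto
    then show ?thesis using that closure_of_subset unfolding \<Gamma>_def by blast
  qed
  have closed\<Gamma>: "closedin ?Z \<Gamma>" unfolding \<Gamma>_def by simp
  have cZ: "compact_space ?Z" by (simp add: compact_space_prod_topology Y.compact compact)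
  have inv: "(\<phi> g x, \<psi> g y) \<in> \<Gamma>" if g: "g \<in> carrier G" and xy: "(x, y) \<in> \<Gamma>" for g x y
  proof -
    define h where "h p = (\<phi> g (fst p), \<psi> g (snd p))" for p
    have "continuous_map ?Z ?Z h"
      unfolding h_def continuous_map_pairwise comp_def fst_conv snd_conv
      by (intro conjI continuous_map_compose[OF _ Y.continuous_act[OF g], unfolded comp_def]
          continuous_map_compose[OF _ continuous_act[OF g], unfolded comp_def]
          continuous_map_fst continuous_map_snd)
    then have "h ` \<Gamma> \<subseteq> ?Z closure_of (h ` (q ` carrier G))"
      unfolding \<Gamma>_def by (rule continuous_map_image_closure_subset)
    also have "h (q k) = q (g \<otimes> k)" if "k \<in> carrier G" for k
      unfolding h_def q_def using g that y0 x0 by (simp add: act_mult Y.act_mult)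
    then have "h ` (q ` carrier G) \<subseteq> q ` carrier G" using g by (auto simp: image_iff)
    then have "?Z closure_of (h ` (q ` carrier G)) \<subseteq> \<Gamma>"
      unfolding \<Gamma>_def by (rule closure_of_mono)
    finally have "h (x, y) \<in> \<Gamma>" using xy by blast
    then show ?thesis unfolding h_def by simp
  qed
  have same: "\<psi> g y0 = \<psi> h y0" if gh: "g \<in> carrier G" "h \<in> carrier G" "\<phi> g x0 = \<phi> h x0" for g h
  proof -
    have "inv h \<otimes> g \<in> P" using gh x0 unfolding stabilizer_def by (simp add: act_mult act_inv)
    then have "\<psi> h (\<psi> (inv h \<otimes> g) y0) = \<psi> h y0" using y0(2) by simp
    then show ?thesis using gh y0(1) by (simp add: Y.act_mult Y.act_inv Y.act_closed)
  qed
  have closed_proj: "closedin X (fst ` (\<Gamma> \<inter> (topspace X \<times> C)))" if C: "closedin Y C" for C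
  proof -
    have "closedin ?Z (\<Gamma> \<inter> (topspace X \<times> C))"
      using closed\<Gamma> C by (intro closedin_Int) (auto simp: closedin_prod_Times_iff)
    then have "compactin ?Z (\<Gamma> \<inter> (topspace X \<times> C))" using cZ by (rule closedin_compact_space[rotated])
    then have "compactin X (fst ` (\<Gamma> \<inter> (topspace X \<times> C)))"
      by (rule image_compactin) (rule continuous_map_fst)
    then show ?thesis using Hausdorff compactin_imp_closedin by blast
  qed
  have sub: "\<Gamma> \<subseteq> topspace X \<times> topspace Y" using closed\<Gamma> closedin_subset by fastforce
  have total: "\<exists>y. (x, y) \<in> \<Gamma>" if x: "x \<in> topspace X" for x
  proof -
    have "fst ` (\<Gamma> \<inter> (topspace X \<times> topspace Y)) = fst ` \<Gamma>" using sub by (simp add: Int_absorb2)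
    then have "closedin X (fst ` \<Gamma>)" using closed_proj[of "topspace Y"] by simp
    moreover have "orbit G \<phi> x0 \<subseteq> fst ` \<Gamma>"
      using q unfolding orbit_def q_def by force
    ultimately have "X closure_of (orbit G \<phi> x0) \<subseteq> fst ` \<Gamma>" by (simp add: closure_of_minimal)
    then have "x \<in> fst ` \<Gamma>" using closure_of_orbit[OF x0] x by blast
    then show ?thesis by auto
  qed
  \<comment> \<open>Two values over \<open>x\<close> would be approximated by
    \<open>\<psi> g y0\<close> and \<open>\<psi> h y0\<close> with both orbit points near
    \<open>x\<close>. Then a small \<open>v\<close> takes the first to the second, since by
    \<open>same\<close> a point of the orbit of \<open>x0\<close> determines the value; this
    contradicts \<open>separation\<close>.\<close>
  have unique: "y = y'" if xy: "(x, y) \<in> \<Gamma>" "(x, y') \<in> \<Gamma>" for x y y'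
  proof (rule ccontr)
    assume ne: "y \<noteq> y'"
    have top: "x \<in> topspace X" "y \<in> topspace Y" "y' \<in> topspace Y" using xy sub by auto
    obtain V U U' where V: "openin T V" "\<one> \<in> V" "openin Y U" "y \<in> U" "openin Y U'" "y' \<in> U'"
      "\<And>v z. v \<in> V \<Longrightarrow> z \<in> U \<Longrightarrow> \<psi> v z \<notin> U'"
      using Y.separation[OF top(2,3) ne] by blast
    obtain W where W: "openin X W" "x \<in> W"
      "\<And>g h. g \<in> carrier G \<Longrightarrow> h \<in> carrier G \<Longrightarrow> \<phi> g x0 \<in> W \<Longrightarrow> \<phi> h x0 \<in> W \<Longrightarrow> \<exists>v\<in>V. \<phi> v (\<phi> g x0) = \<phi> h x0"
      using small_transitive[OF top(1) V(1,2)] by blast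
    have "openin ?Z (W \<times> U)" "openin ?Z (W \<times> U')" using V W by (simp_all add: openin_prod_Times_iff)
    moreover have "(x, y) \<in> W \<times> U" "(x, y') \<in> W \<times> U'" using V W by auto
    ultimately obtain g h where g: "g \<in> carrier G" "q g \<in> W \<times> U" and h: "h \<in> carrier G" "q h \<in> W \<times> U'"
      using closure_of_image_meets[OF xy(1)[unfolded \<Gamma>_def]] closure_of_image_meets[OF xy(2)[unfolded \<Gamma>_def]]
      by metis
    obtain v where v: "v \<in> V" "\<phi> v (\<phi> g x0) = \<phi> h x0"
      using W(3)[OF g(1) h(1)] g(2) h(2) unfolding q_def by auto
    have vG: "v \<in> carrier G" using v(1) V(1) openin_subset topspace_T by blast
    have "\<psi> (v \<otimes> g) y0 = \<psi> h y0" using v vG g h x0 by (intro same) (auto simp: act_mult)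
    then have "\<psi> v (\<psi> g y0) = \<psi> h y0" using vG g y0 by (simp add: Y.act_mult)
    then show False using V(7)[OF v(1), of "\<psi> g y0"] g(2) h(2) unfolding q_def by auto
  qed
  define f where "f x = (THE y. (x, y) \<in> \<Gamma>)" for x
  have f: "(x, f x) \<in> \<Gamma>" if "x \<in> topspace X" for x
    unfolding f_def using total[OF that] unique by (metis theI)
  have fI: "f x = y" if "(x, y) \<in> \<Gamma>" for x y
    using f[of x] unique that sub by blast
  have fY: "f x \<in> topspace Y" if "x \<in> topspace X" for x using f[OF that] sub by blast
  have cont: "continuous_map X Y f"
    unfolding continuous_map_closedin
  proof (intro conjI allI impI)
    fix C assume C: "closedin Y C"
    have "{x \<in> topspace X. f x \<in> C} = fst ` (\<Gamma> \<inter> (topspace X \<times> C))"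
    proof (intro equalityI subsetI)
      fix x assume "x \<in> {x \<in> topspace X. f x \<in> C}"
      then show "x \<in> fst ` (\<Gamma> \<inter> (topspace X \<times> C))" using f[of x] by (intro image_eqI[of _ _ "(x, f x)"]) auto
    qed (use fI in auto)
    then show "closedin X {x \<in> topspace X. f x \<in> C}" using closed_proj[OF C] by simp
  qed (use fY in auto)
  have equi: "f (\<phi> g x) = \<psi> g (f x)" if "g \<in> carrier G" "x \<in> topspace X" for g x
    using fI[OF inv[OF that(1) f[OF that(2)]]] .
  have "f ` topspace X = topspace Y"
  proof
    show "f ` topspace X \<subseteq> topspace Y" using fY by blast
    have "compactin Y (f ` topspace X)"
      using image_compactin[OF _ cont] compact unfolding compact_space_def by blast
    then have "closedin Y (f ` topspace X)" using Y.Hausdorff compactin_imp_closedin by blast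
    moreover have "orbit G \<psi> (f x0) \<subseteq> f ` topspace X"
    proof
      fix y assume "y \<in> orbit G \<psi> (f x0)"
      then obtain g where "g \<in> carrier G" "y = \<psi> g (f x0)" unfolding orbit_def by blast
      then show "y \<in> f ` topspace X" using equi[OF _ x0] act_closed[OF _ x0] by (metis image_eqI)
    qed
    ultimately have "Y closure_of (orbit G \<psi> (f x0)) \<subseteq> f ` topspace X" by (simp add: closure_of_minimal)
    moreover have "Y closure_of (orbit G \<psi> (f x0)) = topspace Y"
      using Y fY[OF x0] unfolding minimal_flow_def by simp
    ultimately show "topspace Y \<subseteq> f ` topspace X" by simp
  qed
  then show ?thesis using cont equi unfolding equivariant_on_def by blast
qed

subsection \<open>The completion of the orbit\<close>

abbreviation "C \<equiv> lcosets P"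
abbreviation "U \<equiv> coset_uniformity G T P"

text \<open>This identifies \<open>G/P\<close> with the orbit of \<open>x0\<close>; the chosen
  representative is irrelevant because \<open>P\<close> fixes \<open>x0\<close>.\<close>

definition orbit_point where "orbit_point c = \<phi> (SOME g. g \<in> c) x0"

lemma orbit_point:
  assumes g: "g \<in> carrier G" shows "orbit_point (g <# P) = \<phi> g x0"
proof -
  have "g \<in> g <# P" by (rule lcos_self[OF g subgroup_P])
  then have "(SOME h. h \<in> g <# P) \<in> g <# P" by (rule someI)
  then obtain p where p: "p \<in> P" "(SOME h. h \<in> g <# P) = g \<otimes> p" unfolding l_coset_def by blast
  then show ?thesis unfolding orbit_point_def using g P_closed P_fix x0 by (simp add: act_mult)
qed

lemma coset_eq:
  assumes gh: "g \<in> carrier G" "h \<in> carrier G" "\<phi> g x0 = \<phi> h x0"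
  shows "g <# P = h <# P"
proof -
  have P: "inv h \<otimes> g \<in> P" using gh x0 unfolding stabilizer_def by (simp add: act_mult act_inv)
  have "g = h \<otimes> (inv h \<otimes> g)" using gh by (simp add: m_assoc[symmetric])
  then have "g \<in> h <# P" using P unfolding l_coset_def by blast
  then show ?thesis using l_repr_independence[OF _ gh(2) subgroup_P] by simp
qed

lemma C_E: "c \<in> C \<Longrightarrow> (\<And>g. g \<in> carrier G \<Longrightarrow> c = g <# P \<Longrightarrow> thesis) \<Longrightarrow> thesis"
  unfolding LCOSETS_def by blast

lemma C_I: "g \<in> carrier G \<Longrightarrow> g <# P \<in> C"
  unfolding LCOSETS_def by blast

text \<open>The condition that \<open>g \<otimes> inv h\<close> lies in \<open>V\<close> means that
  \<open>g = v \<otimes> h\<close> with \<open>v\<close> in \<open>V\<close>. Thus two cosets are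
  close when their orbit points differ by a small element acting on the left, which is the form
  provided by \<open>small_transitive\<close>.\<close>

lemma eventually_U:
  "eventually R U \<longleftrightarrow> (\<exists>V. openin T V \<and> \<one> \<in> V \<and> (\<forall>v\<in>V. \<forall>h\<in>carrier G. R ((v \<otimes> h) <# P, h <# P)))"
proof -
  let ?B = "{V. openin T V \<and> \<one> \<in> V}"
  let ?E = "\<lambda>V. {(g, h). g \<in> carrier G \<and> h \<in> carrier G \<and> g \<otimes> inv h \<in> V}"
  have "openin T (carrier G)" using topspace_T openin_topspace by metis
  then have ne: "?B \<noteq> {}" by blast
  have "\<exists>W\<in>?B. principal (?E W) \<le> inf (principal (?E V)) (principal (?E V'))" if "V \<in> ?B" "V' \<in> ?B" for V V'
    using that by (intro bexI[of _ "V \<inter> V'"]) auto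
  from eventually_INF_base[OF ne this]
  have "eventually R U \<longleftrightarrow> (\<exists>V\<in>?B. eventually (\<lambda>(g, h). R (g <# P, h <# P)) (principal (?E V)))"
    unfolding coset_uniformity_def right_uniformity_def eventually_filtermap by (simp add: split_def)
  also have "\<dots> \<longleftrightarrow> (\<exists>V\<in>?B. \<forall>v\<in>V. \<forall>h\<in>carrier G. R ((v \<otimes> h) <# P, h <# P))"
  proof (intro bex_cong refl)
    fix V assume V: "V \<in> ?B"
    then have VG: "V \<subseteq> carrier G" using openin_subset topspace_T by blast
    show "eventually (\<lambda>(g, h). R (g <# P, h <# P)) (principal (?E V)) \<longleftrightarrow>
      (\<forall>v\<in>V. \<forall>h\<in>carrier G. R ((v \<otimes> h) <# P, h <# P))"
    proof
      assume L: "eventually (\<lambda>(g, h). R (g <# P, h <# P)) (principal (?E V))"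
      show "\<forall>v\<in>V. \<forall>h\<in>carrier G. R ((v \<otimes> h) <# P, h <# P)"
      proof (intro ballI)
        fix v h assume vh: "v \<in> V" "h \<in> carrier G"
        then have "(v \<otimes> h, h) \<in> ?E V" using VG by (auto simp: m_assoc)
        then show "R ((v \<otimes> h) <# P, h <# P)" using L unfolding eventually_principal by fastforce
      qed
    next
      assume R: "\<forall>v\<in>V. \<forall>h\<in>carrier G. R ((v \<otimes> h) <# P, h <# P)"
      show "eventually (\<lambda>(g, h). R (g <# P, h <# P)) (principal (?E V))"
        unfolding eventually_principal
      proof clarify
        fix g h assume gh: "g \<in> carrier G" "h \<in> carrier G" "g \<otimes> inv h \<in> V"
        then have "(g \<otimes> inv h) \<otimes> h = g" by (simp add: m_assoc)
        then show "R (g <# P, h <# P)" using R gh by metis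
      qed
    qed
  qed
  finally show ?thesis by blast
qed

text \<open>The trace on the orbit of the neighbourhood filter of \<open>x\<close>, transferred to
  \<open>G/P\<close>. These filters turn out to be the points of the completion, also for those
  \<open>x\<close> that lie outside the orbit.\<close>

definition nbhd_filter where
  "nbhd_filter x = (INF W\<in>{W. openin X W \<and> x \<in> W}. principal {c \<in> C. orbit_point c \<in> W})"

lemma eventually_nbhd_filter:
  assumes x: "x \<in> topspace X"
  shows "eventually R (nbhd_filter x) \<longleftrightarrow>
    (\<exists>W. openin X W \<and> x \<in> W \<and> (\<forall>g\<in>carrier G. \<phi> g x0 \<in> W \<longrightarrow> R (g <# P)))"
proof -
  let ?B = "{W. openin X W \<and> x \<in> W}"
  let ?E = "\<lambda>W. {c \<in> C. orbit_point c \<in> W}"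
  have ne: "?B \<noteq> {}" using x openin_topspace by blast
  have "\<exists>W\<in>?B. principal (?E W) \<le> inf (principal (?E V)) (principal (?E V'))" if "V \<in> ?B" "V' \<in> ?B" for V V'
    using that by (intro bexI[of _ "V \<inter> V'"]) auto
  from eventually_INF_base[OF ne this]
  have "eventually R (nbhd_filter x) \<longleftrightarrow> (\<exists>W\<in>?B. \<forall>c\<in>?E W. R c)"
    unfolding nbhd_filter_def by (simp add: eventually_principal)
  also have "\<dots> \<longleftrightarrow> (\<exists>W\<in>?B. \<forall>g\<in>carrier G. \<phi> g x0 \<in> W \<longrightarrow> R (g <# P))"
    using C_I orbit_point by (intro bex_cong refl) (auto elim!: C_E)
  finally show ?thesis by blast
qed

lemma nbhd_filter_ne_bot:
  assumes x: "x \<in> topspace X" shows "nbhd_filter x \<noteq> bot"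
proof
  assume "nbhd_filter x = bot"
  then have "eventually (\<lambda>_. False) (nbhd_filter x)" by simp
  then obtain W where "openin X W" "x \<in> W" "\<forall>g\<in>carrier G. \<phi> g x0 \<notin> W"
    unfolding eventually_nbhd_filter[OF x] by blast
  then show False using orbit_dense by blast
qed

lemma cauchy_nbhd_filter:
  assumes x: "x \<in> topspace X" shows "cauchy_filter_on C U (nbhd_filter x)"
  unfolding cauchy_filter_on_def
proof (intro conjI)
  show "nbhd_filter x \<noteq> bot" by (rule nbhd_filter_ne_bot[OF x])
  show "nbhd_filter x \<le> principal C"
    unfolding le_principal eventually_nbhd_filter[OF x] using x C_I openin_topspace by blast
  show "nbhd_filter x \<times>\<^sub>F nbhd_filter x \<le> U"
  proof (rule filter_leI)
    fix R assume "eventually R U"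
    then obtain V where V: "openin T V" "\<one> \<in> V" "\<And>v h. v \<in> V \<Longrightarrow> h \<in> carrier G \<Longrightarrow> R ((v \<otimes> h) <# P, h <# P)"
      unfolding eventually_U by blast
    obtain W where W: "openin X W" "x \<in> W"
      "\<And>g h. g \<in> carrier G \<Longrightarrow> h \<in> carrier G \<Longrightarrow> \<phi> g x0 \<in> W \<Longrightarrow> \<phi> h x0 \<in> W \<Longrightarrow> \<exists>v\<in>V. \<phi> v (\<phi> g x0) = \<phi> h x0"
      using small_transitive[OF x V(1,2)] by blast
    define M where "M c \<longleftrightarrow> (\<exists>g\<in>carrier G. c = g <# P \<and> \<phi> g x0 \<in> W)" for c
    have "eventually M (nbhd_filter x)" unfolding eventually_nbhd_filter[OF x] M_def using W by blast
    moreover have "R (c, d)" if cd: "M c" "M d" for c d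
    proof -
      obtain g h where g: "g \<in> carrier G" "c = g <# P" "\<phi> g x0 \<in> W"
        and h: "h \<in> carrier G" "d = h <# P" "\<phi> h x0 \<in> W" using cd unfolding M_def by blast
      obtain v where v: "v \<in> V" "\<phi> v (\<phi> h x0) = \<phi> g x0" using W(3) g h by blast
      have vG: "v \<in> carrier G" using v(1) V(1) openin_subset topspace_T by blast
      have "(v \<otimes> h) <# P = g <# P" using v vG g h x0 by (intro coset_eq) (auto simp: act_mult)
      then show ?thesis using V(3)[OF v(1) h(1)] g h by simp
    qed
    ultimately show "eventually R (nbhd_filter x \<times>\<^sub>F nbhd_filter x)"
      unfolding eventually_prod_filter by blast
  qed
qed

text \<open>By compactness the filter has a cluster point \<open>x\<close>, and a Cauchy filter
  converges to any cluster point: one orbit point \<open>d\<close> close to \<open>x\<close> is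
  enough, since all others in a small member are \<open>\<phi> v\<close> of it with \<open>v\<close>
  in \<open>V\<close>.\<close>

lemma cauchy_le_nbhd_filter:
  assumes F: "cauchy_filter_on C U F"
  shows "\<exists>x\<in>topspace X. F \<le> nbhd_filter x"
proof -
  have Fb: "F \<noteq> bot" and FC: "eventually (\<lambda>c. c \<in> C) F" and FU: "F \<times>\<^sub>F F \<le> U"
    using F unfolding cauchy_filter_on_def le_principal by auto
  define K where "K M = X closure_of (orbit_point ` (M \<inter> C))" for M
  define \<M> where "\<M> = {M. eventually (\<lambda>c. c \<in> M) F}"
  have op: "orbit_point c \<in> topspace X" if "c \<in> C" for c
    using that by (elim C_E) (simp add: orbit_point act_closed x0)
  have "(\<Inter>M\<in>\<M>. K M) \<noteq> {}"
  proof (rule compact_space_fip_image[OF compact])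
    show "closedin X (K M)" for M unfolding K_def by simp
    fix \<N> assume \<N>: "finite \<N>" "\<N> \<subseteq> \<M>"
    have "eventually (\<lambda>c. \<forall>M\<in>\<N>. c \<in> M) F"
      using \<N> unfolding \<M>_def by (intro eventually_ball_finite) auto
    then have "eventually (\<lambda>c. (\<forall>M\<in>\<N>. c \<in> M) \<and> c \<in> C) F" using FC by (rule eventually_conj)
    then obtain c where c: "\<forall>M\<in>\<N>. c \<in> M" "c \<in> C" using Fb eventually_happens' by blast
    have "orbit_point c \<in> K M" if "M \<in> \<N>" for M
    proof -
      have "orbit_point ` (M \<inter> C) \<subseteq> K M" unfolding K_def using op by (intro closure_of_subset) auto
      then show ?thesis using c that by blast
    qed
    then show "(\<Inter>M\<in>\<N>. K M) \<noteq> {}" by blast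
  qed
  then obtain x where x: "\<And>M. M \<in> \<M> \<Longrightarrow> x \<in> K M" by blast
  have "C \<in> \<M>" unfolding \<M>_def using FC by simp
  then have xX: "x \<in> topspace X" using x unfolding K_def by (meson closure_of_subset_topspace subsetD)
  have "eventually (\<lambda>c. c \<in> {c \<in> C. orbit_point c \<in> W}) F" if W: "openin X W" "x \<in> W" for W
  proof -
    obtain V O' where VO: "openin T V" "\<one> \<in> V" "openin X O'" "x \<in> O'"
      "\<And>h y. h \<in> V \<Longrightarrow> y \<in> O' \<Longrightarrow> \<phi> h y \<in> W" using nbhd_one[OF W] by blast
    define R where "R = (\<lambda>(c, d). \<exists>v\<in>V. orbit_point c = \<phi> v (orbit_point d))"
    have VG: "V \<subseteq> carrier G" using VO(1) openin_subset topspace_T by blast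
    have "R ((v \<otimes> h) <# P, h <# P)" if "v \<in> V" "h \<in> carrier G" for v h
      unfolding R_def using that VG x0 by (auto simp: orbit_point act_mult subset_iff)
    then have "eventually R U" unfolding eventually_U using VO by blast
    then have "eventually R (F \<times>\<^sub>F F)" using FU filter_leD by blast
    then obtain M N where MN: "eventually M F" "eventually N F" "\<And>c d. M c \<Longrightarrow> N d \<Longrightarrow> R (c, d)"
      unfolding eventually_prod_filter by blast
    have "Collect N \<in> \<M>" unfolding \<M>_def using MN(2) by simp
    from closure_of_image_meets[OF x[OF this, unfolded K_def] VO(3,4)]
    obtain d where d: "N d" "d \<in> C" "orbit_point d \<in> O'" by blast
    have "orbit_point c \<in> W" if "M c" for c
      using MN(3)[OF that d(1)] VO(5) d(3) unfolding R_def by auto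
    moreover have "eventually (\<lambda>c. M c \<and> c \<in> C) F" using MN(1) FC by (rule eventually_conj)
    ultimately show ?thesis by (auto elim!: eventually_mono)
  qed
  then have "F \<le> nbhd_filter x"
    unfolding nbhd_filter_def by (auto intro!: INF_greatest simp: le_principal)
  then show ?thesis using xX by blast
qed

lemma nbhd_filter_le_imp_eq:
  assumes "x \<in> topspace X" "y \<in> topspace X" "nbhd_filter x \<le> nbhd_filter y"
  shows "x = y"
proof (rule ccontr)
  assume "x \<noteq> y"
  then obtain W1 W2 where W: "openin X W1" "openin X W2" "x \<in> W1" "y \<in> W2" "disjnt W1 W2"
    using Hausdorff assms unfolding Hausdorff_space_def by blast
  have "eventually (\<lambda>c. orbit_point c \<in> W2) (nbhd_filter y)"
    unfolding eventually_nbhd_filter[OF assms(2)] using W by (auto simp: orbit_point)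
  then have "eventually (\<lambda>c. orbit_point c \<in> W2) (nbhd_filter x)" using assms(3) filter_leD by blast
  moreover have "eventually (\<lambda>c. orbit_point c \<in> W1) (nbhd_filter x)"
    unfolding eventually_nbhd_filter[OF assms(1)] using W by (auto simp: orbit_point)
  ultimately have "eventually (\<lambda>c. False) (nbhd_filter x)"
    by eventually_elim (use W(5) in \<open>auto simp: disjnt_def\<close>)
  then show False using nbhd_filter_ne_bot[OF assms(1)] by simp
qed

text \<open>Every Cauchy filter refines some \<open>nbhd_filter x\<close>, and by the Hausdorff
  property two of these are comparable only if they are equal. Hence they are exactly the coarsest
  Cauchy filters, which is what minimality means in Bourbaki's order.\<close>

lemma completion_eq: "completion C U = nbhd_filter ` topspace X"
proof (intro equalityI subsetI)
  fix F assume F: "F \<in> completion C U"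
  then have cF: "cauchy_filter_on C U F" unfolding completion_def by blast
  obtain x where x: "x \<in> topspace X" "F \<le> nbhd_filter x" using cauchy_le_nbhd_filter[OF cF] by blast
  then have "nbhd_filter x = F" using F cauchy_nbhd_filter unfolding completion_def by blast
  then show "F \<in> nbhd_filter ` topspace X" using x by blast
next
  fix F assume "F \<in> nbhd_filter ` topspace X"
  then obtain x where x: "x \<in> topspace X" "F = nbhd_filter x" by blast
  have "F' = F" if F': "cauchy_filter_on C U F'" "F \<le> F'" for F'
  proof -
    obtain y where y: "y \<in> topspace X" "F' \<le> nbhd_filter y" using cauchy_le_nbhd_filter[OF F'(1)] by blast
    have "x = y" using nbhd_filter_le_imp_eq x y F'(2) order_trans by metis
    then show ?thesis using x y F'(2) by (simp add: order_antisym)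
  qed
  then show "F \<in> completion C U" unfolding completion_def using cauchy_nbhd_filter x by blast
qed

lemma eventually_completion_uniformity:
  "eventually R (completion_uniformity C U) \<longleftrightarrow> (\<exists>E. eventually (\<lambda>p. p \<in> E) U \<and>
     (\<forall>F\<in>completion C U. \<forall>F'\<in>completion C U. \<forall>M. M \<times> M \<subseteq> E \<longrightarrow> eventually (\<lambda>c. c \<in> M) F \<longrightarrow>
       eventually (\<lambda>c. c \<in> M) F' \<longrightarrow> R (F, F')))"
proof -
  let ?B = "{E. eventually (\<lambda>p. p \<in> E) U}"
  let ?S = "\<lambda>E. {(F, F'). F \<in> completion C U \<and> F' \<in> completion C U \<and>
          (\<exists>M. M \<times> M \<subseteq> E \<and> eventually (\<lambda>x. x \<in> M) F \<and> eventually (\<lambda>x. x \<in> M) F')}"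
  have ne: "?B \<noteq> {}" by (auto intro!: exI[of _ UNIV])
  have "\<exists>D\<in>?B. principal (?S D) \<le> inf (principal (?S E)) (principal (?S E'))" if "E \<in> ?B" "E' \<in> ?B" for E E'
  proof (intro bexI[of _ "E \<inter> E'"])
    show "E \<inter> E' \<in> ?B" using that by (auto intro: eventually_conj)
    have "?S (E \<inter> E') \<subseteq> ?S E \<inter> ?S E'" by blast
    then show "principal (?S (E \<inter> E')) \<le> inf (principal (?S E)) (principal (?S E'))" by simp
  qed
  from eventually_INF_base[OF ne this]
  have "eventually R (completion_uniformity C U) \<longleftrightarrow> (\<exists>E\<in>?B. \<forall>p\<in>?S E. R p)"
    unfolding completion_uniformity_def by (simp add: eventually_principal)
  then show ?thesis by blast
qed

text \<open>In terms of uniformities the map \<open>nbhd_filter\<close> is a homeomorphism. From the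
  completion to \<open>X\<close>, a small member of \<open>nbhd_filter x\<close> serves at once for
  all points near \<open>x\<close>; in the other direction the regularity of \<open>X\<close> is
  used.\<close>

lemma openin_completion:
  "openin (completion_topology C U) S \<longleftrightarrow>
     S \<subseteq> nbhd_filter ` topspace X \<and> openin X {x \<in> topspace X. nbhd_filter x \<in> S}"
proof -
  have "openin X {x \<in> topspace X. nbhd_filter x \<in> S}"
    if op: "openin (completion_topology C U) S"
  proof (subst openin_subopen, clarify)
    fix x assume x: "x \<in> topspace X" "nbhd_filter x \<in> S"
    have "eventually (\<lambda>(F, F'). F = nbhd_filter x \<longrightarrow> F' \<in> S) (completion_uniformity C U)"
      using op x(2) unfolding completion_topology_def openin_topology_of_uniformity by blast
    then obtain E where E: "eventually (\<lambda>p. p \<in> E) U"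
      and ES0: "\<forall>F\<in>completion C U. \<forall>F'\<in>completion C U. \<forall>M. M \<times> M \<subseteq> E \<longrightarrow>
        eventually (\<lambda>c. c \<in> M) F \<longrightarrow> eventually (\<lambda>c. c \<in> M) F' \<longrightarrow>
        (case (F, F') of (F, F') \<Rightarrow> F = nbhd_filter x \<longrightarrow> F' \<in> S)"
      unfolding eventually_completion_uniformity by (elim exE conjE) (rule that)
    have "nbhd_filter x \<in> completion C U" using x(1) completion_eq by simp
    from ES0[rule_format, OF this]
    have ES: "F' \<in> S" if "F' \<in> completion C U" "M \<times> M \<subseteq> E" "eventually (\<lambda>c. c \<in> M) (nbhd_filter x)"
        "eventually (\<lambda>c. c \<in> M) F'" for F' M
      using that by simp
    have "eventually (\<lambda>p. p \<in> E) (nbhd_filter x \<times>\<^sub>F nbhd_filter x)"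
      using cauchy_nbhd_filter[OF x(1)] E filter_leD unfolding cauchy_filter_on_def by blast
    then obtain M1 M2 where M12: "eventually M1 (nbhd_filter x)" "eventually M2 (nbhd_filter x)"
      "\<And>c d. M1 c \<Longrightarrow> M2 d \<Longrightarrow> (c, d) \<in> E"
      unfolding eventually_prod_filter by blast
    define M where "M = {c. M1 c \<and> M2 c}"
    have "eventually (\<lambda>c. c \<in> M) (nbhd_filter x)" unfolding M_def using M12(1,2) by (simp add: eventually_conj)
    then obtain W where W: "openin X W" "x \<in> W" "\<And>g. g \<in> carrier G \<Longrightarrow> \<phi> g x0 \<in> W \<Longrightarrow> g <# P \<in> M"
      and Mx: "eventually (\<lambda>c. c \<in> M) (nbhd_filter x)"
      unfolding eventually_nbhd_filter[OF x(1)] by blast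
    have "nbhd_filter y \<in> S" if y: "y \<in> W" for y
    proof (rule ES[of _ M])
      have yX: "y \<in> topspace X" using y W(1) openin_subset by blast
      show "nbhd_filter y \<in> completion C U" unfolding completion_eq using yX by blast
      show "M \<times> M \<subseteq> E" using M12(3) unfolding M_def by blast
      show "eventually (\<lambda>c. c \<in> M) (nbhd_filter y)"
        unfolding eventually_nbhd_filter[OF yX] using W y by blast
    qed (rule Mx)
    then show "\<exists>T. openin X T \<and> x \<in> T \<and> T \<subseteq> {x \<in> topspace X. nbhd_filter x \<in> S}"
      using W openin_subset[OF W(1)] by (intro exI[of _ W]) auto
  qed
  moreover have "openin (completion_topology C U) S"
    if S: "S \<subseteq> nbhd_filter ` topspace X" and op: "openin X {x \<in> topspace X. nbhd_filter x \<in> S}"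
    unfolding completion_topology_def openin_topology_of_uniformity
  proof (intro conjI ballI)
    show "S \<subseteq> completion C U" using S completion_eq by simp
    fix F assume F: "F \<in> S"
    then obtain x where x: "x \<in> topspace X" "F = nbhd_filter x" using S by blast
    \<comment> \<open>A filter close to \<open>nbhd_filter x\<close> is known only through its orbit
      points, which land in \<open>W1\<close>. Its limit \<open>y\<close> is then merely in the
      closure, so a closed \<open>D\<close> between \<open>W1\<close> and the given open set is
      needed.\<close>
    have "neighbourhood_base_of (closedin X) X"
      using compact Hausdorff compact_Hausdorff_imp_regular_space neighbourhood_base_of_closedin by metis
    moreover have "x \<in> {x \<in> topspace X. nbhd_filter x \<in> S}" using x F by simp
    ultimately obtain W1 D where W1: "openin X W1" "closedin X D" "x \<in> W1" "W1 \<subseteq> D"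
      "D \<subseteq> {x \<in> topspace X. nbhd_filter x \<in> S}"
      using op unfolding neighbourhood_base_of by meson
    obtain V O' where VO: "openin T V" "\<one> \<in> V" "openin X O'" "x \<in> O'"
      "\<And>h y. h \<in> V \<Longrightarrow> y \<in> O' \<Longrightarrow> \<phi> h y \<in> W1" using nbhd_one[OF W1(1) W1(3)] by blast
    have VG: "V \<subseteq> carrier G" using VO(1) openin_subset topspace_T by blast
    define E where "E = {(c, d). \<exists>v\<in>V. orbit_point c = \<phi> v (orbit_point d)}"
    have "((v \<otimes> h) <# P, h <# P) \<in> E" if "v \<in> V" "h \<in> carrier G" for v h
      unfolding E_def using that VG x0 by (auto simp: orbit_point act_mult subset_iff)
    then have EU: "eventually (\<lambda>p. p \<in> E) U" unfolding eventually_U using VO by blast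
    have "F' \<in> S" if F': "F' \<in> completion C U" and M: "M \<times> M \<subseteq> E" "eventually (\<lambda>c. c \<in> M) F"
      "eventually (\<lambda>c. c \<in> M) F'" for F' M
    proof -
      obtain y where y: "y \<in> topspace X" "F' = nbhd_filter y" using F' completion_eq by blast
      obtain W2 where W2: "openin X W2" "x \<in> W2" "\<And>g. g \<in> carrier G \<Longrightarrow> \<phi> g x0 \<in> W2 \<Longrightarrow> g <# P \<in> M"
        using M(2) unfolding x(2) eventually_nbhd_filter[OF x(1)] by blast
      have "openin X (W2 \<inter> O')" "W2 \<inter> O' \<noteq> {}" using W2 VO by auto
      then obtain g where g: "g \<in> carrier G" "\<phi> g x0 \<in> W2 \<inter> O'" using orbit_dense by blast
      then have gM: "g <# P \<in> M" using W2 by blast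
      obtain W3 where W3: "openin X W3" "y \<in> W3" "\<And>g. g \<in> carrier G \<Longrightarrow> \<phi> g x0 \<in> W3 \<Longrightarrow> g <# P \<in> M"
        using M(3) unfolding y(2) eventually_nbhd_filter[OF y(1)] by blast
      have inD: "\<phi> h x0 \<in> D" if h: "h \<in> carrier G" "\<phi> h x0 \<in> W3" for h
      proof -
        have "(h <# P, g <# P) \<in> E" using M(1) gM W3(3)[OF h] by blast
        then obtain v where "v \<in> V" "\<phi> h x0 = \<phi> v (\<phi> g x0)"
          unfolding E_def using h g by (auto simp: orbit_point)
        then show ?thesis using VO(5) g(2) W1(4) by auto
      qed
      have "y \<in> X closure_of D"
        unfolding in_closure_of
      proof (intro conjI allI impI)
        fix A assume "y \<in> A \<and> openin X A"
        then have "openin X (A \<inter> W3)" "A \<inter> W3 \<noteq> {}" using W3 by auto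
        then obtain h where "h \<in> carrier G" "\<phi> h x0 \<in> A \<inter> W3" using orbit_dense by blast
        then show "\<exists>z. z \<in> D \<and> z \<in> A" using inD by blast
      qed (rule y(1))
      then have "y \<in> D" using W1(2) closure_of_closedin by metis
      then show ?thesis using W1(5) y(2) by blast
    qed
    then show "eventually (\<lambda>(F'', F'). F'' = F \<longrightarrow> F' \<in> S) (completion_uniformity C U)"
      unfolding eventually_completion_uniformity using EU by (intro exI[of _ E]) auto
  qed
  moreover have "S \<subseteq> nbhd_filter ` topspace X" if "openin (completion_topology C U) S"
    using that unfolding completion_topology_def openin_topology_of_uniformity completion_eq by blast
  ultimately show ?thesis by blast
qed

text \<open>Only one inequality is proved directly; the other is that inequality for
  \<open>inv g\<close> at the translated point, pushed forward by \<open>g\<close>. The two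
  translations cancel only on genuine cosets, hence the detour through
  \<open>eventually_subst\<close>.\<close>

lemma filtermap_nbhd_filter:
  assumes g: "g \<in> carrier G" and x: "x \<in> topspace X"
  shows "filtermap (\<lambda>c. g <# c) (nbhd_filter x) = nbhd_filter (\<phi> g x)"
proof -
  have le: "filtermap (\<lambda>c. g <# c) (nbhd_filter x) \<le> nbhd_filter (\<phi> g x)"
    if g: "g \<in> carrier G" and x: "x \<in> topspace X" for g x
  proof (rule filter_leI)
    fix R assume "eventually R (nbhd_filter (\<phi> g x))"
    then obtain W where W: "openin X W" "\<phi> g x \<in> W" "\<And>h. h \<in> carrier G \<Longrightarrow> \<phi> h x0 \<in> W \<Longrightarrow> R (h <# P)"
      unfolding eventually_nbhd_filter[OF act_closed[OF g x]] by blast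
    have "R (g <# (h <# P))" if h: "h \<in> carrier G" "\<phi> h x0 \<in> {x \<in> topspace X. \<phi> g x \<in> W}" for h
    proof -
      have "g <# (h <# P) = (g \<otimes> h) <# P" using lcos_m_assoc[OF subgroup.subset[OF subgroup_P] g h(1)] .
      then show ?thesis using W(3)[of "g \<otimes> h"] g h x0 by (simp add: act_mult)
    qed
    then show "eventually R (filtermap (\<lambda>c. g <# c) (nbhd_filter x))"
      unfolding eventually_filtermap eventually_nbhd_filter[OF x]
      using openin_preimage[OF g W(1)] W(2) x by (intro exI[of _ "{x \<in> topspace X. \<phi> g x \<in> W}"]) auto
  qed
  have "filtermap (\<lambda>c. inv g <# c) (nbhd_filter (\<phi> g x)) \<le> nbhd_filter x"
    using le[of "inv g" "\<phi> g x"] g x by (simp add: act_closed act_inv)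
  then have "filtermap (\<lambda>c. g <# c) (filtermap (\<lambda>c. inv g <# c) (nbhd_filter (\<phi> g x)))
    \<le> filtermap (\<lambda>c. g <# c) (nbhd_filter x)" by (rule filtermap_mono)
  moreover have "filtermap (\<lambda>c. g <# c) (filtermap (\<lambda>c. inv g <# c) (nbhd_filter (\<phi> g x))) = nbhd_filter (\<phi> g x)"
  proof -
    have "eventually (\<lambda>c. g <# (inv g <# c) = c) (nbhd_filter (\<phi> g x))"
      unfolding eventually_nbhd_filter[OF act_closed[OF g x]]
    proof (intro exI[of _ "topspace X"] conjI ballI impI)
      fix h assume h: "h \<in> carrier G"
      have "P \<subseteq> carrier G" using P_closed by blast
      then show "g <# (inv g <# (h <# P)) = h <# P"
        using g h by (simp add: lcos_m_assoc m_assoc[symmetric])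
    qed (use g x act_closed in auto)
    then have "eventually (\<lambda>c. R (g <# (inv g <# c)) = R c) (nbhd_filter (\<phi> g x))" for R
      by (rule eventually_mono) simp
    from eventually_subst[OF this] show ?thesis
      by (simp add: filter_eq_iff eventually_filtermap)
  qed
  ultimately show ?thesis using le[OF g x] by (simp add: order_antisym)
qed

theorem isomorphic_completion:
  "isomorphic_flows G T X \<phi> (coset_completion_topology G T P) (coset_completion_action G T P)"
proof -
  let ?Y = "coset_completion_topology G T P" and ?\<psi> = "coset_completion_action G T P"
  have Y: "?Y = completion_topology C U" unfolding coset_completion_topology_def ..
  have topY: "topspace ?Y = nbhd_filter ` topspace X"
  proof
    show "topspace ?Y \<subseteq> nbhd_filter ` topspace X"
      using openin_completion[of "topspace ?Y"] Y openin_topspace by metis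
    have "{x \<in> topspace X. nbhd_filter x \<in> nbhd_filter ` topspace X} = topspace X" by blast
    then have "openin ?Y (nbhd_filter ` topspace X)" unfolding Y openin_completion by simp
    then show "nbhd_filter ` topspace X \<subseteq> topspace ?Y" by (rule openin_subset)
  qed
  have hom: "homeomorphic_map X ?Y nbhd_filter"
    unfolding homeomorphic_map_def quotient_map_def
  proof (intro conjI allI impI)
    show "nbhd_filter ` topspace X = topspace ?Y" using topY by simp
    fix S assume "S \<subseteq> topspace ?Y"
    then have "S \<subseteq> nbhd_filter ` topspace X" using topY by simp
    then show "openin X {x \<in> topspace X. nbhd_filter x \<in> S} = openin ?Y S"
      unfolding Y openin_completion by blast
  next
    show "inj_on nbhd_filter (topspace X)" using nbhd_filter_le_imp_eq by (auto intro!: inj_onI)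
  qed
  have eq: "nbhd_filter (\<phi> g x) = ?\<psi> g (nbhd_filter x)" if "g \<in> carrier G" "x \<in> topspace X" for g x
    unfolding coset_completion_action_def completion_eq using that by (simp add: filtermap_nbhd_filter)
  have ext: "?\<psi> g \<in> extensional (topspace ?Y)" for g
    unfolding topY coset_completion_action_def completion_eq by simp
  have "G_flow G T ?Y ?\<psi>"
    by (rule G_flow_transport[OF flow hom eq ext topspace_T])
  then show ?thesis
    unfolding isomorphic_flows_def equivariant_on_def using flow hom eq by blast
qed

end

section \<open>Matchings, nets and concentration\<close>

text \<open>The induction of Halmos and Vaughan. If a proper nonempty \<open>J\<close> is critical,
  that is, has exactly \<open>card J\<close> candidates, it is matched by itself and its candidates
  are withdrawn from the rest. Otherwise every proper nonempty subset has a candidate to spare, and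
  one element may be matched arbitrarily.\<close>

lemma hall_marriage:
  assumes "finite I" "\<And>i. i \<in> I \<Longrightarrow> finite (A i)"
    and "\<And>J. J \<subseteq> I \<Longrightarrow> card J \<le> card (\<Union>i\<in>J. A i)"
  shows "\<exists>f. inj_on f I \<and> (\<forall>i\<in>I. f i \<in> A i)"
  using assms
proof (induction "card I" arbitrary: I A rule: less_induct)
  case less
  note fin = less.prems(1) and finA = less.prems(2) and hall = less.prems(3)
  show ?case
  proof (cases "I = {}")
    case True
    then show ?thesis by simp
  next
    case False
    show ?thesis
    proof (cases "\<exists>J. J \<subseteq> I \<and> J \<noteq> {} \<and> J \<noteq> I \<and> card (\<Union>i\<in>J. A i) = card J")
      case True
      then obtain J where J: "J \<subseteq> I" "J \<noteq> {}" "J \<noteq> I" and cJ: "card (\<Union>i\<in>J. A i) = card J"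
        by blast
      have finJ: "finite J" using J(1) fin finite_subset by blast
      have "card J < card I" using J fin by (simp add: psubset_card_mono psubsetI)
      then obtain f where f: "inj_on f J" "\<forall>i\<in>J. f i \<in> A i"
        using less.hyps[of J A, OF _ finJ] J(1) finA hall by (metis subsetD subset_trans)
      define B where "B i = A i - (\<Union>i\<in>J. A i)" for i
      have "card (I - J) < card I"
        using J fin by (intro psubset_card_mono) auto
      moreover have "card K \<le> card (\<Union>i\<in>K. B i)" if K: "K \<subseteq> I - J" for K
      proof -
        have finU: "finite (\<Union>i\<in>J. A i)" using finJ J(1) finA by blast
        have finK: "finite K" using K fin finite_subset by blast
        have "card K + card J = card (K \<union> J)"
          using K finK finJ by (subst card_Un_disjoint) auto
        also have "\<dots> \<le> card (\<Union>i\<in>K \<union> J. A i)"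
          using hall[of "K \<union> J"] K J(1) by blast
        also have "(\<Union>i\<in>K \<union> J. A i) = (\<Union>i\<in>K. B i) \<union> (\<Union>i\<in>J. A i)"
          unfolding B_def by blast
        also have "card \<dots> \<le> card (\<Union>i\<in>K. B i) + card (\<Union>i\<in>J. A i)"
          by (rule card_Un_le)
        finally show ?thesis using cJ by simp
      qed
      moreover have "finite (I - J)" "\<And>i. i \<in> I - J \<Longrightarrow> finite (B i)"
        using fin finA unfolding B_def by auto
      ultimately have "\<exists>g. inj_on g (I - J) \<and> (\<forall>i\<in>I - J. g i \<in> B i)"
        by (intro less.hyps[of "I - J" B])
      then obtain g where g: "inj_on g (I - J)" "\<forall>i\<in>I - J. g i \<in> B i"
        by (elim exE conjE) (rule that)
      define h where "h i = (if i \<in> J then f i else g i)" for i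
      have "inj_on h I"
      proof (rule inj_onI)
        fix i k assume ik: "i \<in> I" "k \<in> I" "h i = h k"
        have AJ: "f j \<in> (\<Union>i\<in>J. A i)" if "j \<in> J" for j using f(2) that by blast
        have gB: "g j \<notin> (\<Union>i\<in>J. A i)" if "j \<in> I" "j \<notin> J" for j
          using bspec[OF g(2), of j] that unfolding B_def by simp
        show "i = k"
        proof (cases "i \<in> J"; cases "k \<in> J")
          assume "i \<in> J" "k \<in> J"
          then show ?thesis using ik(3) inj_onD[OF f(1), of i k] unfolding h_def by simp
        next
          assume "i \<in> J" "k \<notin> J"
          then show ?thesis using ik AJ[of i] gB[of k] unfolding h_def by simp
        next
          assume "i \<notin> J" "k \<in> J"
          then show ?thesis using ik AJ[of k] gB[of i] unfolding h_def by simp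
        next
          assume "i \<notin> J" "k \<notin> J"
          then show ?thesis using ik inj_onD[OF g(1), of i k] unfolding h_def by simp
        qed
      qed
      moreover have "\<forall>i\<in>I. h i \<in> A i"
      proof
        fix i assume "i \<in> I"
        then show "h i \<in> A i"
          using bspec[OF f(2), of i] bspec[OF g(2), of i] unfolding h_def B_def by simp
      qed
      ultimately show ?thesis by (intro exI[of _ h] conjI)
    next
      case noJ: False
      obtain i where i: "i \<in> I" using False by blast
      have "A i \<noteq> {}" using hall[of "{i}"] i by auto
      then obtain a where a: "a \<in> A i" by blast
      define B where "B k = A k - {a}" for k
      have "card (I - {i}) < card I" using i fin by (meson card_Diff1_less)
      moreover have "card K \<le> card (\<Union>k\<in>K. B k)" if K: "K \<subseteq> I - {i}" for K
      proof (cases "K = {}")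
        case True
        then show ?thesis by simp
      next
        case False
        have finK: "finite K" using K fin finite_subset by blast
        have finU: "finite (\<Union>k\<in>K. A k)" using finK K finA by blast
        have "card K \<noteq> card (\<Union>k\<in>K. A k)" "card K \<le> card (\<Union>k\<in>K. A k)"
          using noJ hall[of K] K False i by (metis DiffE insertI1 subset_iff, blast)
        moreover have eq: "(\<Union>k\<in>K. B k) = (\<Union>k\<in>K. A k) - {a}"
          unfolding B_def by blast
        moreover have "card (\<Union>k\<in>K. A k) - 1 \<le> card ((\<Union>k\<in>K. A k) - {a})"
          using finU by (simp add: card_Diff_singleton_if)
        ultimately show ?thesis unfolding eq by linarith
      qed
      moreover have "finite (I - {i})" "\<And>k. k \<in> I - {i} \<Longrightarrow> finite (B k)"
        using fin finA unfolding B_def by auto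
      ultimately have "\<exists>g. inj_on g (I - {i}) \<and> (\<forall>k\<in>I - {i}. g k \<in> B k)"
        by (intro less.hyps[of "I - {i}" B])
      then obtain g where g: "inj_on g (I - {i})" "\<forall>k\<in>I - {i}. g k \<in> B k"
        by (elim exE conjE) (rule that)
      define h where "h k = (if k = i then a else g k)" for k
      have "inj_on h I"
      proof (rule inj_onI)
        fix j k assume jk: "j \<in> I" "k \<in> I" "h j = h k"
        have ga: "g l \<noteq> a" if "l \<in> I" "l \<noteq> i" for l
          using bspec[OF g(2), of l] that unfolding B_def by simp
        show "j = k"
          using jk ga[of j] ga[of k] inj_onD[OF g(1), of j k] unfolding h_def
          by (simp split: if_splits)
      qed
      moreover have "\<forall>k\<in>I. h k \<in> A k"
      proof
        fix k assume "k \<in> I"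
        then show "h k \<in> A k"
          using a bspec[OF g(2), of k] unfolding h_def B_def by simp
      qed
      ultimately show ?thesis by (intro exI[of _ h] conjI)
    qed
  qed
qed

text \<open>
  Two \<open>\<epsilon>\<close>-nets of minimal cardinality are matched by Hall's theorem. Applied to a minimal net and
  its translate, this replaces the Haar measure of a compact group by a counting measure.
\<close>
lemma minimal_net_matching:
  fixes close1 close2 :: "'q \<Rightarrow> 'q \<Rightarrow> bool" and r :: "'q \<Rightarrow> 'q"
  assumes net: "finite Q" "Q \<subseteq> M" "\<And>q. q \<in> M \<Longrightarrow> \<exists>a\<in>Q. close1 q a"
    and min: "\<And>Q'. \<lbrakk>finite Q'; Q' \<subseteq> M; \<And>q. q \<in> M \<Longrightarrow> \<exists>a\<in>Q'. close1 q a\<rbrakk> \<Longrightarrow> card Q \<le> card Q'"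
    and r: "\<And>q. q \<in> M \<Longrightarrow> r q \<in> M" "\<And>q. q \<in> M \<Longrightarrow> r (r q) = q"
    and close_r: "\<And>q q'. \<lbrakk>q \<in> M; q' \<in> M; close1 q q'\<rbrakk> \<Longrightarrow> close1 (r q) (r q')"
    and trans: "\<And>q a b. \<lbrakk>q \<in> M; a \<in> M; b \<in> M; close1 q a; close1 q b\<rbrakk> \<Longrightarrow> close2 a b"
  shows "\<exists>\<sigma>. bij_betw \<sigma> Q Q \<and> (\<forall>a\<in>Q. close2 (r a) (\<sigma> a))"
proof -
  define A where "A a = {b \<in> Q. close2 (r a) b}" for a
  have "card J \<le> card (\<Union>a\<in>J. A a)" if J: "J \<subseteq> Q" for J
  proof -
    have finJ: "finite J" using J net(1) finite_subset by blast
    define B where "B = (\<Union>a\<in>J. A a)"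
    have B: "B \<subseteq> Q" unfolding B_def A_def by blast
    have finB: "finite B" using B net(1) finite_subset by blast
    \<comment> \<open>A violation of Hall's condition at \<open>J\<close> would give a smaller net:
      a point served by some \<open>a\<close> in \<open>J\<close> is also served by
      \<open>r b\<close>, where \<open>b\<close> serves its image under \<open>r\<close>, and this
      \<open>b\<close> is a candidate for \<open>a\<close>.\<close>
    have "card Q \<le> card ((Q - J) \<union> r ` B)"
    proof (rule min)
      show "finite ((Q - J) \<union> r ` B)" using net(1) finB by simp
      show "(Q - J) \<union> r ` B \<subseteq> M" using net(2) B r(1) by blast
      fix q assume q: "q \<in> M"
      obtain a where a: "a \<in> Q" "close1 q a" using net(3) q by blast
      obtain b where b: "b \<in> Q" "close1 (r q) b" using net(3) r(1) q by blast
      show "\<exists>a\<in>(Q - J) \<union> r ` B. close1 q a"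
      proof (cases "a \<in> J")
        case True
        have "close2 (r a) b"
          using trans[of "r q" "r a" b] close_r[of q a] a b q net(2) r(1) by blast
        then have "b \<in> B" unfolding B_def A_def using True b by blast
        moreover have "close1 q (r b)"
          using close_r[of "r q" b] b q net(2) r by (metis subset_iff)
        ultimately show ?thesis by blast
      qed (use a in blast)
    qed
    also have "\<dots> \<le> card (Q - J) + card (r ` B)" by (rule card_Un_le)
    also have "\<dots> \<le> card (Q - J) + card B" using finB by (simp add: card_image_le)
    also have "card (Q - J) = card Q - card J" using J finJ by (simp add: card_Diff_subset)
    finally have "card Q \<le> card Q - card J + card B" .
    moreover have "card J \<le> card Q" using J net(1) by (simp add: card_mono)
    ultimately show ?thesis unfolding B_def by linarith
  qed
  moreover have "finite (A a)" for a unfolding A_def using net(1) by simp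
  ultimately have "\<exists>\<sigma>. inj_on \<sigma> Q \<and> (\<forall>a\<in>Q. \<sigma> a \<in> A a)"
    by (intro hall_marriage[OF net(1), of A])
  then obtain \<sigma> where \<sigma>: "inj_on \<sigma> Q" "\<forall>a\<in>Q. \<sigma> a \<in> A a"
    by (elim exE conjE) (rule that)
  have "\<sigma> ` Q = Q"
    using \<sigma> net(1) unfolding A_def by (intro endo_inj_surj) auto
  then show ?thesis using \<sigma> unfolding A_def bij_betw_def by (intro exI[of _ \<sigma>]) simp
qed

section \<open>Variance and concentration on words with the Hamming distance\<close>

definition words :: "'q set \<Rightarrow> nat \<Rightarrow> 'q list set" where
  "words Q N = {xs. set xs \<subseteq> Q \<and> length xs = N}"

lemma finite_words [simp]: "finite Q \<Longrightarrow> finite (words Q N)"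
  unfolding words_def by (rule finite_lists_length_eq)

lemma card_words: "finite Q \<Longrightarrow> card (words Q N) = card Q ^ N"
  unfolding words_def by (rule card_lists_length_eq)

lemma words_Suc: "words Q (Suc N) = (\<lambda>(q, xs). q # xs) ` (Q \<times> words Q N)"
  unfolding words_def by (auto simp: length_Suc_conv image_iff)

lemma sum_words_Suc:
  "(\<Sum>xs\<in>words Q (Suc N). h xs) = (\<Sum>q\<in>Q. \<Sum>xs\<in>words Q N. h (q # xs))"
proof -
  have "inj_on (\<lambda>(q, xs). q # xs) (Q \<times> words Q N)" by (auto simp: inj_on_def)
  then have "(\<Sum>xs\<in>words Q (Suc N). h xs) = (\<Sum>p\<in>Q \<times> words Q N. h (fst p # snd p))"
    unfolding words_Suc by (subst sum.reindex) (auto simp: case_prod_beta comp_def)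
  also have "\<dots> = (\<Sum>q\<in>Q. \<Sum>xs\<in>words Q N. h (q # xs))"
    by (simp add: sum.cartesian_product case_prod_beta)
  finally show ?thesis .
qed

text \<open>Twice the left-hand side is the sum of the squared differences over all pairs. The
  factor 2 is then given away, as the later constants are not sharp.\<close>

lemma variance_bound:
  fixes s :: "'q \<Rightarrow> real" and c :: real
  assumes "finite Q" "\<And>q q'. q \<in> Q \<Longrightarrow> q' \<in> Q \<Longrightarrow> \<bar>s q - s q'\<bar> \<le> c"
  shows "card Q * (\<Sum>q\<in>Q. (s q)\<^sup>2) - (\<Sum>q\<in>Q. s q)\<^sup>2 \<le> (real (card Q))\<^sup>2 * c\<^sup>2"
proof -
  have *: "(\<Sum>q\<in>Q. \<Sum>q'\<in>Q. (s q - s q')\<^sup>2) = 2 * (card Q * (\<Sum>q\<in>Q. (s q)\<^sup>2) - (\<Sum>q\<in>Q. s q)\<^sup>2)"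
  proof -
    have "(\<Sum>q\<in>Q. \<Sum>q'\<in>Q. (s q - s q')\<^sup>2)
      = (\<Sum>q\<in>Q. \<Sum>q'\<in>Q. (s q)\<^sup>2) + (\<Sum>q\<in>Q. \<Sum>q'\<in>Q. (s q')\<^sup>2) - 2 * (\<Sum>q\<in>Q. \<Sum>q'\<in>Q. s q * s q')"
      by (simp add: power2_diff sum.distrib sum_subtractf sum_distrib_left algebra_simps)
    also have "(\<Sum>q\<in>Q. \<Sum>q'\<in>Q. s q * s q') = (\<Sum>q\<in>Q. s q)\<^sup>2"
      by (simp add: power2_eq_square sum_product)
    finally show ?thesis by (simp add: sum_distrib_left)
  qed
  have "(\<Sum>q\<in>Q. \<Sum>q'\<in>Q. (s q - s q')\<^sup>2) \<le> (\<Sum>q\<in>Q. \<Sum>q'\<in>Q. c\<^sup>2)"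
    by (intro sum_mono) (use assms(2) in \<open>metis abs_ge_zero power2_abs power_mono\<close>)
  also have "\<dots> = (real (card Q))\<^sup>2 * c\<^sup>2" by (simp add: power2_eq_square)
  finally have "2 * (card Q * (\<Sum>q\<in>Q. (s q)\<^sup>2) - (\<Sum>q\<in>Q. s q)\<^sup>2) \<le> (real (card Q))\<^sup>2 * c\<^sup>2"
    using * by simp
  moreover have "0 \<le> (real (card Q))\<^sup>2 * c\<^sup>2" by simp
  ultimately have "2 * (card Q * (\<Sum>q\<in>Q. (s q)\<^sup>2) - (\<Sum>q\<in>Q. s q)\<^sup>2) \<le> 2 * ((real (card Q))\<^sup>2 * c\<^sup>2)"
    by linarith
  then show ?thesis by (simp only: mult_le_cancel_left_pos zero_less_numeral)
qed

text \<open>A function on a product with differences at most \<open>c\<close> in each coordinate has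
  variance at most \<open>N * c\<^sup>2\<close>, here multiplied by the square of the number of
  words to avoid division. The induction splits off the first letter: the variance within a block is
  the induction hypothesis, the variance of the block sums \<open>S q\<close> is
  \<open>variance_bound\<close>.\<close>

lemma variance_words:
  fixes h :: "'q list \<Rightarrow> real" and c :: real
  assumes "finite Q" "0 \<le> c"
    and "\<And>xs j q. \<lbrakk>xs \<in> words Q N; j < N; q \<in> Q\<rbrakk> \<Longrightarrow> \<bar>h (xs[j := q]) - h xs\<bar> \<le> c"
  shows "card (words Q N) * (\<Sum>xs\<in>words Q N. (h xs)\<^sup>2) - (\<Sum>xs\<in>words Q N. h xs)\<^sup>2
    \<le> N * c\<^sup>2 * (real (card (words Q N)))\<^sup>2"
  using assms(3)
proof (induction N arbitrary: h)
  case 0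
  have "words Q 0 = {[]}" unfolding words_def by auto
  then show ?case by simp
next
  case (Suc N)
  define M where "M = real (card Q)"
  define K where "K = real (card (words Q N))"
  define S where "S q = (\<Sum>xs\<in>words Q N. h (q # xs))" for q
  define R where "R q = (\<Sum>xs\<in>words Q N. (h (q # xs))\<^sup>2)" for q
  have cons: "q # xs \<in> words Q (Suc N)" if "q \<in> Q" "xs \<in> words Q N" for q xs
    using that unfolding words_def by auto
  have IH: "K * R q \<le> (S q)\<^sup>2 + N * c\<^sup>2 * K\<^sup>2" if q: "q \<in> Q" for q
  proof -
    have "\<bar>h (q # xs[j := q']) - h (q # xs)\<bar> \<le> c" if "xs \<in> words Q N" "j < N" "q' \<in> Q" for xs j q'
      using Suc.prems[of "q # xs" "Suc j" q'] cons[OF q] that by simp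
    from Suc.IH[of "\<lambda>xs. h (q # xs)", OF this] show ?thesis unfolding K_def R_def S_def by simp
  qed
  have var: "M * (\<Sum>q\<in>Q. (S q)\<^sup>2) - (\<Sum>q\<in>Q. S q)\<^sup>2 \<le> M\<^sup>2 * (K * c)\<^sup>2"
  proof -
    have "\<bar>S q - S q'\<bar> \<le> K * c" if q: "q \<in> Q" "q' \<in> Q" for q q'
    proof -
      have bd: "\<bar>h (q # xs) - h (q' # xs)\<bar> \<le> c" if "xs \<in> words Q N" for xs
        using Suc.prems[of "q' # xs" 0 q] cons that q by simp
      have "\<bar>S q - S q'\<bar> = \<bar>\<Sum>xs\<in>words Q N. h (q # xs) - h (q' # xs)\<bar>"
        unfolding S_def by (simp add: sum_subtractf)
      also have "\<dots> \<le> (\<Sum>xs\<in>words Q N. \<bar>h (q # xs) - h (q' # xs)\<bar>)" by (rule sum_abs)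
      also have "\<dots> \<le> (\<Sum>xs\<in>words Q N. c)"
        using bd by (rule sum_mono)
      finally show ?thesis unfolding K_def by simp
    qed
    then show ?thesis using variance_bound[OF assms(1), of S "K * c"] unfolding M_def by simp
  qed
  have MK: "real (card (words Q (Suc N))) = M * K"
    unfolding M_def K_def using assms(1) by (simp add: card_words)
  have "M * K * (\<Sum>q\<in>Q. R q) = M * (\<Sum>q\<in>Q. K * R q)"
    by (simp add: sum_distrib_left mult.assoc)
  also have "\<dots> \<le> M * (\<Sum>q\<in>Q. (S q)\<^sup>2 + N * c\<^sup>2 * K\<^sup>2)"
    using IH unfolding M_def by (intro mult_left_mono sum_mono) auto
  also have "\<dots> = M * (\<Sum>q\<in>Q. (S q)\<^sup>2) + N * c\<^sup>2 * (M * K)\<^sup>2"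
    unfolding M_def by (simp add: sum.distrib algebra_simps power2_eq_square)
  finally have "M * K * (\<Sum>q\<in>Q. R q) - (\<Sum>q\<in>Q. S q)\<^sup>2 \<le> N * c\<^sup>2 * (M * K)\<^sup>2 + M\<^sup>2 * (K * c)\<^sup>2"
    using var by linarith
  also have "\<dots> = Suc N * c\<^sup>2 * (M * K)\<^sup>2" by (simp add: algebra_simps power2_eq_square)
  finally show ?case unfolding MK sum_words_Suc R_def S_def .
qed

definition hamming :: "'q list \<Rightarrow> 'q list \<Rightarrow> nat" where
  "hamming xs ys = card {j. j < length xs \<and> xs ! j \<noteq> ys ! j}"

lemma hamming_update: "hamming (xs[j := q]) ys \<le> hamming xs ys + 1"
proof -
  have "{i. i < length (xs[j := q]) \<and> xs[j := q] ! i \<noteq> ys ! i}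
      \<subseteq> insert j {i. i < length xs \<and> xs ! i \<noteq> ys ! i}"
    by (auto simp: nth_list_update split: if_splits)
  then have "hamming (xs[j := q]) ys \<le> card (insert j {i. i < length xs \<and> xs ! i \<noteq> ys ! i})"
    unfolding hamming_def by (intro card_mono) auto
  also have "\<dots> \<le> hamming xs ys + 1"
    unfolding hamming_def by (simp add: card_insert_if)
  finally show ?thesis .
qed

text \<open>The distance \<open>d\<close> to \<open>A\<close> has variance at most \<open>N\<close>.
  Chebyshev's inequality is used twice: since \<open>d\<close> vanishes on a proportion of at least
  \<open>1/c\<close>, its mean \<open>m\<close> is at most of order \<open>sqrt (c * N)\<close>;
  hence \<open>d\<close> exceeds \<open>\<delta> * N\<close> on fewer than half of the words. Both
  orders of magnitude are below \<open>N\<close>, so a long word length suffices.\<close>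

lemma hamming_blow_up:
  fixes c :: nat and \<delta> :: real
  assumes Q: "finite Q" "Q \<noteq> {}" and c: "c > 0" and \<delta>: "\<delta> > 0"
  shows "\<exists>N>0. \<forall>A\<subseteq>words Q N. card (words Q N) \<le> c * card A \<longrightarrow>
    card (words Q N) < 2 * card {x \<in> words Q N. \<exists>a\<in>A. hamming x a \<le> \<delta> * N}"
proof -
  \<comment> \<open>The summand \<open>4 * c\<close> forces the mean of \<open>d\<close> below
    \<open>\<delta> * N / 2\<close>; the summand \<open>8\<close> makes the proportion of words with
    \<open>d\<close> above \<open>\<delta> * N\<close>, at most
    \<open>4 / (N * \<delta>\<^sup>2)\<close>, less than one half.\<close>
  obtain N :: nat where N: "N > (4 * c + 8) / \<delta>\<^sup>2" using reals_Archimedean2 by blast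
  have Npos: "N > 0" using N \<delta> by (cases N) (auto simp: field_simps)
  have N\<delta>: "N * \<delta>\<^sup>2 > 4 * c + 8" using N \<delta> by (simp add: field_simps)
  show ?thesis
  proof (intro exI[of _ N] conjI allI impI Npos)
    fix A assume A: "A \<subseteq> words Q N" and cA: "card (words Q N) \<le> c * card A"
    define W where "W = real (card (words Q N))"
    have finW: "finite (words Q N)" using Q by simp
    have Wpos: "W > 0" unfolding W_def using Q by (simp add: card_words card_gt_0_iff)
    have finA: "finite A" using A finW finite_subset by blast
    have Ane: "A \<noteq> {}" using cA Wpos unfolding W_def by auto
    define d where "d x = Min ((\<lambda>a. hamming x a) ` A)" for x
    have d_le: "d x \<le> hamming x a" if "a \<in> A" for x a
      unfolding d_def using finA that by simp
    have d_ex: "\<exists>a\<in>A. d x = hamming x a" for x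
    proof -
      have "d x \<in> (\<lambda>a. hamming x a) ` A"
        unfolding d_def using finA Ane by (intro Min_in) auto
      then show ?thesis by blast
    qed
    have d_up: "d (x[j := q]) \<le> d x + 1" for x j q
    proof -
      obtain a where a: "a \<in> A" "d x = hamming x a" using d_ex by blast
      have "d (x[j := q]) \<le> hamming (x[j := q]) a" using a(1) by (rule d_le)
      also have "\<dots> \<le> d x + 1" using hamming_update a(2) by metis
      finally show ?thesis .
    qed
    have "\<bar>real (d (x[j := q])) - real (d x)\<bar> \<le> 1" for x j q
      using d_up[of x j q] d_up[of "x[j := q]" j "x ! j"] by simp
    then have var: "W * (\<Sum>x\<in>words Q N. (real (d x))\<^sup>2) - (\<Sum>x\<in>words Q N. real (d x))\<^sup>2 \<le> N * W\<^sup>2"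
      using variance_words[OF Q(1), of 1 N "\<lambda>x. real (d x)"] unfolding W_def by simp
    define m where "m = (\<Sum>x\<in>words Q N. real (d x)) / W"
    have sm: "(\<Sum>x\<in>words Q N. real (d x)) = m * W" unfolding m_def using Wpos by simp
    have dev: "(\<Sum>x\<in>words Q N. (real (d x) - m)\<^sup>2) \<le> N * W"
    proof -
      have "(\<Sum>x\<in>words Q N. (real (d x) - m)\<^sup>2)
        = (\<Sum>x\<in>words Q N. (real (d x))\<^sup>2) - 2 * m * (\<Sum>x\<in>words Q N. real (d x)) + W * m\<^sup>2"
        unfolding W_def by (simp add: power2_diff sum.distrib sum_subtractf sum_distrib_left algebra_simps)
      also have "\<dots> = (\<Sum>x\<in>words Q N. (real (d x))\<^sup>2) - m\<^sup>2 * W"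
        unfolding sm by (simp add: algebra_simps power2_eq_square)
      finally have D: "(\<Sum>x\<in>words Q N. (real (d x) - m)\<^sup>2)
        = (\<Sum>x\<in>words Q N. (real (d x))\<^sup>2) - m\<^sup>2 * W" .
      have "W * (\<Sum>x\<in>words Q N. (real (d x) - m)\<^sup>2) \<le> W * (N * W)"
        using var unfolding sm D by (simp add: algebra_simps power2_eq_square)
      then show ?thesis using Wpos by (simp add: mult_le_cancel_left)
    qed
    have dA: "d a = 0" if "a \<in> A" for a
      using d_le[OF that, of a] unfolding hamming_def by simp
    have "card A * m\<^sup>2 = (\<Sum>x\<in>A. (real (d x) - m)\<^sup>2)" using dA by simp
    also have "\<dots> \<le> (\<Sum>x\<in>words Q N. (real (d x) - m)\<^sup>2)"
      using A finW by (intro sum_mono2) auto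
    finally have Am: "card A * m\<^sup>2 \<le> N * W" using dev by linarith
    have "W * m\<^sup>2 \<le> (c * card A) * m\<^sup>2"
    proof -
      have "W \<le> c * card A" using cA unfolding W_def by (metis of_nat_le_iff of_nat_mult)
      then show ?thesis by (intro mult_right_mono) auto
    qed
    also have "\<dots> \<le> c * (N * W)" using Am by (simp add: mult_left_mono mult.assoc)
    finally have "m\<^sup>2 \<le> c * N" using Wpos by (simp add: mult.commute mult.left_commute)
    also have "\<dots> \<le> (N * \<delta>\<^sup>2 / 4) * N"
      using mult_right_mono[of "real c" "N * \<delta>\<^sup>2 / 4" "real N"] N\<delta> by simp
    also have "\<dots> = (\<delta> * N / 2)\<^sup>2" by (simp add: power2_eq_square)
    finally have m: "m \<le> \<delta> * N / 2" by (rule power2_le_imp_le) (use \<delta> in simp)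
    define B where "B = {x \<in> words Q N. \<not> d x \<le> \<delta> * N}"
    have B: "B \<subseteq> words Q N" unfolding B_def by blast
    have "card B * (\<delta> * N / 2)\<^sup>2 = (\<Sum>x\<in>B. (\<delta> * N / 2)\<^sup>2)" by simp
    also have "\<dots> \<le> (\<Sum>x\<in>B. (real (d x) - m)\<^sup>2)"
      using m \<delta> unfolding B_def by (intro sum_mono power_mono) auto
    also have "\<dots> \<le> (\<Sum>x\<in>words Q N. (real (d x) - m)\<^sup>2)"
      using B finW by (intro sum_mono2) auto
    also have "\<dots> \<le> N * W" by (rule dev)
    finally have "N * (card B * (N * \<delta>\<^sup>2)) \<le> N * (4 * W)"
      by (simp add: power2_eq_square algebra_simps)
    then have le4: "card B * (N * \<delta>\<^sup>2) \<le> 4 * W" using Npos by (simp add: mult_le_cancel_left)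
    have "2 * real (card B) < W"
    proof (cases "card B = 0")
      case True
      then show ?thesis using Wpos by simp
    next
      case False
      then have "real (card B) * 8 < real (card B) * (N * \<delta>\<^sup>2)"
        using N\<delta> by (intro mult_strict_left_mono) auto
      then show ?thesis using le4 by linarith
    qed
    moreover have eq: "{x \<in> words Q N. \<exists>a\<in>A. hamming x a \<le> \<delta> * N} = words Q N - B"
    proof -
      have "(\<exists>a\<in>A. hamming x a \<le> \<delta> * N) \<longleftrightarrow> d x \<le> \<delta> * N" for x
      proof
        assume "\<exists>a\<in>A. hamming x a \<le> \<delta> * N"
        then obtain a where a: "a \<in> A" "hamming x a \<le> \<delta> * N" by blast
        have "real (d x) \<le> real (hamming x a)" using d_le[OF a(1)] by simp
        then show "d x \<le> \<delta> * N" using a(2) by linarith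
      next
        assume "d x \<le> \<delta> * N"
        then show "\<exists>a\<in>A. hamming x a \<le> \<delta> * N" using d_ex[of x] by metis
      qed
      then show ?thesis unfolding B_def by auto
    qed
    moreover have "card (words Q N - B) = card (words Q N) - card B"
      using B finW by (meson card_Diff_subset finite_subset)
    moreover have "card B \<le> card (words Q N)" using B finW by (simp add: card_mono)
    ultimately show "card (words Q N) < 2 * card {x \<in> words Q N. \<exists>a\<in>A. hamming x a \<le> \<delta> * N}"
      unfolding W_def eq by linarith
  qed
qed

section \<open>Hilbert space\<close>

lemma orthonormal_basis:
  fixes T :: "'b::real_inner set"
  assumes "finite T"
  obtains d and b :: "nat \<Rightarrow> 'b" where
    "\<And>i j. i < d \<Longrightarrow> j < d \<Longrightarrow> b i \<bullet> b j = (if i = j then 1 else 0)"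
    "span (b ` {..<d}) = span T"
proof -
  obtain C0 where C0: "finite C0" "span C0 = span T" "pairwise orthogonal C0"
    using basis_orthogonal[OF assms] by blast
  define C where "C = (\<lambda>x. (1 / norm x) *\<^sub>R x) ` (C0 - {0})"
  have finC: "finite C" unfolding C_def using C0(1) by simp
  have orth: "x \<bullet> y = (if x = y then 1 else 0)" if "x \<in> C" "y \<in> C" for x y
  proof -
    obtain x0 y0 where x0: "x0 \<in> C0" "x0 \<noteq> 0" "x = (1 / norm x0) *\<^sub>R x0"
      and y0: "y0 \<in> C0" "y0 \<noteq> 0" "y = (1 / norm y0) *\<^sub>R y0" using \<open>x \<in> C\<close> \<open>y \<in> C\<close> unfolding C_def by blast
    have self: "x \<bullet> x = 1"
      unfolding x0(3) using x0(2) by (simp add: power2_norm_eq_inner[symmetric] power2_eq_square)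
    show ?thesis
    proof (cases "x0 = y0")
      case True
      then show ?thesis using self x0 y0 by simp
    next
      case False
      then have "x0 \<bullet> y0 = 0" using C0(3) x0(1) y0(1) unfolding pairwise_def orthogonal_def by blast
      then have "x \<bullet> y = 0" unfolding x0(3) y0(3) by simp
      then show ?thesis using self by auto
    qed
  qed
  obtain d and b :: "nat \<Rightarrow> 'b" where b: "C = b ` {i. i < d}" "inj_on b {i. i < d}"
    using finite_imp_nat_seg_image_inj_on[OF finC] by blast
  have "span C = span C0"
    unfolding span_eq
  proof
    show "C \<subseteq> span C0" unfolding C_def by (auto intro: span_base span_scale)
    show "C0 \<subseteq> span C"
    proof
      fix x assume x: "x \<in> C0"
      show "x \<in> span C"
      proof (cases "x = 0")
        case False
        then have "(1 / norm x) *\<^sub>R x \<in> span C" using x unfolding C_def by (intro span_base) blast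
        then have "norm x *\<^sub>R ((1 / norm x) *\<^sub>R x) \<in> span C" by (rule span_scale)
        then show ?thesis using False by simp
      qed (simp add: span_zero)
    qed
  qed
  moreover have "{i. i < d} = {..<d}" by blast
  moreover have "b i \<bullet> b j = (if i = j then 1 else 0)" if "i < d" "j < d" for i j
    using orth[of "b i" "b j"] b that inj_onD[OF b(2), of i j] by auto
  ultimately show ?thesis using that[of d b] C0(2) b(1) by simp
qed

lemma orthonormal_expansion:
  fixes b :: "nat \<Rightarrow> 'b::real_inner"
  assumes "\<And>i j. i < d \<Longrightarrow> j < d \<Longrightarrow> b i \<bullet> b j = (if i = j then 1 else 0)"
    and "z \<in> span (b ` {..<d})"
  shows "z = (\<Sum>i<d. (z \<bullet> b i) *\<^sub>R b i)"
  using assms(2)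
proof (induction rule: span_induct_alt)
  case base
  then show ?case by simp
next
  case (step c x y)
  then obtain k where k: "k < d" "x = b k" by blast
  have "(\<Sum>i<d. (x \<bullet> b i) *\<^sub>R b i) = (\<Sum>i<d. if i = k then b i else 0)"
    by (rule sum.cong) (use k assms(1) in auto)
  also have "\<dots> = x" using k by simp
  finally have x: "(\<Sum>i<d. (x \<bullet> b i) *\<^sub>R b i) = x" .
  have "(\<Sum>i<d. ((c *\<^sub>R x + y) \<bullet> b i) *\<^sub>R b i)
    = c *\<^sub>R (\<Sum>i<d. (x \<bullet> b i) *\<^sub>R b i) + (\<Sum>i<d. (y \<bullet> b i) *\<^sub>R b i)"
    by (simp add: inner_add_left scaleR_add_left sum.distrib scaleR_sum_right)
  then show ?case using x step.IH by simp
qed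

locale hilbert_basis =
  fixes e :: "nat \<Rightarrow> 'a::{real_inner, complete_space}"
  assumes Hilbert_basis: "Hilbert_basis e"
begin

lemma e_inner: "e i \<bullet> e j = (if i = j then 1 else 0)"
  using Hilbert_basis unfolding Hilbert_basis_def by blast

lemma e_inner_self [simp]: "e i \<bullet> e i = 1"
  and e_inner_ne [simp]: "i \<noteq> j \<Longrightarrow> e i \<bullet> e j = 0"
  and e_inner_0_Suc [simp]: "e 0 \<bullet> e (Suc i) = 0" "e (Suc i) \<bullet> e 0 = 0"
  and norm_e [simp]: "norm (e i) = 1"
  by (simp_all add: e_inner norm_eq_1)

lemma closure_span_e: "closure (span (range e)) = UNIV"
  using Hilbert_basis unfolding Hilbert_basis_def by blast

lemma norm_sum_e: "finite I \<Longrightarrow> (norm (\<Sum>i\<in>I. a i *\<^sub>R e i))\<^sup>2 = (\<Sum>i\<in>I. (a i)\<^sup>2)"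
  unfolding power2_norm_eq_inner
  by (simp add: inner_sum_left inner_sum_right e_inner if_distrib power2_eq_square cong: if_cong)

lemma inner_sum_e: "finite I \<Longrightarrow> (\<Sum>i\<in>I. a i *\<^sub>R e i) \<bullet> e j = (if j \<in> I then a j else 0)"
  by (simp add: inner_sum_left e_inner if_distrib cong: if_cong)

text \<open>The Riesz-Fischer theorem: bounded partial sums of squares make the vector sums Cauchy,
  and completeness of the space provides the limit.\<close>

lemma sums_ex:
  assumes "\<And>n. (\<Sum>i<n. (a i)\<^sup>2) \<le> B"
  shows "\<exists>x. (\<lambda>n. \<Sum>i<n. a i *\<^sub>R e i) \<longlonglongrightarrow> x \<and> (\<forall>i. x \<bullet> e i = a i)"
proof -
  have "incseq (\<lambda>n. \<Sum>i<n. (a i)\<^sup>2)" by (rule incseq_SucI) simp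
  then have "convergent (\<lambda>n. \<Sum>i<n. (a i)\<^sup>2)"
    using assms by (metis convergentI incseq_convergent)
  then have C: "Cauchy (\<lambda>n. \<Sum>i<n. (a i)\<^sup>2)" by (rule convergent_Cauchy)
  have "Cauchy (\<lambda>n. \<Sum>i<n. a i *\<^sub>R e i)"
  proof (rule CauchyI')
    fix \<epsilon> :: real assume "\<epsilon> > 0"
    then obtain M where M: "\<And>m n. m \<ge> M \<Longrightarrow> n \<ge> M \<Longrightarrow> norm ((\<Sum>i<m. (a i)\<^sup>2) - (\<Sum>i<n. (a i)\<^sup>2)) < \<epsilon>\<^sup>2"
      using CauchyD[OF C, of "\<epsilon>\<^sup>2"] by auto
    have "norm ((\<Sum>i<m. a i *\<^sub>R e i) - (\<Sum>i<n. a i *\<^sub>R e i)) < \<epsilon>" if mn: "m \<ge> M" "n > m" for m n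
    proof -
      have "(\<Sum>i<n. a i *\<^sub>R e i) - (\<Sum>i<m. a i *\<^sub>R e i) = (\<Sum>i\<in>{m..<n}. a i *\<^sub>R e i)"
        using mn sum_diff_nat_ivl[of 0 m n "\<lambda>i. a i *\<^sub>R e i"] by (simp add: lessThan_atLeast0)
      then have "(norm ((\<Sum>i<n. a i *\<^sub>R e i) - (\<Sum>i<m. a i *\<^sub>R e i)))\<^sup>2 = (\<Sum>i\<in>{m..<n}. (a i)\<^sup>2)"
        by (simp add: norm_sum_e)
      also have "\<dots> = (\<Sum>i<n. (a i)\<^sup>2) - (\<Sum>i<m. (a i)\<^sup>2)"
        using mn sum_diff_nat_ivl[of 0 m n "\<lambda>i. (a i)\<^sup>2"] by (simp add: lessThan_atLeast0)
      also have "\<dots> < \<epsilon>\<^sup>2" using M[of n m] mn by simp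
      finally show ?thesis using \<open>\<epsilon> > 0\<close>
        by (simp add: norm_minus_commute power2_less_imp_less)
    qed
    then show "\<exists>M. \<forall>m\<ge>M. \<forall>n>m. dist (\<Sum>i<m. a i *\<^sub>R e i) (\<Sum>i<n. a i *\<^sub>R e i) < \<epsilon>"
      unfolding dist_norm by blast
  qed
  then obtain x where x: "(\<lambda>n. \<Sum>i<n. a i *\<^sub>R e i) \<longlonglongrightarrow> x"
    using Cauchy_convergent convergent_def by blast
  have "x \<bullet> e i = a i" for i
  proof -
    have "(\<lambda>n. (\<Sum>i<n. a i *\<^sub>R e i) \<bullet> e i) \<longlonglongrightarrow> x \<bullet> e i" by (intro tendsto_intros x)
    moreover have "(\<lambda>n. (\<Sum>i<n. a i *\<^sub>R e i) \<bullet> e i) \<longlonglongrightarrow> a i"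
      by (rule tendsto_eventually) (auto simp: inner_sum_e eventually_sequentially intro!: exI[of _ "Suc i"])
    ultimately show ?thesis using LIMSEQ_unique by blast
  qed
  then show ?thesis using x by blast
qed

lemma eq_zero_if_inner_e:
  assumes "\<And>i. x \<bullet> e i = 0"
  shows "x = 0"
proof -
  have "span (range e) \<subseteq> {y. x \<bullet> y = 0}"
    using assms by (intro span_minimal subspace_hyperplane) auto
  moreover have "closed {y. x \<bullet> y = 0}" by (rule closed_hyperplane)
  ultimately have "closure (span (range e)) \<subseteq> {y. x \<bullet> y = 0}" by (rule closure_minimal)
  then have "x \<bullet> x = 0" using closure_span_e by blast
  then show ?thesis by simp
qed

lemma bessel: "(\<Sum>i<n. (x \<bullet> e i)\<^sup>2) \<le> (norm x)\<^sup>2"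
proof -
  define s where "s = (\<Sum>i<n. (x \<bullet> e i) *\<^sub>R e i)"
  have "x \<bullet> s = (\<Sum>i<n. (x \<bullet> e i)\<^sup>2)"
    unfolding s_def by (simp add: inner_sum_right power2_eq_square)
  moreover have "s \<bullet> s = (\<Sum>i<n. (x \<bullet> e i)\<^sup>2)"
    unfolding s_def power2_norm_eq_inner[symmetric] by (rule norm_sum_e) simp
  moreover have "0 \<le> (x - s) \<bullet> (x - s)" by simp
  ultimately show ?thesis
    by (simp add: power2_norm_eq_inner inner_diff_left inner_diff_right inner_commute)
qed

lemma expansion: "(\<lambda>n. \<Sum>i<n. (x \<bullet> e i) *\<^sub>R e i) \<longlonglongrightarrow> x"
proof -
  obtain y where y: "(\<lambda>n. \<Sum>i<n. (x \<bullet> e i) *\<^sub>R e i) \<longlonglongrightarrow> y" "\<And>i. y \<bullet> e i = x \<bullet> e i"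
    using sums_ex[of "\<lambda>i. x \<bullet> e i", OF bessel] by blast
  have "y - x = 0" by (rule eq_zero_if_inner_e) (simp add: inner_diff_left y(2))
  then show ?thesis using y(1) by simp
qed

lemma parseval: "(\<lambda>i. (x \<bullet> e i)\<^sup>2) sums (norm x)\<^sup>2"
  using tendsto_power[OF tendsto_norm[OF expansion[of x]], of 2]
  by (simp add: sums_def norm_sum_e)

lemma inner_e_tendsto_0: "(\<lambda>i. x \<bullet> e i) \<longlonglongrightarrow> 0"
proof -
  have "(\<lambda>i. (x \<bullet> e i)\<^sup>2) \<longlonglongrightarrow> 0"
    using parseval sums_summable summable_LIMSEQ_zero by blast
  then have "(\<lambda>i. sqrt ((x \<bullet> e i)\<^sup>2)) \<longlonglongrightarrow> sqrt 0" by (rule tendsto_real_sqrt)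
  then show ?thesis by (simp add: tendsto_rabs_zero_iff)
qed

text \<open>The weak topology is generated by arbitrary bounded functionals, whereas all estimates
  concern inner products. The representing vector has coordinates \<open>f (e i)\<close>; they are
  square summable because \<open>f s\<close> equals the squared norm of the partial sum
  \<open>s\<close>.\<close>

lemma riesz:
  assumes "bounded_linear (f :: 'a \<Rightarrow> real)"
  shows "\<exists>y. \<forall>x. f x = x \<bullet> y"
proof -
  interpret f: bounded_linear f by fact
  obtain K where K: "\<And>x. norm (f x) \<le> norm x * K" and K0: "K \<ge> 0"
    using f.nonneg_bounded by blast
  have "(\<Sum>i<n. (f (e i))\<^sup>2) \<le> K\<^sup>2" for n
  proof -
    define s where "s = (\<Sum>i<n. f (e i) *\<^sub>R e i)"
    define r where "r = (\<Sum>i<n. (f (e i))\<^sup>2)"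
    have "f s = r" unfolding s_def r_def by (simp add: f.sum f.scaleR power2_eq_square)
    moreover have "(norm s)\<^sup>2 = r" unfolding s_def r_def by (simp add: norm_sum_e)
    ultimately have "norm s * norm s \<le> norm s * K" using K[of s] by (simp add: power2_eq_square)
    then have "norm s \<le> K" using K0 by (cases "norm s = 0") (auto simp: mult_le_cancel_left)
    then have "(norm s)\<^sup>2 \<le> K\<^sup>2" by (simp add: power_mono)
    then show ?thesis using \<open>(norm s)\<^sup>2 = r\<close> unfolding r_def by simp
  qed
  from sums_ex[OF this] obtain y where y: "\<And>i. y \<bullet> e i = f (e i)" by blast
  have fe: "f (e i) = e i \<bullet> y" for i by (metis y inner_commute)
  have "f x = x \<bullet> y" for x
  proof -
    have "(\<lambda>n. f (\<Sum>i<n. (x \<bullet> e i) *\<^sub>R e i)) \<longlonglongrightarrow> f x"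
      by (intro f.tendsto expansion)
    moreover have "f (\<Sum>i<n. (x \<bullet> e i) *\<^sub>R e i) = (\<Sum>i<n. (x \<bullet> e i) *\<^sub>R e i) \<bullet> y" for n
      by (simp add: f.sum f.scaleR inner_sum_left fe)
    moreover have "(\<lambda>n. (\<Sum>i<n. (x \<bullet> e i) *\<^sub>R e i) \<bullet> y) \<longlonglongrightarrow> x \<bullet> y"
      by (intro tendsto_intros expansion)
    ultimately show ?thesis using LIMSEQ_unique by auto
  qed
  then show ?thesis by blast
qed

subsection \<open>The weak topology of the closed unit ball of a hyperplane\<close>

abbreviation Wd :: "'a topology" where
  "Wd \<equiv> subtopology weak_topology (hyp_disc e)"

lemma openin_weak_topology:
  assumes "open U" shows "openin weak_topology {x::'a. x \<bullet> y \<in> U}"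
proof -
  have "{x::'a. x \<bullet> y \<in> U} = (\<lambda>x. x \<bullet> y) -` U" by auto
  then have "{x::'a. x \<bullet> y \<in> U} \<in> {f -` U | (f :: 'a \<Rightarrow> real) U. bounded_linear f \<and> open U}"
    using assms bounded_linear_inner_left by blast
  then show ?thesis
    unfolding weak_topology_def openin_topology_generated_by_iff
    by (rule generate_topology_on.Basis)
qed

lemma topspace_weak_topology [simp]: "topspace (weak_topology :: 'a topology) = UNIV"
proof -
  have "openin weak_topology {x::'a. x \<bullet> 0 \<in> UNIV}" by (rule openin_weak_topology) simp
  from openin_subset[OF this] show ?thesis by auto
qed

lemma topspace_Wd [simp]: "topspace Wd = hyp_disc e"
  by simp

lemma continuous_map_into_weak:
  fixes F :: "'z \<Rightarrow> 'a"
  assumes "\<And>y. continuous_map Z euclideanreal (\<lambda>z. F z \<bullet> y)"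
  shows "continuous_map Z weak_topology F"
  unfolding weak_topology_def
proof (rule continuous_on_generated_topo)
  fix S assume "S \<in> {f -` U | (f :: 'a \<Rightarrow> real) U. bounded_linear f \<and> open U}"
  then obtain f :: "'a \<Rightarrow> real" and U where S: "S = f -` U" "bounded_linear f" "open U" by blast
  obtain y where y: "\<And>x. f x = x \<bullet> y" using riesz S(2) by blast
  have "F -` S \<inter> topspace Z = {z \<in> topspace Z. F z \<bullet> y \<in> U}" unfolding S(1) using y by auto
  then show "openin Z (F -` S \<inter> topspace Z)"
    using assms[of y] S(3) unfolding continuous_map_def by simp
next
  show "F ` topspace Z \<subseteq> \<Union> {f -` U | (f :: 'a \<Rightarrow> real) U. bounded_linear f \<and> open U}"
  proof
    fix x :: 'a
    have "(\<lambda>x::'a. 0 :: real) -` UNIV \<in> {f -` U | (f :: 'a \<Rightarrow> real) U. bounded_linear f \<and> open U}"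
      using bounded_linear_zero by blast
    then show "x \<in> \<Union> {f -` U | (f :: 'a \<Rightarrow> real) U. bounded_linear f \<and> open U}" by blast
  qed
qed

lemma continuous_map_weak_inner: "continuous_map weak_topology euclideanreal (\<lambda>x::'a. x \<bullet> y)"
  unfolding continuous_map_def using openin_weak_topology by auto

lemma continuous_map_Wd_inner: "continuous_map Wd euclideanreal (\<lambda>x. x \<bullet> y)"
  using continuous_map_from_subtopology continuous_map_weak_inner by blast

lemma continuous_map_into_Wd:
  fixes F :: "'z \<Rightarrow> 'a"
  assumes "\<And>y. continuous_map Z euclideanreal (\<lambda>z. F z \<bullet> y)" "F ` topspace Z \<subseteq> hyp_disc e"
  shows "continuous_map Z Wd F"
  using continuous_map_into_weak[OF assms(1)] assms(2) by (auto simp: continuous_map_in_subtopology)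

lemma Hausdorff_Wd: "Hausdorff_space Wd"
  unfolding Hausdorff_space_def
proof (intro allI impI)
  fix x y assume xy: "x \<in> topspace Wd \<and> y \<in> topspace Wd \<and> x \<noteq> y"
  then have "(x - y) \<bullet> (x - y) > 0" by simp
  then have lt: "y \<bullet> (x - y) < x \<bullet> (x - y)" by (simp add: inner_diff_left)
  define c where "c = (y \<bullet> (x - y) + x \<bullet> (x - y)) / 2"
  have "openin Wd (hyp_disc e \<inter> {z. z \<bullet> (x - y) \<in> {c<..}})"
    "openin Wd (hyp_disc e \<inter> {z. z \<bullet> (x - y) \<in> {..<c}})"
    by (intro openin_subtopology_Int2 openin_weak_topology open_greaterThan open_lessThan)+
  moreover have "x \<in> hyp_disc e \<inter> {z. z \<bullet> (x - y) \<in> {c<..}}" "y \<in> hyp_disc e \<inter> {z. z \<bullet> (x - y) \<in> {..<c}}"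
    using xy lt unfolding c_def by (auto simp: field_simps)
  moreover have "disjnt (hyp_disc e \<inter> {z. z \<bullet> (x - y) \<in> {c<..}}) (hyp_disc e \<inter> {z. z \<bullet> (x - y) \<in> {..<c}})"
    unfolding disjnt_def by auto
  ultimately show "\<exists>U V. openin Wd U \<and> openin Wd V \<and> x \<in> U \<and> y \<in> V \<and> disjnt U V" by blast
qed

text \<open>Tychonoff's theorem for the coordinates with respect to \<open>e\<close>.\<close>
lemma compact_Wd: "compact_space Wd"
proof -
  let ?P = "product_topology (\<lambda>i::nat. euclideanreal) UNIV"
  \<comment> \<open>The coordinate sequences of the points of the disc: a closed subset of a cube,
    because the norm bound is a condition on each finite partial sum separately.\<close>
  define C :: "(nat \<Rightarrow> real) set" where "C = {a \<in> (\<Pi>\<^sub>E i\<in>UNIV. {-1..1::real}). a 0 = 0 \<and> (\<forall>n. (\<Sum>i<n. (a i)\<^sup>2) \<le> 1)}"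
  have cont: "continuous_map ?P euclideanreal (\<lambda>a. a i)" for i
    by (rule continuous_map_product_projection) simp
  have "closedin ?P {a \<in> topspace ?P. a 0 \<in> {0} \<and> (\<forall>n. (\<Sum>i<n. (a i)\<^sup>2) \<in> {..1})}"
  proof -
    have "closedin ?P {a \<in> topspace ?P. a 0 \<in> {0}}"
      by (rule closedin_continuous_map_preimage[OF cont]) simp
    moreover have "closedin ?P {a \<in> topspace ?P. (\<Sum>i<n. (a i)\<^sup>2) \<in> {..1}}" for n
      by (rule closedin_continuous_map_preimage[where Y = euclideanreal])
        (auto intro!: continuous_map_sum continuous_map_real_pow cont)
    then have "closedin ?P (\<Inter>n. {a \<in> topspace ?P. (\<Sum>i<n. (a i)\<^sup>2) \<in> {..1}})"
      by (intro closedin_Inter) auto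
    ultimately have "closedin ?P ({a \<in> topspace ?P. a 0 \<in> {0}} \<inter> (\<Inter>n. {a \<in> topspace ?P. (\<Sum>i<n. (a i)\<^sup>2) \<in> {..1}}))"
      by (rule closedin_Int)
    also have "{a \<in> topspace ?P. a 0 \<in> {0}} \<inter> (\<Inter>n. {a \<in> topspace ?P. (\<Sum>i<n. (a i)\<^sup>2) \<in> {..1}})
      = {a \<in> topspace ?P. a 0 \<in> {0} \<and> (\<forall>n. (\<Sum>i<n. (a i)\<^sup>2) \<in> {..1})}" by auto
    finally show ?thesis .
  qed
  moreover have "compactin ?P (\<Pi>\<^sub>E i\<in>UNIV. {-1..1::real})"
    by (simp add: compactin_PiE compactin_euclidean_iff)
  ultimately have "compactin ?P ((\<Pi>\<^sub>E i\<in>UNIV. {-1..1::real}) \<inter> {a \<in> topspace ?P. a 0 \<in> {0} \<and> (\<forall>n. (\<Sum>i<n. (a i)\<^sup>2) \<in> {..1})})"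
    by (intro compact_Int_closedin)
  also have "(\<Pi>\<^sub>E i\<in>UNIV. {-1..1::real}) \<inter> {a \<in> topspace ?P. a 0 \<in> {0} \<and> (\<forall>n. (\<Sum>i<n. (a i)\<^sup>2) \<in> {..1})} = C"
    unfolding C_def by auto
  finally have C: "compactin ?P C" .
  define F where "F a = (THE x. \<forall>i. x \<bullet> e i = a i)" for a
  have F: "F a \<bullet> e i = a i" if a: "a \<in> C" for a i
  proof -
    obtain x where "\<forall>i. x \<bullet> e i = a i" using sums_ex[of a 1] a unfolding C_def by auto
    then have "\<exists>!x. \<forall>i. x \<bullet> e i = a i"
      using eq_zero_if_inner_e by (metis eq_iff_diff_eq_0 inner_diff_left)
    from theI'[OF this] show ?thesis unfolding F_def by blast
  qed
  have F_disc: "F a \<in> hyp_disc e" if a: "a \<in> C" for a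
  proof -
    have "(\<lambda>n. \<Sum>i<n. (F a \<bullet> e i)\<^sup>2) \<longlonglongrightarrow> (norm (F a))\<^sup>2" using parseval unfolding sums_def .
    moreover have "(\<Sum>i<n. (F a \<bullet> e i)\<^sup>2) \<le> 1" for n using a F[OF a] unfolding C_def by simp
    ultimately have "(norm (F a))\<^sup>2 \<le> 1" by (meson LIMSEQ_le_const2)
    then show ?thesis using F[OF a, of 0] a unfolding hyp_disc_def C_def by (simp add: abs_square_le_1)
  qed
  have "continuous_map (subtopology ?P C) Wd F"
  proof (rule continuous_map_into_Wd)
    show "F ` topspace (subtopology ?P C) \<subseteq> hyp_disc e" using F_disc by auto
    fix y
    have span: "continuous_map (subtopology ?P C) euclideanreal (\<lambda>a. F a \<bullet> z)" if "z \<in> span (range e)" for z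
      using that
    proof (induction rule: span_induct_alt)
      case base
      then show ?case by simp
    next
      case (step c x z)
      then obtain i where x: "x = e i" by blast
      have "continuous_map (subtopology ?P C) euclideanreal (\<lambda>a. F a \<bullet> e i)"
        by (rule continuous_map_eq[OF continuous_map_from_subtopology[OF cont[of i]]]) (simp add: F)
      then show ?case unfolding x inner_add_right inner_scaleR_right
        using step by (intro continuous_map_add continuous_map_real_mult_left) auto
    qed
    show "continuous_map (subtopology ?P C) euclideanreal (\<lambda>a. F a \<bullet> y)"
      unfolding continuous_map_def
    proof (intro conjI allI impI)
      fix U assume "openin euclideanreal U"
      then have U: "open U" by simp
      show "openin (subtopology ?P C) {a \<in> topspace (subtopology ?P C). F a \<bullet> y \<in> U}"
      proof (subst openin_subopen, clarify)
        fix a assume a: "a \<in> topspace (subtopology ?P C)" "F a \<bullet> y \<in> U"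
        then obtain \<epsilon> where \<epsilon>: "\<epsilon> > 0" "ball (F a \<bullet> y) \<epsilon> \<subseteq> U" using U open_contains_ball by blast
        \<comment> \<open>Continuity of the coordinates gives only functionals in the span of the
          basis. Since the disc is bounded, replacing \<open>y\<close> by a nearby \<open>z\<close>
          of the span changes all values uniformly by less than \<epsilon>/3.\<close>
        have "y \<in> closure (span (range e))" using closure_span_e by simp
        then obtain z where z: "z \<in> span (range e)" "dist z y < \<epsilon> / 3"
          using \<epsilon>(1) unfolding closure_approachable by (metis divide_pos_pos zero_less_numeral)
        have near: "\<bar>F b \<bullet> y - F b \<bullet> z\<bar> < \<epsilon> / 3" if "b \<in> C" for b
        proof -
          have "\<bar>F b \<bullet> (y - z)\<bar> \<le> norm (F b) * norm (y - z)" by (rule Cauchy_Schwarz_ineq2)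
          also have "\<dots> \<le> 1 * norm (y - z)"
            using F_disc[OF that] unfolding hyp_disc_def by (intro mult_right_mono) auto
          also have "\<dots> < \<epsilon> / 3" using z(2) by (simp add: dist_norm norm_minus_commute)
          finally show ?thesis by (simp add: inner_diff_right)
        qed
        define T where "T = {b \<in> topspace (subtopology ?P C). F b \<bullet> z \<in> ball (F a \<bullet> z) (\<epsilon> / 3)}"
        have "openin (subtopology ?P C) T"
          unfolding T_def by (rule openin_continuous_map_preimage[OF span[OF z(1)]]) simp
        moreover have "a \<in> T" unfolding T_def using a(1) \<epsilon>(1) by simp
        moreover have "T \<subseteq> {a \<in> topspace (subtopology ?P C). F a \<bullet> y \<in> U}"
        proof
          fix b assume b: "b \<in> T"
          have "\<bar>F b \<bullet> z - F a \<bullet> z\<bar> < \<epsilon> / 3" using b unfolding T_def by (simp add: dist_real_def abs_minus_commute)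
          moreover have "\<bar>F a \<bullet> y - F a \<bullet> z\<bar> < \<epsilon> / 3" "\<bar>F b \<bullet> y - F b \<bullet> z\<bar> < \<epsilon> / 3"
            using near a(1) b unfolding T_def by auto
          ultimately have "\<bar>F b \<bullet> y - F a \<bullet> y\<bar> < \<epsilon>" by linarith
          then have "F b \<bullet> y \<in> ball (F a \<bullet> y) \<epsilon>" by (simp add: dist_real_def abs_minus_commute)
          then have "F b \<bullet> y \<in> U" using \<epsilon>(2) by blast
          then show "b \<in> {a \<in> topspace (subtopology ?P C). F a \<bullet> y \<in> U}" using b unfolding T_def by simp
        qed
        ultimately show "\<exists>T. openin (subtopology ?P C) T \<and> a \<in> T \<and> T \<subseteq> {a \<in> topspace (subtopology ?P C). F a \<bullet> y \<in> U}"
          by blast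
      qed
    qed simp
  qed
  moreover have "compact_space (subtopology ?P C)" using C compactin_subspace by blast
  ultimately have "compactin Wd (F ` topspace (subtopology ?P C))"
    using image_compactin compact_space_def by blast
  moreover have "F ` topspace (subtopology ?P C) = hyp_disc e"
  proof
    show "F ` topspace (subtopology ?P C) \<subseteq> hyp_disc e" using F_disc by auto
    show "hyp_disc e \<subseteq> F ` topspace (subtopology ?P C)"
    proof
      fix x assume x: "x \<in> hyp_disc e"
      define a where "a i = x \<bullet> e i" for i
      have "\<bar>a i\<bar> \<le> 1" for i
        using Cauchy_Schwarz_ineq2[of x "e i"] x unfolding a_def hyp_disc_def by simp
      moreover have "(\<Sum>i<n. (a i)\<^sup>2) \<le> 1" for n
      proof -
        have "(norm x)\<^sup>2 \<le> 1" using x unfolding hyp_disc_def by (simp add: abs_square_le_1)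
        then show ?thesis using bessel[of x n] unfolding a_def by linarith
      qed
      ultimately have a: "a \<in> C" using x unfolding C_def a_def hyp_disc_def by (auto simp: abs_le_iff)
      have "F a - x = 0" by (rule eq_zero_if_inner_e) (simp add: inner_diff_left F[OF a], simp add: a_def)
      then have "x = F a" by simp
      moreover have "a \<in> topspace (subtopology ?P C)" using a by simp
      ultimately show "x \<in> F ` topspace (subtopology ?P C)" by (rule image_eqI)
    qed
  qed
  ultimately show ?thesis unfolding compact_space_def by simp
qed

section \<open>The Lorentzian form and its isometries\<close>

text \<open>The polarization of \<open>hyp_Q\<close> without the infinite sum: by Parseval the sum
  over all indices is the inner product, and the time coordinate has to change its sign.\<close>

definition B :: "'a \<Rightarrow> 'a \<Rightarrow> real" where "B x y = 2 * (x \<bullet> e 0) * (y \<bullet> e 0) - x \<bullet> y"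

text \<open>The involution relating the two forms: \<open>B x (J y)\<close> is the inner product. It
  converts adjoints for one form into adjoints for the other.\<close>

definition J :: "'a \<Rightarrow> 'a" where "J x = (2 * (x \<bullet> e 0)) *\<^sub>R e 0 - x"

abbreviation "H \<equiv> hyp_space e"

lemma hyp_Q_eq: "hyp_Q e x = B x x"
proof -
  have "(\<Sum>i. (x \<bullet> e (Suc i))\<^sup>2) = (\<Sum>i. (x \<bullet> e i)\<^sup>2) - (x \<bullet> e 0)\<^sup>2"
    using suminf_split_head[OF sums_summable[OF parseval[of x]]] .
  then show ?thesis
    unfolding hyp_Q_def B_def using sums_unique[OF parseval[of x]] power2_norm_eq_inner[of x]
    by (simp add: power2_eq_square)
qed

lemma B_commute: "B x y = B y x"
  unfolding B_def by (simp add: inner_commute mult.commute mult.left_commute)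

lemma B_simps: "B (x + y) z = B x z + B y z" "B z (x + y) = B z x + B z y"
  "B (x - y) z = B x z - B y z" "B z (x - y) = B z x - B z y"
  "B (c *\<^sub>R x) z = c * B x z" "B z (c *\<^sub>R x) = c * B z x" "B (- x) z = - B x z" "B z (- x) = - B z x"
  "B 0 z = 0" "B z 0 = 0"
  unfolding B_def by (simp_all add: inner_add_left inner_add_right inner_diff_left inner_diff_right algebra_simps)

lemma hyp_form_eq: "hyp_form e x y = B x y"
  unfolding hyp_form_def hyp_Q_eq by (simp add: B_simps B_commute[of y x])

lemma B_e0: "B x (e 0) = x \<bullet> e 0" "B (e 0) x = x \<bullet> e 0"
  unfolding B_def by (simp_all add: inner_commute)

lemma B_J: "B x (J y) = x \<bullet> y" "J (J x) = x"
  unfolding B_def J_def by (simp_all add: inner_diff_left inner_diff_right inner_commute algebra_simps)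

lemma norm_B: "(norm x)\<^sup>2 = 2 * (x \<bullet> e 0)\<^sup>2 - B x x"
  unfolding B_def power2_norm_eq_inner by (simp add: power2_eq_square)

lemma tendsto_B [tendsto_intros]:
  "(f \<longlongrightarrow> x) F \<Longrightarrow> (g \<longlongrightarrow> y) F \<Longrightarrow> ((\<lambda>t. B (f t) (g t)) \<longlongrightarrow> B x y) F"
  unfolding B_def by (intro tendsto_intros)

lemma tendsto_J [tendsto_intros]: "(f \<longlongrightarrow> x) F \<Longrightarrow> ((\<lambda>t. J (f t)) \<longlongrightarrow> J x) F"
  unfolding J_def by (intro tendsto_intros)

lemma B_nondegenerate: "(\<And>y. B x y = 0) \<Longrightarrow> x = 0"
  using B_J(1)[of x x] by simp

lemma H_iff: "x \<in> H \<longleftrightarrow> B x x = 1 \<and> x \<bullet> e 0 > 0"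
  unfolding hyp_space_def hyp_Q_eq by simp

lemma e0_H [simp]: "e 0 \<in> H"
  unfolding H_iff B_def by simp

definition tail :: "'a \<Rightarrow> 'a" where "tail x = x - (x \<bullet> e 0) *\<^sub>R e 0"

lemma B_tail: "B x y = (x \<bullet> e 0) * (y \<bullet> e 0) - tail x \<bullet> tail y"
  unfolding B_def tail_def by (simp add: inner_diff_left inner_diff_right inner_commute algebra_simps)

lemma norm_tail: "(norm (tail x))\<^sup>2 = (x \<bullet> e 0)\<^sup>2 - B x x"
  unfolding B_tail power2_norm_eq_inner by (simp add: power2_eq_square)

lemma tail_inner_e0 [simp]: "tail x \<bullet> e 0 = 0"
  unfolding tail_def by (simp add: inner_diff_left)

lemma norm_tail_le: "norm (tail x) \<le> norm x"
proof -
  have "(norm (tail x))\<^sup>2 \<le> (norm x)\<^sup>2" unfolding norm_tail norm_B[of x] by simp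
  then show ?thesis by (rule power2_le_imp_le) simp
qed

text \<open>In the forward cone the spatial part is dominated by the time coordinate, so
  Cauchy-Schwarz for the tails cannot outweigh the product of the time coordinates. This is the
  qualitative form of the reversed Cauchy-Schwarz inequality.\<close>

lemma B_pos:
  assumes "B x x \<ge> 0" "x \<bullet> e 0 > 0" "B y y > 0" "y \<bullet> e 0 > 0"
  shows "B x y > 0"
proof -
  have "(norm (tail x))\<^sup>2 \<le> (x \<bullet> e 0)\<^sup>2" "(norm (tail y))\<^sup>2 < (y \<bullet> e 0)\<^sup>2"
    using assms unfolding norm_tail by auto
  then have le: "norm (tail x) \<le> x \<bullet> e 0" and lt: "norm (tail y) < y \<bullet> e 0"
    using assms by (auto intro: power2_le_imp_le power_less_imp_less_base)
  have "tail x \<bullet> tail y \<le> norm (tail x) * norm (tail y)" by (rule norm_cauchy_schwarz)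
  also have "\<dots> \<le> (x \<bullet> e 0) * norm (tail y)" using le by (intro mult_right_mono) auto
  also have "\<dots> < (x \<bullet> e 0) * (y \<bullet> e 0)" using lt assms by simp
  finally show ?thesis unfolding B_tail by simp
qed

lemma spacelike:
  assumes "B w x = 0" "B x x > 0" "x \<bullet> e 0 > 0" "w \<noteq> 0"
  shows "B w w < 0"
proof (rule ccontr)
  assume nn: "\<not> B w w < 0"
  have "w \<bullet> e 0 \<noteq> 0"
  proof
    assume "w \<bullet> e 0 = 0"
    then have "B w w = - (w \<bullet> w)" unfolding B_def by simp
    then show False using nn assms(4) inner_gt_zero_iff[of w] by linarith
  qed
  then consider "w \<bullet> e 0 > 0" | "(- w) \<bullet> e 0 > 0" by force
  then show False
  proof cases
    case 1
    then show ?thesis using B_pos[of w x] nn assms by simp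
  next
    case 2
    then show ?thesis using B_pos[of "- w" x] nn assms by (simp add: B_simps)
  qed
qed

text \<open>The component \<open>w\<close> of \<open>y\<close> that is \<open>B\<close>-orthogonal
  to \<open>x\<close> is spacelike, and its square is \<open>1 - (B x y)\<^sup>2\<close>. So
  \<open>arcosh\<close> is applied within its range, and the distance separates points.\<close>

lemma H_B_gt1:
  assumes "x \<in> H" "y \<in> H" "x \<noteq> y" shows "B x y > 1"
proof -
  define w where "w = y - B x y *\<^sub>R x"
  have pos: "B x y > 0" using B_pos assms(1,2) unfolding H_iff by simp
  have wx: "B w x = 0" and ww: "B w w = 1 - (B x y)\<^sup>2"
    using assms unfolding w_def H_iff by (simp_all add: B_simps B_commute[of y x] power2_eq_square)
  have "w \<noteq> 0"
  proof
    assume w0: "w = 0"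
    then have "(B x y)\<^sup>2 = 1" using ww by (simp add: B_simps)
    then have "B x y = 1" using pos by (simp add: power2_eq_1_iff)
    then show False using w0 assms(3) unfolding w_def by simp
  qed
  then have "B w w < 0" using spacelike[OF wx] assms unfolding H_iff by simp
  then have "1\<^sup>2 < (B x y)\<^sup>2" using ww by simp
  then show ?thesis using power_less_imp_less_base[of 1 2 "B x y"] pos by simp
qed

lemma H_B_ge1: "x \<in> H \<Longrightarrow> y \<in> H \<Longrightarrow> B x y \<ge> 1"
  using H_B_gt1[of x y] by (cases "x = y") (auto simp: H_iff)

lemma H_forward:
  assumes x: "x \<in> H" and y: "B y y = 1" "B x y > 0" shows "y \<in> H"
proof (rule ccontr)
  assume n: "y \<notin> H"
  have "y \<bullet> e 0 \<noteq> 0" using y(1) norm_B[of y] zero_le_power2[of "norm y"] by auto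
  then have "- y \<in> H" using n y unfolding H_iff by (simp add: B_simps)
  then show False using H_B_ge1[OF x, of "- y"] y by (simp add: B_simps)
qed

text \<open>Since \<open>e 0\<close> lies in \<open>H\<close> as well, linear questions are decided
  by values on the hyperboloid. The isometries extend to linear maps in this way.\<close>

lemma decomposition:
  obtains s t p where "p \<in> H" "x = s *\<^sub>R p - t *\<^sub>R e 0"
proof -
  \<comment> \<open>The time coordinate of \<open>x\<close> is at least \<open>- norm x\<close> and
    its tail has norm at most \<open>norm x\<close>, so this multiple of \<open>e 0\<close> pushes
    \<open>x\<close> strictly inside the forward cone.\<close>
  define t where "t = 2 * norm x + 1"
  define y where "y = x + t *\<^sub>R e 0"
  have x0: "\<bar>x \<bullet> e 0\<bar> \<le> norm x" using Cauchy_Schwarz_ineq2[of x "e 0"] by simp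
  have y0: "y \<bullet> e 0 = x \<bullet> e 0 + t" unfolding y_def by (simp add: inner_add_left)
  have ty: "tail y = tail x" unfolding y_def tail_def by (simp add: inner_add_left algebra_simps)
  have lt: "norm (tail x) < y \<bullet> e 0"
    using norm_tail_le[of x] x0 norm_ge_zero[of x] unfolding y0 t_def by linarith
  then have pos: "y \<bullet> e 0 > 0" using norm_ge_zero le_less_trans by blast
  have "(norm (tail x))\<^sup>2 < (y \<bullet> e 0)\<^sup>2" using lt by (simp add: power_strict_mono)
  then have Q: "B y y > 0" using norm_tail[of y] ty by simp
  define s where "s = sqrt (B y y)"
  have s: "s > 0" "s * s = B y y" unfolding s_def using Q by auto
  define p where "p = (1 / s) *\<^sub>R y"
  have "B p p = 1" unfolding p_def B_simps s(2)[symmetric] using s(1) by simp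
  moreover have "p \<bullet> e 0 > 0" unfolding p_def using pos s(1) by simp
  ultimately have "p \<in> H" unfolding H_iff by simp
  moreover have "x = s *\<^sub>R p - t *\<^sub>R e 0" unfolding p_def y_def using s(1) by simp
  ultimately show ?thesis using that by blast
qed

lemma H_separates: "(\<And>q. q \<in> H \<Longrightarrow> B z q = 0) \<Longrightarrow> z = 0"
proof (rule B_nondegenerate)
  fix y assume z: "\<And>q. q \<in> H \<Longrightarrow> B z q = 0"
  obtain s t p where "p \<in> H" "y = s *\<^sub>R p - t *\<^sub>R e 0" by (rule decomposition)
  then show "B z y = 0" using z by (simp add: B_simps)
qed

subsection \<open>Reflections\<close>

definition refl :: "'a \<Rightarrow> 'a \<Rightarrow> 'a" where "refl w x = x - (2 * B x w / B w w) *\<^sub>R w"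

lemma refl_linear: "linear (refl w)"
  by (rule linearI) (simp_all add: refl_def B_simps algebra_simps add_divide_distrib)

lemma refl_refl: "B w w \<noteq> 0 \<Longrightarrow> refl w (refl w x) = x"
  unfolding refl_def by (simp add: B_simps algebra_simps)

lemma refl_B: "B w w \<noteq> 0 \<Longrightarrow> B (refl w x) (refl w y) = B x y"
  unfolding refl_def by (simp add: B_simps B_commute[of w x] B_commute[of w y])

lemma refl_scale: "c \<noteq> 0 \<Longrightarrow> refl (c *\<^sub>R w) x = refl w x"
  unfolding refl_def by (simp add: B_simps)

lemma refl_swap:
  assumes "B x x = B y y" "B (x - y) (x - y) \<noteq> 0" shows "refl (x - y) x = y"
proof -
  have "B (x - y) (x - y) = 2 * B x (x - y)" using assms(1) by (simp add: B_simps B_commute[of y x])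
  then show ?thesis using assms(2) unfolding refl_def by simp
qed

lemma tendsto_refl:
  assumes "(f \<longlongrightarrow> w) F" "(g \<longlongrightarrow> x) F" "B w w \<noteq> 0"
  shows "((\<lambda>t. refl (f t) (g t)) \<longlongrightarrow> refl w x) F"
  unfolding refl_def by (intro tendsto_intros assms)

subsection \<open>The orthogonal group\<close>

abbreviation "finv \<equiv> inv_into (UNIV :: 'a set)"

text \<open>One representative of each class modulo the sign: the orthogonal maps that preserve the
  upper sheet. They form a group isomorphic to the isometry group, and no quotient has to be
  formed.\<close>

definition OG :: "('a \<Rightarrow> 'a) set" where
  "OG = {A \<in> hyp_orthogonal_group e. \<forall>x\<in>H. A x \<in> H}"

text \<open>The sheet needs to be tested at \<open>e 0\<close> only: a vector of square 1 lies on
  one of the two sheets, and the sign of its product with a point of \<open>H\<close> tells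
  which.\<close>

lemma OG_I:
  assumes "linear A" "\<And>x. A (A' x) = x" "\<And>x. A' (A x) = x" "\<And>x. B (A x) (A x) = B x x"
    "A (e 0) \<bullet> e 0 > 0"
  shows "A \<in> OG"
proof -
  have lin: "A (x + y) = A x + A y" for x y using assms(1) linear_add by blast
  have BA: "B (A x) (A y) = B x y" for x y
    using assms(4)[of "x + y"] assms(4)[of x] assms(4)[of y]
    by (simp add: lin B_simps B_commute[of y x] B_commute[of "A y" "A x"])
  have "A (e 0) \<in> H" using assms(4)[of "e 0"] assms(5) e0_H unfolding H_iff by simp
  then have "A x \<in> H" if "x \<in> H" for x
    using H_forward[of "A (e 0)" "A x"] BA that H_B_ge1[OF e0_H that] unfolding H_iff by force
  moreover have "bij A" using assms(2,3) by (metis bijI')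
  ultimately show ?thesis using assms(1,4) unfolding OG_def hyp_orthogonal_group_def hyp_Q_eq by blast
qed

lemma OG_linear: "A \<in> OG \<Longrightarrow> linear A" and OG_bij: "A \<in> OG \<Longrightarrow> bij A"
  and OG_H: "A \<in> OG \<Longrightarrow> x \<in> H \<Longrightarrow> A x \<in> H"
  unfolding OG_def hyp_orthogonal_group_def by auto

lemma OG_B: assumes "A \<in> OG" shows "B (A x) (A y) = B x y"
proof -
  have Q: "B (A x) (A x) = B x x" for x
    using assms unfolding OG_def hyp_orthogonal_group_def hyp_Q_eq by blast
  have lin: "A (x + y) = A x + A y" using OG_linear[OF assms] linear_add by blast
  show ?thesis
    using Q[of "x + y"] Q[of x] Q[of y]
    by (simp add: lin B_simps B_commute[of y x] B_commute[of "A y" "A x"])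
qed

lemma OG_id: "id \<in> OG"
  by (rule OG_I[where A' = id]) (auto simp: linear_id)

lemma OG_comp: assumes "A \<in> OG" "A' \<in> OG" shows "A \<circ> A' \<in> OG"
proof -
  have "linear (A \<circ> A')" using linear_compose[OF OG_linear OG_linear] assms by blast
  moreover have "bij (A \<circ> A')" using bij_comp OG_bij assms by blast
  moreover have "B ((A \<circ> A') x) ((A \<circ> A') x) = B x x" for x using OG_B assms by simp
  moreover have "(A \<circ> A') x \<in> H" if "x \<in> H" for x using OG_H assms that by simp
  ultimately show ?thesis unfolding OG_def hyp_orthogonal_group_def hyp_Q_eq by blast
qed

lemma OG_inv:
  assumes A: "A \<in> OG" shows "finv A \<in> OG"
    and "A (finv A x) = x" and "finv A (A x) = x"
proof -
  show 1: "A (finv A x) = x" "finv A (A x) = x" for x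
    using OG_bij[OF A] by (simp_all add: bij_is_surj surj_f_inv_f bij_is_inj inv_f_f)
  have "linear (finv A)"
  proof (rule linearI)
    show "finv A (x + y) = finv A x + finv A y" for x y
      using linear_add[OF OG_linear[OF A], of "finv A x" "finv A y"] 1 by metis
    show "finv A (c *\<^sub>R x) = c *\<^sub>R finv A x" for c x
      using linear_scale[OF OG_linear[OF A], of c "finv A x"] 1 by metis
  qed
  moreover have "B (finv A x) (finv A x) = B x x" for x using OG_B[OF A, of "finv A x" "finv A x"] 1 by simp
  moreover have "finv A (e 0) \<bullet> e 0 = A (e 0) \<bullet> e 0"
    using OG_B[OF A, of "finv A (e 0)" "e 0"] 1 by (simp add: B_e0)
  ultimately show "finv A \<in> OG"
    using OG_I[of "finv A" A] 1 OG_H[OF A e0_H] unfolding H_iff by simp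
qed

lemma refl_OG: assumes "B w w < 0" shows "refl w \<in> OG"
proof (rule OG_I[where A' = "refl w"])
  have "B (refl w (e 0)) (e 0) = 1 - 2 * (B (e 0) w)\<^sup>2 / B w w"
    using e0_H unfolding refl_def H_iff
    by (simp add: B_simps B_commute[of w "e 0"] power2_eq_square)
  moreover have "2 * (B (e 0) w)\<^sup>2 / B w w \<le> 0" using assms by (simp add: divide_nonneg_neg)
  ultimately show "refl w (e 0) \<bullet> e 0 > 0" unfolding B_e0 by linarith
qed (use assms refl_linear refl_refl refl_B in auto)

lemma OG_transitive:
  assumes "x \<in> H" "y \<in> H" obtains A where "A \<in> OG" "A x = y"
proof (cases "x = y")
  case True
  then show ?thesis using that[of id] OG_id by simp
next
  case False
  have "B (x - y) (x - y) < 0"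
    using H_B_gt1[OF assms False] assms unfolding H_iff by (simp add: B_simps B_commute[of y x])
  then show ?thesis using that[OF refl_OG] refl_swap[of x y] assms unfolding H_iff by simp
qed

text \<open>Continuity is not part of the definition of the orthogonal group. It is automatic,
  because the norm is determined by the preserved form and one time coordinate, and the time
  coordinate of \<open>A x\<close> is \<open>B x u\<close> with \<open>u\<close> the preimage of
  \<open>e 0\<close>.\<close>

lemma OG_bounded:
  assumes A: "A \<in> OG" obtains K where "K > 0" "\<And>x. norm (A x) \<le> K * norm x"
proof -
  define u where "u = finv A (e 0)"
  have eq: "A x \<bullet> e 0 = B x u" for x
    using OG_B[OF A, of x u] OG_inv(2)[OF A, of "e 0"] unfolding u_def by (simp add: B_e0)
  have Jn: "norm (J u) = norm u"
    unfolding norm_eq J_def by (simp add: inner_diff_left inner_diff_right inner_commute algebra_simps)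
  have Bu: "\<bar>B x u\<bar> \<le> norm x * norm u" for x
    using Cauchy_Schwarz_ineq2[of x "J u"] B_J(1)[of x "J u"] B_J(2)[of u] Jn by simp
  have Bx: "- B x x \<le> (norm x)\<^sup>2" for x using norm_B[of x] zero_le_power2[of "x \<bullet> e 0"] by linarith
  define K where "K = sqrt (2 * (norm u)\<^sup>2 + 1)"
  have K: "K > 0" "K\<^sup>2 = 2 * (norm u)\<^sup>2 + 1" unfolding K_def by (auto simp: add_nonneg_pos)
  have "norm (A x) \<le> K * norm x" for x
  proof -
    have "(norm (A x))\<^sup>2 = 2 * (B x u)\<^sup>2 - B x x" unfolding norm_B[of "A x"] eq OG_B[OF A] ..
    also have "(B x u)\<^sup>2 \<le> (norm x * norm u)\<^sup>2" using Bu[of x] by (metis abs_ge_zero power2_abs power_mono)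
    finally have "(norm (A x))\<^sup>2 \<le> (K * norm x)\<^sup>2"
      using Bx[of x] K(2) by (simp add: power_mult_distrib algebra_simps)
    then show ?thesis by (rule power2_le_imp_le) (use K in simp)
  qed
  then show ?thesis using that K(1) by blast
qed

subsection \<open>The isometry group\<close>

abbreviation "G \<equiv> hyp_Isom e"

lemma hyp_dist_eq: "x \<in> H \<Longrightarrow> y \<in> H \<Longrightarrow> hyp_dist e x y = arcosh (B x y)"
  unfolding hyp_dist_def hyp_form_eq by simp

lemma hyp_dist_eq_iff:
  assumes "x \<in> H" "y \<in> H" "x' \<in> H" "y' \<in> H"
  shows "hyp_dist e x y = hyp_dist e x' y' \<longleftrightarrow> B x y = B x' y'"
proof -
  have "cosh (arcosh (B x y)) = B x y" "cosh (arcosh (B x' y')) = B x' y'"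
    using assms by (simp_all add: H_B_ge1)
  then show ?thesis using assms by (metis hyp_dist_eq)
qed

lemma carrier_iff: "g \<in> carrier G \<longleftrightarrow> g \<in> Bij H \<and> (\<forall>x\<in>H. \<forall>y\<in>H. B (g x) (g y) = B x y)"
proof -
  have "g \<in> carrier G \<longleftrightarrow> g \<in> Bij H \<and> (\<forall>x\<in>H. \<forall>y\<in>H. hyp_dist e (g x) (g y) = hyp_dist e x y)"
    unfolding hyp_Isom_def by simp
  also have "\<dots> \<longleftrightarrow> g \<in> Bij H \<and> (\<forall>x\<in>H. \<forall>y\<in>H. B (g x) (g y) = B x y)"
  proof (intro conj_cong refl ball_cong)
    fix x y assume "g \<in> Bij H" "x \<in> H" "y \<in> H"
    moreover then have "g x \<in> H" "g y \<in> H" using Bij_imp_funcset by blast+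
    ultimately show "hyp_dist e (g x) (g y) = hyp_dist e x y \<longleftrightarrow> B (g x) (g y) = B x y"
      by (intro hyp_dist_eq_iff) auto
  qed
  finally show ?thesis .
qed

lemma carrier_closed: "g \<in> carrier G \<Longrightarrow> x \<in> H \<Longrightarrow> g x \<in> H"
  using Bij_imp_funcset carrier_iff by blast

lemma carrier_surj: "g \<in> carrier G \<Longrightarrow> y \<in> H \<Longrightarrow> \<exists>x\<in>H. y = g x"
  unfolding carrier_iff Bij_def bij_betw_def by blast

lemma carrier_B: "g \<in> carrier G \<Longrightarrow> x \<in> H \<Longrightarrow> y \<in> H \<Longrightarrow> B (g x) (g y) = B x y"
  unfolding carrier_iff by blast

lemma mult_G: "g \<in> carrier G \<Longrightarrow> h \<in> carrier G \<Longrightarrow> g \<otimes>\<^bsub>G\<^esub> h = compose H g h"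
  unfolding hyp_Isom_def by (simp add: BijGroup_def)

lemma one_G: "\<one>\<^bsub>G\<^esub> = (\<lambda>x\<in>H. x)"
  unfolding hyp_Isom_def by (simp add: BijGroup_def)

lemma group_G: "group G"
proof -
  interpret BG: group "BijGroup H" by (rule group_BijGroup)
  have sub: "subgroup (carrier G) (BijGroup H)"
  proof (rule BG.subgroupI)
    show "carrier G \<subseteq> carrier (BijGroup H)" unfolding hyp_Isom_def BijGroup_def by auto
    have "(\<lambda>x\<in>H. x) \<in> carrier G" unfolding carrier_iff using id_Bij by simp
    then show "carrier G \<noteq> {}" by blast
  next
    fix g assume g: "g \<in> carrier G"
    then have gB: "g \<in> Bij H" by (simp add: carrier_iff)
    have eq: "inv\<^bsub>BijGroup H\<^esub> g = (\<lambda>x\<in>H. inv_into H g x)" using inv_BijGroup[OF gB] .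
    have "B (inv_into H g x) (inv_into H g y) = B x y" if xy: "x \<in> H" "y \<in> H" for x y
    proof -
      obtain a b where ab: "a \<in> H" "b \<in> H" "x = g a" "y = g b" using carrier_surj[OF g] xy by metis
      have inj: "inj_on g H" using gB unfolding Bij_def bij_betw_def by blast
      show ?thesis using ab inj carrier_B[OF g] by simp
    qed
    then show "inv\<^bsub>BijGroup H\<^esub> g \<in> carrier G"
      unfolding eq carrier_iff using restrict_inv_into_Bij[OF gB] by simp
  next
    fix g h assume gh: "g \<in> carrier G" "h \<in> carrier G"
    then have "g \<otimes>\<^bsub>BijGroup H\<^esub> h = compose H g h" by (simp add: carrier_iff BijGroup_def)
    moreover have "compose H g h \<in> Bij H" using gh compose_Bij carrier_iff by blast
    then have "compose H g h \<in> carrier G"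
      unfolding carrier_iff using carrier_B[OF gh(1)] carrier_B[OF gh(2)] carrier_closed[OF gh(2)]
      by (simp add: compose_eq)
    ultimately show "g \<otimes>\<^bsub>BijGroup H\<^esub> h \<in> carrier G" by simp
  qed
  have "G = BijGroup H\<lparr>carrier := carrier G\<rparr>" unfolding hyp_Isom_def by simp
  then show ?thesis using subgroup.subgroup_is_group[OF sub group_BijGroup] by simp
qed

sublocale G: group G by (rule group_G)

definition iso :: "('a \<Rightarrow> 'a) \<Rightarrow> 'a \<Rightarrow> 'a" where "iso A = restrict A H"

lemma iso_carrier: assumes A: "A \<in> OG" shows "iso A \<in> carrier G"
proof -
  have "bij_betw (restrict A H) H H"
    by (rule bij_betw_byWitness[where f' = "finv A"])
      (use OG_inv[OF A] OG_H[OF A] OG_H[OF OG_inv(1)[OF A]] in auto)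
  then show ?thesis unfolding carrier_iff iso_def Bij_def using OG_B[OF A] by simp
qed

text \<open>The image of \<open>x\<close> is characterized by its products with the points
  \<open>k q\<close>, which must equal those of \<open>x\<close> with \<open>q\<close>. Such a
  vector exists by \<open>decomposition\<close> and is unique since \<open>k\<close> is onto and
  \<open>H\<close> separates vectors; linearity and the inverse then follow from uniqueness.\<close>

lemma lift_exists:
  assumes g: "g \<in> carrier G" obtains A where "A \<in> OG" "\<And>x. x \<in> H \<Longrightarrow> A x = g x"
proof -
  have ex: "\<exists>z. \<forall>q\<in>H. B z (k q) = B x q" if k: "k \<in> carrier G" for k x
  proof -
    obtain s t p where p: "p \<in> H" "x = s *\<^sub>R p - t *\<^sub>R e 0" by (rule decomposition)
    have "\<forall>q\<in>H. B (s *\<^sub>R k p - t *\<^sub>R k (e 0)) (k q) = B x q"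
      using p carrier_B[OF k] by (simp add: B_simps)
    then show ?thesis by blast
  qed
  have unique: "z = z'" if k: "k \<in> carrier G" and zz: "\<forall>q\<in>H. B z (k q) = B z' (k q)" for k z z'
  proof -
    have "z - z' = 0"
    proof (rule H_separates)
      fix q assume "q \<in> H"
      then obtain q' where "q' \<in> H" "q = k q'" using carrier_surj[OF k] by blast
      then show "B (z - z') q = 0" using zz by (simp add: B_simps)
    qed
    then show ?thesis by simp
  qed
  define l where "l k x = (SOME z. \<forall>q\<in>H. B z (k q) = B x q)" for k x
  have l: "B (l k x) (k q) = B x q" if "k \<in> carrier G" "q \<in> H" for k x q
    unfolding l_def using someI_ex[OF ex[OF that(1), of x]] that(2) by blast
  have lI: "l k x = z" if "k \<in> carrier G" "\<And>q. q \<in> H \<Longrightarrow> B z (k q) = B x q" for k x z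
    using unique[OF that(1), of "l k x" z] l[OF that(1)] that(2) by simp
  have on_H: "l k x = k x" if "k \<in> carrier G" "x \<in> H" for k x
    using that carrier_B by (intro lI) auto
  let ?h = "inv\<^bsub>G\<^esub> g"
  have h: "?h \<in> carrier G" using g by simp
  have gh: "g (?h q) = q" "?h (g q) = q" if q: "q \<in> H" for q
  proof -
    have "(g \<otimes>\<^bsub>G\<^esub> ?h) q = q" "(?h \<otimes>\<^bsub>G\<^esub> g) q = q" using g q by (simp_all add: one_G)
    then show "g (?h q) = q" "?h (g q) = q" using q by (simp_all add: mult_G g h compose_eq)
  qed
  have inv1: "l g (l ?h x) = x" for x
  proof (rule lI[OF g])
    fix q assume q: "q \<in> H"
    show "B x (g q) = B (l ?h x) q"
      using l[OF h carrier_closed[OF g q], of x] gh(2)[OF q] by simp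
  qed
  have inv2: "l ?h (l g x) = x" for x
  proof (rule lI[OF h])
    fix q assume q: "q \<in> H"
    show "B x (?h q) = B (l g x) q"
      using l[OF g carrier_closed[OF h q], of x] gh(1)[OF q] by simp
  qed
  have lin: "linear (l g)"
    by (rule linearI) (auto intro!: lI g simp: B_simps l[OF g])
  have "B (l g x) (l g x) = B x x" for x
  proof -
    obtain s t p where p: "p \<in> H" "x = s *\<^sub>R p - t *\<^sub>R e 0" by (rule decomposition)
    have "l g x = s *\<^sub>R g p - t *\<^sub>R g (e 0)"
      using p lin on_H[OF g] by (simp add: linear_diff linear_scale)
    then have "B (l g x) (l g x) = s * B (l g x) (g p) - t * B (l g x) (g (e 0))" by (simp add: B_simps)
    also have "\<dots> = B x x" using l[OF g, of _ x] p by (simp add: B_simps)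
    finally show ?thesis .
  qed
  moreover have "l g (e 0) \<bullet> e 0 > 0" using on_H[OF g e0_H] carrier_closed[OF g e0_H] unfolding H_iff by simp
  ultimately have "l g \<in> OG" using OG_I[OF lin, of "l ?h"] inv1 inv2 by blast
  then show ?thesis using that on_H[OF g] by blast
qed

lemma linear_eq_on_H:
  assumes "linear A" "linear A'" "\<And>x. x \<in> H \<Longrightarrow> A x = A' x" shows "A = A'"
proof
  fix x
  obtain s t p where p: "p \<in> H" "x = s *\<^sub>R p - t *\<^sub>R e 0" by (rule decomposition)
  then show "A x = A' x" using assms(3) by (simp add: linear_diff[OF assms(1)] linear_diff[OF assms(2)]
      linear_scale[OF assms(1)] linear_scale[OF assms(2)])
qed

abbreviation "L \<equiv> hyp_linear_lift e"

lemma lift_eqI: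
  assumes "A \<in> OG" "\<And>x. x \<in> H \<Longrightarrow> A x = g x" shows "L g = A"
  unfolding hyp_linear_lift_def
proof (rule the_equality)
  show "A \<in> hyp_orthogonal_group e \<and> (\<forall>x\<in>H. A x = g x)" using assms unfolding OG_def by blast
  fix A' assume "A' \<in> hyp_orthogonal_group e \<and> (\<forall>x\<in>H. A' x = g x)"
  then show "A' = A" using assms OG_linear[OF assms(1)] unfolding hyp_orthogonal_group_def
    by (intro linear_eq_on_H) auto
qed

lemma L_OG: "g \<in> carrier G \<Longrightarrow> L g \<in> OG" and L_H: "g \<in> carrier G \<Longrightarrow> x \<in> H \<Longrightarrow> L g x = g x"
  using lift_exists[of g] lift_eqI by metis+

lemma L_iso: "A \<in> OG \<Longrightarrow> L (iso A) = A"
  by (rule lift_eqI) (auto simp: iso_def)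

lemma iso_L: "g \<in> carrier G \<Longrightarrow> iso (L g) = g"
proof (rule extensionalityI[where A = H])
  assume "g \<in> carrier G"
  then show "g \<in> extensional H" using Bij_imp_extensional carrier_iff by blast
qed (auto simp: iso_def L_H)

lemma L_mult: assumes "g \<in> carrier G" "h \<in> carrier G" shows "L (g \<otimes>\<^bsub>G\<^esub> h) = L g \<circ> L h"
  by (rule lift_eqI) (use assms in \<open>auto simp: OG_comp L_OG mult_G compose_eq L_H carrier_closed\<close>)

lemma L_one: "L \<one>\<^bsub>G\<^esub> = id"
  by (rule lift_eqI) (auto simp: OG_id one_G)

lemma L_inv: assumes "g \<in> carrier G" shows "L g (L (inv\<^bsub>G\<^esub> g) x) = x" "L (inv\<^bsub>G\<^esub> g) (L g x) = x"
  using L_mult[of g "inv\<^bsub>G\<^esub> g"] L_mult[of "inv\<^bsub>G\<^esub> g" g] assms by (simp_all add: L_one fun_eq_iff)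

lemma carrier_eqI: "g \<in> carrier G \<Longrightarrow> h \<in> carrier G \<Longrightarrow> L g = L h \<Longrightarrow> g = h"
  using iso_L by metis

lemma iso_comp: "A \<in> OG \<Longrightarrow> A' \<in> OG \<Longrightarrow> iso (A \<circ> A') = iso A \<otimes>\<^bsub>G\<^esub> iso A'"
  by (rule carrier_eqI) (auto simp: iso_carrier OG_comp L_iso L_mult)

subsection \<open>The metric and the topology of the isometry group\<close>

lemma Metric_space_H: "Metric_space H (hyp_dist e)"
proof
  show "hyp_dist e x y \<ge> 0" for x y
    using H_B_ge1[of x y] by (auto simp: hyp_dist_def hyp_form_eq)
  show "hyp_dist e x y = hyp_dist e y x" for x y
    by (auto simp: hyp_dist_def hyp_form_eq B_commute)
  show "hyp_dist e x y = 0 \<longleftrightarrow> x = y" if "x \<in> H" "y \<in> H" for x y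
  proof -
    have "hyp_dist e y y = 0" using that by (simp add: hyp_dist_eq H_iff)
    then have "hyp_dist e x y = 0 \<longleftrightarrow> B x y = B y y" using that hyp_dist_eq_iff by metis
    then show ?thesis using that H_B_gt1[of x y] unfolding H_iff by force
  qed
  show "hyp_dist e x z \<le> hyp_dist e x y + hyp_dist e y z" if xyz: "x \<in> H" "y \<in> H" "z \<in> H" for x y z
  proof -
    \<comment> \<open>With the middle point at \<open>e 0\<close> the distances are read off from
      the time coordinates and the tails have norms \<open>sinh a\<close> and \<open>sinh b\<close>.
      Cauchy-Schwarz for the tails replaces the hyperbolic law of cosines by the bound
      \<open>cosh (a + b)\<close>.\<close>
    obtain A where A: "A \<in> OG" "A y = e 0" using OG_transitive[OF xyz(2) e0_H] by blast
    define a where "a = arcosh (A x \<bullet> e 0)"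
    define b where "b = arcosh (A z \<bullet> e 0)"
    have Hx: "A x \<in> H" "A z \<in> H" using OG_H[OF A(1)] xyz by auto
    then have ge: "A x \<bullet> e 0 \<ge> 1" "A z \<bullet> e 0 \<ge> 1" using H_B_ge1[OF _ e0_H] by (metis B_e0(1))+
    then have ab: "a \<ge> 0" "b \<ge> 0" "cosh a = A x \<bullet> e 0" "cosh b = A z \<bullet> e 0"
      unfolding a_def b_def by (auto simp: cosh_arcosh_real)
    have nt: "norm (tail (A x)) = sinh a" "norm (tail (A z)) = sinh b"
      using norm_tail[of "A x"] norm_tail[of "A z"] Hx ab cosh_square_eq[of a] cosh_square_eq[of b]
      unfolding H_iff by (auto intro!: power2_eq_imp_eq)
    have "B x z = B (A x) (A z)" by (simp add: OG_B[OF A(1)])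
    also have "\<dots> \<le> cosh a * cosh b + norm (tail (A x)) * norm (tail (A z))"
      unfolding B_tail ab using Cauchy_Schwarz_ineq2[of "tail (A x)" "tail (A z)"] by linarith
    also have "\<dots> = cosh (a + b)" unfolding nt cosh_add ..
    finally have "B x z \<le> cosh (a + b)" .
    then have "\<not> arcosh (cosh (a + b)) < arcosh (B x z)"
      using H_B_ge1[OF xyz(1,3)] cosh_real_ge_1[of "a + b"] by simp
    then have "arcosh (B x z) \<le> arcosh (cosh (a + b))" by simp
    then have "hyp_dist e x z \<le> a + b" using ab xyz by (simp add: hyp_dist_eq arcosh_cosh_real)
    also have "a = hyp_dist e x y"
      unfolding a_def using xyz OG_B[OF A(1), of x y] A(2) by (simp add: hyp_dist_eq B_e0)
    also have "b = hyp_dist e y z"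
      unfolding b_def using xyz OG_B[OF A(1), of y z] A(2) by (simp add: hyp_dist_eq B_e0)
    finally show ?thesis .
  qed
qed

lemma norm_small_if_dist_small:
  assumes x: "x \<in> H" and \<epsilon>: "\<epsilon> > 0"
  obtains r where "r > 0" "\<And>y. y \<in> H \<Longrightarrow> hyp_dist e x y < r \<Longrightarrow> norm (y - x) < \<epsilon>"
proof -
  obtain A where A: "A \<in> OG" "A (e 0) = x" using OG_transitive[OF e0_H x] by blast
  obtain K where K: "K > 0" "\<And>y. norm (A y) \<le> K * norm y" using OG_bounded[OF A(1)] by blast
  \<comment> \<open>At \<open>e 0\<close> the squared norm of the displacement is
    \<open>2 * z\<^sub>0 * (z\<^sub>0 - 1)\<close>. The bound \<open>1\<close> keeps the time
    coordinate below 2, and the other bound absorbs the norm \<open>K\<close> of the map that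
    transports \<open>e 0\<close> to \<open>x\<close>.\<close>
  define \<eta> where "\<eta> = min 1 (\<epsilon>\<^sup>2 / (4 * K\<^sup>2))"
  have \<eta>: "\<eta> > 0" "\<eta> \<le> 1" "4 * K\<^sup>2 * \<eta> \<le> \<epsilon>\<^sup>2"
  proof -
    show "\<eta> > 0" "\<eta> \<le> 1" unfolding \<eta>_def using \<epsilon> K(1) by auto
    have "4 * K\<^sup>2 * \<eta> \<le> 4 * K\<^sup>2 * (\<epsilon>\<^sup>2 / (4 * K\<^sup>2))" unfolding \<eta>_def by (intro mult_left_mono) auto
    then show "4 * K\<^sup>2 * \<eta> \<le> \<epsilon>\<^sup>2" using K(1) by simp
  qed
  show ?thesis
  proof (rule that[of "arcosh (1 + \<eta>)"])
    show "arcosh (1 + \<eta>) > 0" using \<eta>(1) by simp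
    fix y assume y: "y \<in> H" "hyp_dist e x y < arcosh (1 + \<eta>)"
    define z where "z = finv A y"
    have z: "z \<in> H" "A z = y" unfolding z_def using OG_inv[OF A(1)] OG_H y(1) by auto
    have z0: "z \<bullet> e 0 = B x y" using OG_B[OF A(1), of "e 0" z] A(2) z(2) by (simp add: B_e0)
    have ge: "B x y \<ge> 1" using H_B_ge1[OF x y(1)] .
    have "arcosh (B x y) < arcosh (1 + \<eta>)" using y x by (simp add: hyp_dist_eq)
    then have lt: "B x y < 1 + \<eta>" using arcosh_less_iff_real[OF ge, of "1 + \<eta>"] \<eta>(1) by simp
    have "(norm (z - e 0))\<^sup>2 = 2 * (z \<bullet> e 0) * (z \<bullet> e 0 - 1)"
      using z(1) norm_B[of "z - e 0"] e0_H unfolding H_iff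
      by (simp add: B_simps B_e0 inner_diff_left power2_eq_square algebra_simps)
    also have "\<dots> < 4 * \<eta>"
    proof -
      have "(z \<bullet> e 0) * (z \<bullet> e 0 - 1) < 2 * \<eta>"
        unfolding z0 using ge lt \<eta> by (intro mult_le_less_imp_less) auto
      then show ?thesis by simp
    qed
    finally have *: "(norm (z - e 0))\<^sup>2 < 4 * \<eta>" .
    have "norm (y - x) = norm (A (z - e 0))"
      using z(2) A by (simp add: linear_diff[OF OG_linear[OF A(1)]])
    also have "\<dots> \<le> K * norm (z - e 0)" by (rule K(2))
    finally have "(norm (y - x))\<^sup>2 \<le> (K * norm (z - e 0))\<^sup>2" by (simp add: power_mono)
    also have "\<dots> = K\<^sup>2 * (norm (z - e 0))\<^sup>2" by (simp add: power_mult_distrib)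
    also have "\<dots> < K\<^sup>2 * (4 * \<eta>)" using * K(1) by (intro mult_strict_left_mono) auto
    also have "\<dots> \<le> \<epsilon>\<^sup>2" using \<eta>(3) by (simp add: mult.assoc mult.left_commute)
    finally show "norm (y - x) < \<epsilon>" by (rule power_less_imp_less_base) (use \<epsilon> in simp)
  qed
qed

lemma dist_small_if_norm_small:
  assumes x: "x \<in> H" and r: "r > 0"
  obtains \<epsilon> where "\<epsilon> > 0" "\<And>y. y \<in> H \<Longrightarrow> norm (y - x) < \<epsilon> \<Longrightarrow> hyp_dist e x y < r"
proof -
  have "1 < cosh r" using r cosh_real_strict_mono[of 0 r] by simp
  moreover have "((\<lambda>y. B x y) \<longlongrightarrow> B x x) (at x)" by (intro tendsto_intros)
  ultimately have "eventually (\<lambda>y. B x y < cosh r) (at x)"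
    using x unfolding H_iff by (intro order_tendstoD) auto
  then obtain \<epsilon> where \<epsilon>: "\<epsilon> > 0" "\<And>y. y \<noteq> x \<Longrightarrow> dist y x < \<epsilon> \<Longrightarrow> B x y < cosh r"
    unfolding eventually_at by auto
  show ?thesis
  proof (rule that[OF \<epsilon>(1)])
    fix y assume y: "y \<in> H" "norm (y - x) < \<epsilon>"
    have "B x y < cosh r" using \<epsilon>(2)[of y] y \<open>1 < cosh r\<close> x unfolding H_iff dist_norm by (cases "y = x") auto
    then have "arcosh (B x y) < arcosh (cosh r)"
      using H_B_ge1[OF x y(1)] \<open>1 < cosh r\<close> by simp
    then show "hyp_dist e x y < r" using x y(1) r by (simp add: hyp_dist_eq arcosh_cosh_real)
  qed
qed

text \<open>From here on the topology of the group is pointwise convergence in norm on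
  \<open>H\<close>.\<close>

lemma mtopology_H: "Metric_space.mtopology H (hyp_dist e) = top_of_set H"
proof -
  interpret Metric_space H "hyp_dist e" by (rule Metric_space_H)
  have "openin mtopology S \<longleftrightarrow> openin (top_of_set H) S" for S
  proof
    assume S: "openin mtopology S"
    then have SH: "S \<subseteq> H" unfolding openin_mtopology by blast
    show "openin (top_of_set H) S"
      unfolding openin_contains_ball
    proof (intro conjI ballI SH)
      fix x assume x: "x \<in> S"
      then obtain r where r: "r > 0" "mball x r \<subseteq> S" using S unfolding openin_mtopology by blast
      have xH: "x \<in> H" using x SH by blast
      obtain \<epsilon> where \<epsilon>: "\<epsilon> > 0" "\<And>y. y \<in> H \<Longrightarrow> norm (y - x) < \<epsilon> \<Longrightarrow> hyp_dist e x y < r"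
        by (rule dist_small_if_norm_small[OF xH r(1)]) (rule that)
      have "y \<in> S" if "y \<in> ball x \<epsilon> \<inter> H" for y
      proof -
        have "y \<in> mball x r" using that \<epsilon>(2)[of y] xH by (simp add: dist_norm norm_minus_commute)
        then show ?thesis using r(2) by blast
      qed
      then show "\<exists>\<epsilon>>0. ball x \<epsilon> \<inter> H \<subseteq> S" using \<epsilon>(1) by blast
    qed
  next
    assume S: "openin (top_of_set H) S"
    then have SH: "S \<subseteq> H" unfolding openin_contains_ball by blast
    show "openin mtopology S"
      unfolding openin_mtopology
    proof (intro conjI allI impI SH)
      fix x assume x: "x \<in> S"
      then obtain \<epsilon> where \<epsilon>: "\<epsilon> > 0" "ball x \<epsilon> \<inter> H \<subseteq> S" using S unfolding openin_contains_ball by blast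
      have xH: "x \<in> H" using x SH by blast
      obtain r where r: "r > 0" "\<And>y. y \<in> H \<Longrightarrow> hyp_dist e x y < r \<Longrightarrow> norm (y - x) < \<epsilon>"
        by (rule norm_small_if_dist_small[OF xH \<epsilon>(1)]) (rule that)
      have "y \<in> S" if "y \<in> mball x r" for y
      proof -
        have "y \<in> ball x \<epsilon> \<inter> H" using that r(2)[of y] by (simp add: dist_norm norm_minus_commute)
        then show ?thesis using \<epsilon>(2) by blast
      qed
      then show "\<exists>r>0. mball x r \<subseteq> S" using r(1) by blast
    qed
  qed
  then show ?thesis by (simp add: topology_eq)
qed

abbreviation "TG \<equiv> hyp_Isom_topology e"

lemma TG_eq: "TG = subtopology (product_topology (\<lambda>_. top_of_set H) H) (carrier G)"
  unfolding hyp_Isom_topology_def mtopology_H ..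

lemma topspace_TG: "topspace TG = carrier G"
proof -
  have "carrier G \<subseteq> PiE H (\<lambda>_. H)"
  proof
    fix g assume g: "g \<in> carrier G"
    then have "g \<in> extensional H" using Bij_imp_extensional carrier_iff by blast
    then show "g \<in> PiE H (\<lambda>_. H)" using carrier_closed[OF g] by (simp add: PiE_def)
  qed
  then show ?thesis unfolding TG_eq by auto
qed

lemma continuous_map_eval: assumes "p \<in> H" shows "continuous_map TG euclidean (\<lambda>g. g p)"
proof -
  have "continuous_map TG (top_of_set H) (\<lambda>g. g p)"
    unfolding TG_eq by (intro continuous_map_from_subtopology continuous_map_product_projection assms)
  then show ?thesis using continuous_map_in_subtopology by blast
qed

lemma continuous_map_euclideanI:
  fixes f :: "'z \<Rightarrow> 'b::real_normed_vector"
  assumes "\<And>x \<epsilon>. x \<in> topspace Z \<Longrightarrow> \<epsilon> > 0 \<Longrightarrow>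
    \<exists>W. openin Z W \<and> x \<in> W \<and> (\<forall>y\<in>W. norm (f y - f x) < \<epsilon>)"
  shows "continuous_map Z euclidean f"
  unfolding continuous_map_def
proof (intro conjI allI impI)
  fix U :: "'b set" assume "openin euclidean U"
  then have U: "open U" by simp
  show "openin Z {x \<in> topspace Z. f x \<in> U}"
  proof (subst openin_subopen, clarify)
    fix x assume x: "x \<in> topspace Z" "f x \<in> U"
    obtain \<epsilon> where \<epsilon>: "\<epsilon> > 0" "ball (f x) \<epsilon> \<subseteq> U" using U x(2) open_contains_ball by blast
    obtain W where W: "openin Z W" "x \<in> W" "\<And>y. y \<in> W \<Longrightarrow> norm (f y - f x) < \<epsilon>"
      using assms[OF x(1) \<epsilon>(1)] by blast
    have "f y \<in> U" if "y \<in> W" for y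
    proof -
      have "f y \<in> ball (f x) \<epsilon>" using W(3)[OF that] by (simp add: dist_norm norm_minus_commute)
      then show ?thesis using \<epsilon>(2) by blast
    qed
    then show "\<exists>T. openin Z T \<and> x \<in> T \<and> T \<subseteq> {x \<in> topspace Z. f x \<in> U}"
      using W(1,2) openin_subset[OF W(1)] by (intro exI[of _ W]) auto
  qed
qed simp

lemma continuous_map_euclideanD:
  fixes f :: "'z \<Rightarrow> 'b::real_normed_vector"
  assumes "continuous_map Z euclidean f" "x \<in> topspace Z" "\<epsilon> > 0"
  obtains W where "openin Z W" "x \<in> W" "\<And>y. y \<in> W \<Longrightarrow> norm (f y - f x) < \<epsilon>"
proof (rule that)
  show "openin Z {y \<in> topspace Z. f y \<in> ball (f x) \<epsilon>}"
    by (rule openin_continuous_map_preimage[OF assms(1)]) simp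
qed (use assms in \<open>auto simp: dist_norm norm_minus_commute\<close>)

lemma continuous_map_L_if:
  assumes "\<And>p. p \<in> H \<Longrightarrow> continuous_map TG euclidean (\<lambda>g. L (k g) p)" "\<And>g. g \<in> carrier G \<Longrightarrow> k g \<in> carrier G"
  shows "continuous_map TG euclidean (\<lambda>g. L (k g) x)"
proof -
  obtain s t p where p: "p \<in> H" "x = s *\<^sub>R p - t *\<^sub>R e 0" by (rule decomposition)
  have "continuous_map TG euclidean (\<lambda>g. s *\<^sub>R L (k g) p - t *\<^sub>R L (k g) (e 0))"
    using assms(1)[OF p(1)] assms(1)[OF e0_H]
    by (simp add: continuous_map_atin tendsto_diff tendsto_scaleR)
  then show ?thesis
    by (rule continuous_map_eq) (use p assms(2) L_OG OG_linear in \<open>simp add: topspace_TG linear_diff linear_scale\<close>)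
qed

lemma continuous_map_L: "continuous_map TG euclidean (\<lambda>g. L g x)"
proof (rule continuous_map_L_if[where k = "\<lambda>g. g"])
  show "continuous_map TG euclidean (\<lambda>g. L g p)" if "p \<in> H" for p
    by (rule continuous_map_eq[OF continuous_map_eval[OF that]]) (simp add: topspace_TG L_H that)
qed

text \<open>For an isometry the distance from \<open>q\<close> to the preimage of \<open>p\<close>
  equals the distance from the image of \<open>q\<close> to \<open>p\<close>. With \<open>q\<close>
  the preimage of \<open>p\<close> under \<open>g0\<close>, closeness of \<open>g q\<close> to
  \<open>p\<close> thus suffices.\<close>

lemma continuous_map_L_inv: "continuous_map TG euclidean (\<lambda>g. L (inv\<^bsub>G\<^esub> g) x)"
proof (rule continuous_map_L_if)
  fix p assume p: "p \<in> H"
  show "continuous_map TG euclidean (\<lambda>g. L (inv\<^bsub>G\<^esub> g) p)"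
  proof (rule continuous_map_euclideanI)
    fix g0 and \<epsilon> :: real assume g0: "g0 \<in> topspace TG" and \<epsilon>: "\<epsilon> > 0"
    then have g0G: "g0 \<in> carrier G" by (simp add: topspace_TG)
    define q where "q = L (inv\<^bsub>G\<^esub> g0) p"
    have qH: "q \<in> H" unfolding q_def using g0G p by (intro OG_H[OF L_OG]) auto
    have g0q: "L g0 q = p" unfolding q_def using L_inv[OF g0G] by simp
    obtain r where r: "r > 0" "\<And>y. y \<in> H \<Longrightarrow> hyp_dist e q y < r \<Longrightarrow> norm (y - q) < \<epsilon>"
      using norm_small_if_dist_small[OF qH \<epsilon>] by blast
    obtain \<eta> where \<eta>: "\<eta> > 0" "\<And>y. y \<in> H \<Longrightarrow> norm (y - p) < \<eta> \<Longrightarrow> hyp_dist e p y < r"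
      using dist_small_if_norm_small[OF p r(1)] by blast
    obtain W where W: "openin TG W" "g0 \<in> W" "\<And>g. g \<in> W \<Longrightarrow> norm (L g q - L g0 q) < \<eta>"
      using continuous_map_euclideanD[OF continuous_map_L g0 \<eta>(1)] by blast
    have "norm (L (inv\<^bsub>G\<^esub> g) p - q) < \<epsilon>" if g: "g \<in> W" for g
    proof (rule r(2))
      have gG: "g \<in> carrier G" using g W(1) openin_subset topspace_TG by blast
      show y: "L (inv\<^bsub>G\<^esub> g) p \<in> H" using gG p by (intro OG_H[OF L_OG]) auto
      have gq: "L g q \<in> H" using gG qH by (intro OG_H[OF L_OG]) auto
      have "B q (L (inv\<^bsub>G\<^esub> g) p) = B (L g q) p"
        using OG_B[OF L_OG[OF gG], of q "L (inv\<^bsub>G\<^esub> g) p"] L_inv[OF gG] by simp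
      then have "hyp_dist e q (L (inv\<^bsub>G\<^esub> g) p) = hyp_dist e p (L g q)"
        using qH y p gq by (simp add: hyp_dist_eq B_commute)
      then show "hyp_dist e q (L (inv\<^bsub>G\<^esub> g) p) < r" using \<eta>(2)[OF gq] W(3)[OF g] g0q by simp
    qed
    then show "\<exists>W. openin TG W \<and> g0 \<in> W \<and> (\<forall>g\<in>W. norm (L (inv\<^bsub>G\<^esub> g) p - L (inv\<^bsub>G\<^esub> g0) p) < \<epsilon>)"
      using W unfolding q_def by blast
  qed
qed simp

text \<open>The form in which smallness is verified throughout: to lie in \<open>V\<close> it
  suffices to move finitely many points of \<open>H\<close> by little in norm.\<close>

lemma TG_nbhd:
  assumes V: "openin TG V" "\<one>\<^bsub>G\<^esub> \<in> V"
  obtains F \<epsilon> where "finite F" "F \<subseteq> H" "\<epsilon> > 0"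
    "\<And>A. A \<in> OG \<Longrightarrow> \<forall>p\<in>F. norm (A p - p) < \<epsilon> \<Longrightarrow> iso A \<in> V"
proof -
  obtain S where S: "openin (product_topology (\<lambda>_. top_of_set H) H) S" "V = S \<inter> carrier G"
    using V(1) unfolding TG_eq openin_subtopology by blast
  have "\<one>\<^bsub>G\<^esub> \<in> S" using V(2) S(2) by blast
  from S(1)[unfolded openin_product_topology_alt, rule_format, OF this]
  obtain U where U: "finite {p \<in> H. U p \<noteq> topspace (top_of_set H)}"
    "\<forall>p\<in>H. openin (top_of_set H) (U p)" "\<one>\<^bsub>G\<^esub> \<in> PiE H U" "PiE H U \<subseteq> S"
    by (elim exE conjE) (rule that)
  define F where "F = {p \<in> H. U p \<noteq> H}"
  have F: "finite F" "F \<subseteq> H" using U(1) unfolding F_def by auto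
  have "\<exists>\<epsilon>>0. ball p \<epsilon> \<inter> H \<subseteq> U p" if p: "p \<in> F" for p
  proof -
    have "p \<in> H" using p F(2) by blast
    moreover then have "p \<in> U p" using U(3) by (auto simp: one_G PiE_def Pi_def)
    ultimately show ?thesis using U(2) unfolding openin_contains_ball by blast
  qed
  then obtain \<epsilon>' where \<epsilon>': "\<And>p. p \<in> F \<Longrightarrow> \<epsilon>' p > 0" "\<And>p. p \<in> F \<Longrightarrow> ball p (\<epsilon>' p) \<inter> H \<subseteq> U p"
    by metis
  define \<epsilon> where "\<epsilon> = Min (insert 1 (\<epsilon>' ` F))"
  have \<epsilon>: "\<epsilon> > 0" "\<And>p. p \<in> F \<Longrightarrow> \<epsilon> \<le> \<epsilon>' p"
    unfolding \<epsilon>_def using F(1) \<epsilon>'(1) by (auto simp: Min_gr_iff)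
  show ?thesis
  proof (rule that[OF F \<epsilon>(1)])
    fix A assume A: "A \<in> OG" "\<forall>p\<in>F. norm (A p - p) < \<epsilon>"
    have "A p \<in> U p" if p: "p \<in> H" for p
    proof (cases "p \<in> F")
      case True
      have "A p \<in> ball p (\<epsilon>' p)" using bspec[OF A(2) True] \<epsilon>(2)[OF True] by (simp add: dist_norm norm_minus_commute)
      then show ?thesis using \<epsilon>'(2)[OF True] OG_H[OF A(1) p] by blast
    next
      case False
      then have "U p = H" using p unfolding F_def by blast
      then show ?thesis using OG_H[OF A(1) p] by simp
    qed
    then have "iso A \<in> PiE H U" unfolding iso_def by auto
    then show "iso A \<in> V" using S(2) U(4) iso_carrier[OF A(1)] by blast
  qed
qed

subsection \<open>The action on the closed ball\<close>

abbreviation "D \<equiv> hyp_disc e"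
abbreviation "XT \<equiv> hyp_closure_topology e"

definition line :: "'a \<Rightarrow> 'a set" where "line x = span {e 0 + x}"

text \<open>The Klein model: the line of \<open>u\<close> meets the affine hyperplane of time
  coordinate 1 in \<open>e 0 + proj u\<close>. For lines in the closed cone this inverts
  \<open>line\<close>.\<close>

definition proj :: "'a \<Rightarrow> 'a" where "proj u = (1 / (u \<bullet> e 0)) *\<^sub>R u - e 0"

definition dact :: "('a \<Rightarrow> 'a) \<Rightarrow> 'a \<Rightarrow> 'a" where "dact g x = proj (L g (e 0 + x))"

lemma D_iff: "x \<in> D \<longleftrightarrow> x \<bullet> e 0 = 0 \<and> norm x \<le> 1"
  unfolding hyp_disc_def by simp

lemma D_e0: assumes "x \<bullet> e 0 = 0"
  shows "(e 0 + x) \<bullet> e 0 = 1" "B (e 0 + x) (e 0 + x) = 1 - (norm x)\<^sup>2"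
  using assms by (simp_all add: B_def inner_add_left inner_add_right power2_norm_eq_inner inner_commute)

lemma D_cone: assumes "x \<in> D" shows "B (e 0 + x) (e 0 + x) \<ge> 0" "(e 0 + x) \<bullet> e 0 > 0"
  using assms unfolding D_iff by (simp_all add: D_e0 abs_square_le_1)

lemma proj_scale: "c \<noteq> 0 \<Longrightarrow> proj (c *\<^sub>R u) = proj u"
  unfolding proj_def by simp

lemma proj_e0: "x \<bullet> e 0 = 0 \<Longrightarrow> proj (e 0 + x) = x"
  unfolding proj_def by (simp add: D_e0)

lemma e0_proj: "e 0 + proj u = (1 / (u \<bullet> e 0)) *\<^sub>R u"
  unfolding proj_def by simp

lemma span_scale_singleton: assumes "c \<noteq> 0" shows "span {c *\<^sub>R u} = span {u :: 'a}"
unfolding span_eq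
proof
  show "{c *\<^sub>R u} \<subseteq> span {u}" by (simp add: span_base span_scale)
  have "(1 / c) *\<^sub>R (c *\<^sub>R u) \<in> span {c *\<^sub>R u}" by (intro span_scale span_base) simp
  then show "{u} \<subseteq> span {c *\<^sub>R u}" using assms by simp
qed

lemma line_proj: "u \<bullet> e 0 \<noteq> 0 \<Longrightarrow> line (proj u) = span {u}"
  unfolding line_def e0_proj by (rule span_scale_singleton) simp

lemma proj_D: assumes "B u u \<ge> 0" "u \<bullet> e 0 > 0" shows "proj u \<in> D"
proof -
  have 0: "proj u \<bullet> e 0 = 0" unfolding proj_def using assms(2) by (simp add: inner_diff_left)
  have "1 - (norm (proj u))\<^sup>2 = B u u / (u \<bullet> e 0)\<^sup>2"
    using D_e0(2)[OF 0] unfolding e0_proj by (simp add: B_simps power2_eq_square)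
  moreover have "B u u / (u \<bullet> e 0)\<^sup>2 \<ge> 0" using assms by simp
  ultimately have "(norm (proj u))\<^sup>2 \<le> 1" by linarith
  then show ?thesis using 0 unfolding D_iff by (simp add: abs_square_le_1)
qed

lemma OG_cone:
  assumes A: "A \<in> OG" and u: "B u u \<ge> 0" "u \<bullet> e 0 > 0"
  shows "B (A u) (A u) \<ge> 0" "A u \<bullet> e 0 > 0"
proof -
  show "B (A u) (A u) \<ge> 0" using u OG_B[OF A] by simp
  have "finv A (e 0) \<in> H" using OG_H[OF OG_inv(1)[OF A] e0_H] .
  then have "B u (finv A (e 0)) > 0" using B_pos[OF u] unfolding H_iff by simp
  then show "A u \<bullet> e 0 > 0" using OG_B[OF A, of u "finv A (e 0)"] OG_inv(2)[OF A] by (simp add: B_e0)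
qed

lemma line_inj: "x \<in> D \<Longrightarrow> y \<in> D \<Longrightarrow> line x = line y \<Longrightarrow> x = y"
proof -
  assume xy: "x \<in> D" "y \<in> D" "line x = line y"
  have "e 0 + x \<in> line y" using xy(3) span_base[of "e 0 + x" "{e 0 + x}"] unfolding line_def by simp
  then obtain c where c: "e 0 + x = c *\<^sub>R (e 0 + y)" unfolding line_def span_singleton by blast
  have "(e 0 + x) \<bullet> e 0 = c * ((e 0 + y) \<bullet> e 0)" unfolding c by simp
  then have "c = 1" using xy unfolding D_iff by (simp add: D_e0)
  then show "x = y" using c by simp
qed

lemma span_in_line_image:
  assumes "B x x \<ge> 0" "x \<noteq> 0" shows "span {x} \<in> line ` D"
proof -
  have pos: "span {y} \<in> line ` D" if "B y y \<ge> 0" "y \<bullet> e 0 > 0" for y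
    using line_proj[of y] proj_D[OF that] that(2) by (intro image_eqI[of _ _ "proj y"]) auto
  have "x \<bullet> e 0 \<noteq> 0"
  proof
    assume "x \<bullet> e 0 = 0"
    then have "B x x = - (x \<bullet> x)" unfolding B_def by simp
    then show False using assms inner_gt_zero_iff[of x] by linarith
  qed
  then consider "x \<bullet> e 0 > 0" | "(- x) \<bullet> e 0 > 0" by force
  then show ?thesis
  proof cases
    case 1
    then show ?thesis using pos assms(1) by blast
  next
    case 2
    have "span {- x} = span {x}" using span_scale_singleton[of "-1" x] by simp
    moreover have "B (- x) (- x) \<ge> 0" using assms(1) by (simp add: B_simps)
    ultimately show ?thesis using pos[of "- x"] 2 by simp
  qed
qed

lemma hyp_closure_eq: "hyp_closure e = line ` D"
proof
  show "hyp_closure e \<subseteq> line ` D"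
  proof
    fix l assume "l \<in> hyp_closure e"
    then obtain x where x: "l = span {x}" "B x x > 0 \<or> x \<noteq> 0 \<and> B x x = 0"
      unfolding hyp_closure_def hyp_positive_lines_def hyp_boundary_def hyp_Q_eq by blast
    then have "x \<noteq> 0" "B x x \<ge> 0" by (auto simp: B_simps)
    then show "l \<in> line ` D" unfolding x(1) by (intro span_in_line_image)
  qed
  show "line ` D \<subseteq> hyp_closure e"
  proof
    fix l assume "l \<in> line ` D"
    then obtain x where x: "x \<in> D" "l = span {e 0 + x}" unfolding line_def by blast
    have ne: "e 0 + x \<noteq> 0" using D_cone(2)[OF x(1)] by auto
    have "B (e 0 + x) (e 0 + x) > 0 \<or> B (e 0 + x) (e 0 + x) = 0"
      using D_cone(1)[OF x(1)] by linarith
    then show "l \<in> hyp_closure e"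
      unfolding x(2) hyp_closure_def hyp_positive_lines_def hyp_boundary_def hyp_Q_eq using ne by blast
  qed
qed

lemma hyp_boundary_eq: "hyp_boundary e = line ` {b. b \<bullet> e 0 = 0 \<and> norm b = 1}"
proof
  show "hyp_boundary e \<subseteq> line ` {b. b \<bullet> e 0 = 0 \<and> norm b = 1}"
  proof
    fix l assume l: "l \<in> hyp_boundary e"
    then obtain x where x: "l = span {x}" "x \<noteq> 0" "B x x = 0"
      unfolding hyp_boundary_def hyp_Q_eq by blast
    obtain b where b: "b \<in> D" "l = line b" using l hyp_closure_eq unfolding hyp_closure_def by blast
    have "e 0 + b \<in> span {x}" using b(2) x(1) span_base[of "e 0 + b" "{e 0 + b}"] unfolding line_def by simp
    then obtain c where "e 0 + b = c *\<^sub>R x" unfolding span_singleton by blast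
    then have "B (e 0 + b) (e 0 + b) = 0" using x(3) by (simp add: B_simps)
    then have "norm b = 1 \<or> norm b = - 1" using b(1) unfolding D_iff by (simp add: D_e0 power2_eq_1_iff)
    then have "norm b = 1" using norm_ge_zero[of b] by linarith
    then show "l \<in> line ` {b. b \<bullet> e 0 = 0 \<and> norm b = 1}" using b unfolding D_iff by blast
  qed
  show "line ` {b. b \<bullet> e 0 = 0 \<and> norm b = 1} \<subseteq> hyp_boundary e"
  proof clarify
    fix b assume b: "b \<bullet> e 0 = 0" "norm b = 1"
    have "e 0 + b \<noteq> 0" using D_e0(1)[OF b(1)] by auto
    then show "line b \<in> hyp_boundary e" unfolding hyp_boundary_def hyp_Q_eq line_def using D_e0(2)[OF b(1)] b(2) by auto
  qed
qed

lemma hyp_action_line: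
  assumes g: "g \<in> carrier G" and x: "x \<in> D"
  shows "hyp_action e g (line x) = line (dact g x)" "dact g x \<in> D"
proof -
  have c: "B (L g (e 0 + x)) (L g (e 0 + x)) \<ge> 0" "L g (e 0 + x) \<bullet> e 0 > 0"
    using OG_cone[OF L_OG[OF g] D_cone[OF x]] by auto
  show "dact g x \<in> D" unfolding dact_def by (rule proj_D[OF c])
  have "hyp_action e g (line x) = L g ` span {e 0 + x}"
    unfolding hyp_action_def hyp_closure_eq using x by (simp add: line_def)
  also have "\<dots> = span {L g (e 0 + x)}"
    using linear_span_image[OF OG_linear[OF L_OG[OF g]], of "{e 0 + x}"] by simp
  also have "\<dots> = line (dact g x)" unfolding dact_def using c by (intro line_proj[symmetric]) auto
  finally show "hyp_action e g (line x) = line (dact g x)" .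
qed

lemma dact_iso: "A \<in> OG \<Longrightarrow> dact (iso A) x = proj (A (e 0 + x))"
  unfolding dact_def by (simp add: L_iso)

lemma inv_into_line: "x \<in> D \<Longrightarrow> inv_into D line (line x) = x"
  by (rule inv_into_f_f) (auto intro!: inj_onI line_inj)

lemma homeomorphic_line: "homeomorphic_map Wd XT line"
proof -
  let ?h = "inv_into D line"
  have XT: "XT = pullback_topology (line ` D) ?h Wd"
    unfolding hyp_closure_topology_def hyp_closure_eq line_def ..
  have 1: "continuous_map Wd XT line"
    unfolding XT
  proof (rule continuous_map_pullback')
    show "continuous_map Wd Wd (?h \<circ> line)"
      by (rule continuous_map_eq[OF continuous_map_id]) (simp add: inv_into_line)
    show "topspace Wd \<subseteq> line -` (line ` D)" by auto
  qed
  have "continuous_map XT Wd (id \<circ> ?h)"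
    unfolding XT by (rule continuous_map_pullback) (rule continuous_map_id)
  then have 2: "continuous_map XT Wd ?h" by simp
  have "topspace XT = line ` D"
    unfolding XT topspace_pullback_topology by (auto simp: inv_into_line)
  then have "homeomorphic_maps Wd XT line ?h"
    unfolding homeomorphic_maps_def using 1 2 by (auto simp: inv_into_line)
  then show ?thesis using homeomorphic_map_maps by blast
qed

lemma topspace_XT: "topspace XT = line ` D"
  using homeomorphic_imp_surjective_map[OF homeomorphic_line] by simp

lemma openin_XT: "openin Wd W \<Longrightarrow> openin XT (line ` W)"
  using homeomorphic_line homeomorphic_imp_open_map open_map_def by blast

lemma openin_XT': "openin XT W \<Longrightarrow> openin Wd {x \<in> D. line x \<in> W}"
  using openin_continuous_map_preimage[OF homeomorphic_imp_continuous_map[OF homeomorphic_line]] by simp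

lemma limitin_XT:
  assumes "(f \<longlongrightarrow> z) F" "\<forall>\<^sub>F t in F. f t \<in> D" "z \<in> D"
  shows "limitin XT (\<lambda>t. line (f t)) (line z) F"
proof -
  have "continuous_map (top_of_set D) Wd (\<lambda>x. x)"
    by (rule continuous_map_into_Wd) (auto simp: continuous_on_inner)
  then have "continuous_map (top_of_set D) XT (line \<circ> (\<lambda>x. x))"
    using continuous_map_compose homeomorphic_imp_continuous_map[OF homeomorphic_line] by blast
  moreover have "limitin (top_of_set D) f z F" using assms by (simp add: limitin_subtopology)
  ultimately show ?thesis using continuous_map_limit by (fastforce simp: comp_def)
qed

lemma flow_D: "G_flow G TG Wd (\<lambda>g. \<lambda>x\<in>D. dact g x)"
  unfolding G_flow_def
proof (intro conjI)
  have "0 \<in> D" unfolding D_iff by simp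
  then show "topspace Wd \<noteq> {}" by auto
  show "group_action G (topspace Wd) (\<lambda>g. \<lambda>x\<in>D. dact g x)"
  proof (rule group_actionI[OF group_G])
    fix g h x assume gh: "g \<in> carrier G" "h \<in> carrier G" "x \<in> topspace Wd"
    then have x: "x \<in> D" by simp
    define c where "c = L h (e 0 + x) \<bullet> e 0"
    have "c > 0" unfolding c_def using OG_cone[OF L_OG[OF gh(2)] D_cone[OF x]] by auto
    have "dact g (dact h x) = proj ((1 / c) *\<^sub>R L g (L h (e 0 + x)))"
      unfolding dact_def e0_proj c_def by (simp add: linear_scale[OF OG_linear[OF L_OG[OF gh(1)]]])
    also have "\<dots> = dact (g \<otimes>\<^bsub>G\<^esub> h) x"
      unfolding dact_def using \<open>c > 0\<close> gh by (simp add: proj_scale L_mult)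
    finally show "(\<lambda>x\<in>D. dact (g \<otimes>\<^bsub>G\<^esub> h) x) x = (\<lambda>x\<in>D. dact g x) ((\<lambda>x\<in>D. dact h x) x)"
      using x hyp_action_line(2)[OF gh(2) x] by simp
  next
    fix x assume "x \<in> topspace Wd"
    then show "(\<lambda>x\<in>D. dact \<one>\<^bsub>G\<^esub> x) x = x" by (simp add: dact_def L_one proj_e0 D_iff)
  qed (auto simp: hyp_action_line)
  let ?Z = "prod_topology TG Wd"
  have topZ: "fst p \<in> carrier G" "snd p \<in> D" if "p \<in> topspace ?Z" for p
    using that by (auto simp: topspace_TG)
  have N: "continuous_map ?Z euclideanreal (\<lambda>p. L (fst p) (e 0 + snd p) \<bullet> y)" for y
  proof -
    \<comment> \<open>This is the adjoint of \<open>L g\<close> applied to \<open>y\<close>. Moving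
      \<open>g\<close> to this side pairs the weakly varying point \<open>x\<close> with a vector
      that varies continuously in norm; as the disc is bounded, the pairing is jointly
      continuous.\<close>
    define f where "f g = J (L (inv\<^bsub>G\<^esub> g) (J y))" for g
    have f: "continuous_map TG euclidean f"
      unfolding f_def using continuous_map_L_inv[of "J y"] by (simp add: continuous_map_atin tendsto_J)
    have eq: "L g (e 0 + x) \<bullet> y = e 0 \<bullet> f g + x \<bullet> f g" if g: "g \<in> carrier G" for g x
    proof -
      have "L g (e 0 + x) \<bullet> y = B (L g (e 0 + x)) (L g (L (inv\<^bsub>G\<^esub> g) (J y)))"
        using B_J(1)[of "L g (e 0 + x)" y] L_inv[OF g] by simp
      also have "\<dots> = (e 0 + x) \<bullet> f g"
        unfolding f_def OG_B[OF L_OG[OF g]] using B_J(1)[of "e 0 + x" "J (L (inv\<^bsub>G\<^esub> g) (J y))"] B_J(2) by simp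
      finally show ?thesis by (simp add: inner_add_left)
    qed
    have ff: "continuous_map ?Z euclidean (\<lambda>p. f (fst p))"
      using continuous_map_compose[OF continuous_map_fst f] by (simp add: comp_def)
    then have 1: "continuous_map ?Z euclideanreal (\<lambda>p. e 0 \<bullet> f (fst p))"
      by (simp add: continuous_map_atin tendsto_inner)
    have 2: "continuous_map ?Z euclideanreal (\<lambda>p. snd p \<bullet> f (fst p))"
    proof (rule continuous_map_euclideanI)
      fix p and \<epsilon> :: real assume p: "p \<in> topspace ?Z" and \<epsilon>: "\<epsilon> > 0"
      obtain W1 where W1: "openin ?Z W1" "p \<in> W1" "\<And>q. q \<in> W1 \<Longrightarrow> norm (f (fst q) - f (fst p)) < \<epsilon> / 2"
        using continuous_map_euclideanD[OF ff p, of "\<epsilon> / 2"] \<epsilon> by auto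
      have cs: "continuous_map ?Z euclideanreal (\<lambda>q. snd q \<bullet> f (fst p))"
        using continuous_map_compose[OF continuous_map_snd continuous_map_Wd_inner] by (simp add: comp_def)
      have \<epsilon>2: "\<epsilon> / 2 > 0" using \<epsilon> by simp
      obtain W2 where W2: "openin ?Z W2" "p \<in> W2"
        "\<And>q. q \<in> W2 \<Longrightarrow> norm (snd q \<bullet> f (fst p) - snd p \<bullet> f (fst p)) < \<epsilon> / 2"
        by (rule continuous_map_euclideanD[OF cs p \<epsilon>2]) (rule that)
      have "norm (snd q \<bullet> f (fst q) - snd p \<bullet> f (fst p)) < \<epsilon>" if q: "q \<in> W1 \<inter> W2" for q
      proof -
        have "q \<in> topspace ?Z" using q W1(1) openin_subset by blast
        then have nq: "norm (snd q) \<le> 1" using topZ[of q] unfolding D_iff by blast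
        have "\<bar>snd q \<bullet> (f (fst q) - f (fst p))\<bar> \<le> norm (snd q) * norm (f (fst q) - f (fst p))"
          by (rule Cauchy_Schwarz_ineq2)
        also have "\<dots> \<le> 1 * norm (f (fst q) - f (fst p))" by (intro mult_right_mono nq) simp
        also have "\<dots> < \<epsilon> / 2" using W1(3) q by simp
        finally have "\<bar>snd q \<bullet> f (fst q) - snd q \<bullet> f (fst p)\<bar> < \<epsilon> / 2" by (simp add: inner_diff_right)
        moreover have "\<bar>snd q \<bullet> f (fst p) - snd p \<bullet> f (fst p)\<bar> < \<epsilon> / 2" using W2(3)[of q] q by simp
        ultimately show ?thesis unfolding real_norm_def by linarith
      qed
      then show "\<exists>W. openin ?Z W \<and> p \<in> W \<and> (\<forall>q\<in>W. norm (snd q \<bullet> f (fst q) - snd p \<bullet> f (fst p)) < \<epsilon>)"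
        using W1 W2 by (intro exI[of _ "W1 \<inter> W2"]) auto
    qed
    show ?thesis
      by (rule continuous_map_eq[OF continuous_map_add[OF 1 2]]) (use topZ eq in auto)
  qed
  show "continuous_map ?Z Wd (\<lambda>(g, x). (\<lambda>x\<in>D. dact g x) x)"
  proof (rule continuous_map_into_Wd)
    fix y
    have "continuous_map ?Z euclideanreal
      (\<lambda>p. (L (fst p) (e 0 + snd p) \<bullet> y) / (L (fst p) (e 0 + snd p) \<bullet> e 0) - e 0 \<bullet> y)"
    proof (intro continuous_map_diff continuous_map_real_divide N)
      show "L (fst p) (e 0 + snd p) \<bullet> e 0 \<noteq> 0" if "p \<in> topspace ?Z" for p
        using OG_cone(2)[OF L_OG D_cone] topZ[OF that] by (metis less_irrefl)
    qed simp
    then show "continuous_map ?Z euclideanreal (\<lambda>p. (case p of (g, x) \<Rightarrow> (\<lambda>x\<in>D. dact g x) x) \<bullet> y)"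
      by (rule continuous_map_eq) (use topZ in \<open>auto simp: dact_def proj_def inner_diff_left\<close>)
  qed (auto simp: topspace_TG hyp_action_line)
qed (rule compact_Wd Hausdorff_Wd)+

lemma flow_XT: "G_flow G TG XT (hyp_action e)"
proof (rule G_flow_transport[OF flow_D homeomorphic_line])
  fix g x assume "g \<in> carrier G" "x \<in> topspace Wd"
  then show "line ((\<lambda>x\<in>D. dact g x) x) = hyp_action e g (line x)" by (simp add: hyp_action_line)
next
  show "hyp_action e g \<in> extensional (topspace XT)" for g
    unfolding topspace_XT hyp_action_def hyp_closure_eq by simp
qed (rule topspace_TG)

section \<open>Reflections that fix \<open>e 0\<close>, and small moves of the unit sphere\<close>

lemma B_perp: "w \<bullet> e 0 = 0 \<Longrightarrow> B x w = - (x \<bullet> w)" "w \<bullet> e 0 = 0 \<Longrightarrow> B w x = - (w \<bullet> x)"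
  unfolding B_def by simp_all

lemma refl_perp:
  assumes "w \<bullet> e 0 = 0"
  shows "refl w x = x - (2 * (x \<bullet> w) / (w \<bullet> w)) *\<^sub>R w"
  unfolding refl_def B_perp(1)[OF assms] by simp

lemma refl_perp_OG:
  assumes "w \<bullet> e 0 = 0" "w \<noteq> 0" shows "refl w \<in> OG" "refl w (e 0) = e 0"
proof -
  have "B w w < 0" using assms by (simp add: B_perp)
  then show "refl w \<in> OG" by (rule refl_OG)
  show "refl w (e 0) = e 0" using assms by (simp add: refl_perp inner_commute)
qed

lemma norm_refl_perp:
  assumes "w \<bullet> e 0 = 0" "w \<noteq> 0" shows "norm (refl w x) = norm x"
  unfolding norm_eq refl_perp[OF assms(1)] using assms(2)
  by (simp add: inner_diff_left inner_diff_right inner_commute[of w x])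

lemma refl_unit_swap:
  assumes "b1 \<bullet> e 0 = 0" "b2 \<bullet> e 0 = 0" "norm b1 = norm b2" "b1 \<noteq> b2"
  shows "refl (b1 - b2) b1 = b2"
proof (rule refl_swap)
  show "B b1 b1 = B b2 b2" using assms by (simp add: B_perp norm_eq)
  have "(b1 - b2) \<bullet> e 0 = 0" using assms by (simp add: inner_diff_left)
  from B_perp(1)[OF this] show "B (b1 - b2) (b1 - b2) \<noteq> 0" using assms(4) by simp
qed

lemma dact_K:
  assumes "A \<in> OG" "A (e 0) = e 0" "A b \<bullet> e 0 = 0" shows "dact (iso A) b = A b"
  unfolding dact_iso[OF assms(1)] linear_add[OF OG_linear[OF assms(1)]] assms(2)
  by (rule proj_e0[OF assms(3)])

text \<open>
  Unit vectors that are weakly but not strongly close are exchanged by the reflection in their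
  difference, which barely moves the given finitely many points; unit vectors that are strongly
  close are related by a rotation of small angle.
\<close>
lemma small_rotation:
  assumes F: "finite F" and \<epsilon>: "\<epsilon> > 0"
  obtains \<delta> where "\<delta> > 0" "\<And>b1 b2. \<lbrakk>b1 \<bullet> e 0 = 0; b2 \<bullet> e 0 = 0; norm b1 = 1; norm b2 = 1;
      \<forall>p\<in>F. \<bar>p \<bullet> (b1 - b2)\<bar> < \<delta>\<rbrakk> \<Longrightarrow>
    \<exists>A\<in>OG. A (e 0) = e 0 \<and> A b1 = b2 \<and> (\<forall>p\<in>F. norm (A p - p) < \<epsilon>)"
proof -
  obtain M where M: "M > 0" "\<And>p. p \<in> F \<Longrightarrow> norm p \<le> M"
    using finite_imp_bounded[OF F] unfolding bounded_pos by blast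
  \<comment> \<open>The threshold between the two cases. Below it a rotation moves each point of
    \<open>F\<close> by at most \<open>4 * M * c\<close>, which must be less than \<epsilon>; the
    bound 1 makes the angle between the two vectors acute.\<close>
  define c where "c = min 1 (\<epsilon> / (8 * M))"
  have c: "c > 0" "c \<le> 1" "4 * M * c < \<epsilon>"
  proof -
    show "c > 0" "c \<le> 1" unfolding c_def using \<epsilon> M(1) by auto
    have "4 * M * c \<le> 4 * M * (\<epsilon> / (8 * M))" unfolding c_def using M(1) by (intro mult_left_mono) auto
    also have "\<dots> < \<epsilon>" using M(1) \<epsilon> by simp
    finally show "4 * M * c < \<epsilon>" .
  qed
  show ?thesis
  \<comment> \<open>A reflection in \<open>w\<close> moves \<open>p\<close> by
    \<open>2 * \<bar>p \<bullet> w\<bar> / norm w\<close>. With \<open>norm w\<close> at least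
    \<open>c\<close>, this choice keeps it below \<epsilon>/2.\<close>
  proof (rule that[of "\<epsilon> * c / 4"])
    show "\<epsilon> * c / 4 > 0" using \<epsilon> c by simp
    fix b1 b2 assume b: "b1 \<bullet> e 0 = 0" "b2 \<bullet> e 0 = 0" "norm b1 = 1" "norm b2 = 1"
      and close: "\<forall>p\<in>F. \<bar>p \<bullet> (b1 - b2)\<bar> < \<epsilon> * c / 4"
    show "\<exists>A\<in>OG. A (e 0) = e 0 \<and> A b1 = b2 \<and> (\<forall>p\<in>F. norm (A p - p) < \<epsilon>)"
    proof (cases "norm (b1 - b2) \<ge> c")
      case True
      define w where "w = b1 - b2"
      have w: "w \<bullet> e 0 = 0" "w \<noteq> 0" "norm w \<ge> c" using b True c(1) unfolding w_def by (auto simp: inner_diff_left)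
      have "norm (refl w p - p) < \<epsilon>" if p: "p \<in> F" for p
      proof -
        have "norm (refl w p - p) = 2 * \<bar>p \<bullet> w\<bar> / (w \<bullet> w) * norm w"
          unfolding refl_perp[OF w(1)] by (simp add: abs_mult)
        also have "\<dots> = 2 * \<bar>p \<bullet> w\<bar> / norm w"
          using w(2) unfolding power2_norm_eq_inner[symmetric] by (simp add: power2_eq_square)
        also have "\<dots> \<le> 2 * \<bar>p \<bullet> w\<bar> / c" using w c(1) by (intro divide_left_mono mult_pos_pos) auto
        also have "\<dots> < \<epsilon>" using bspec[OF close p] c(1) \<epsilon> unfolding w_def by (simp add: field_simps)
        finally show ?thesis .
      qed
      moreover have "refl w b1 = b2"
        unfolding w_def by (rule refl_unit_swap) (use b w w_def in auto)
      ultimately show ?thesis using refl_perp_OG[OF w(1,2)] by blast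
    next
      case False
      define w where "w = b1 + b2"
      define d where "d = b1 \<bullet> b2"
      have bb: "b1 \<bullet> b1 = 1" "b2 \<bullet> b2 = 1" using b by (simp_all add: norm_eq_1)
      have dw: "w \<bullet> w = 2 + 2 * d" and db: "(norm (b1 - b2))\<^sup>2 = 2 - 2 * d"
        unfolding w_def d_def power2_norm_eq_inner
        by (simp_all add: inner_add_left inner_add_right inner_diff_left inner_diff_right bb inner_commute)
      have "(norm (b1 - b2))\<^sup>2 < 1\<^sup>2" using False c by (intro power_strict_mono) auto
      then have dpos: "d > 0" using db by simp
      have w0: "w \<bullet> e 0 = 0" using b unfolding w_def by (simp add: inner_add_left)
      have wn: "w \<noteq> 0" using dw dpos by auto
      have b1n: "b1 \<noteq> 0" using b by auto
      define n where "n = norm w"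
      have n: "n * n = 2 + 2 * d" "n > 0" "n \<le> 2"
      proof -
        show "n * n = 2 + 2 * d" unfolding n_def dw[symmetric] by (simp add: power2_norm_eq_inner[symmetric] power2_eq_square)
        show "n > 0" unfolding n_def using wn by simp
        show "n \<le> 2" unfolding n_def w_def using norm_triangle_ineq[of b1 b2] b by simp
      qed
      \<comment> \<open>The unit bisector of \<open>b1\<close> and \<open>b2\<close>. It is no
        farther from \<open>b1\<close> than \<open>b2\<close> is, which bounds the difference of the
        reflections in \<open>b1\<close> and in \<open>u\<close>.\<close>
      define u where "u = (1 / n) *\<^sub>R w"
      have u1: "norm u = 1" unfolding u_def using n(2) by (simp add: n_def)
      have ub: "u \<bullet> b1 = n / 2"
      proof -
        have "w \<bullet> b1 = 1 + d"
          unfolding w_def d_def inner_add_left bb by (simp add: inner_commute)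
        then have "u \<bullet> b1 = (1 + d) / n" unfolding u_def by simp
        also have "1 + d = n * n / 2" using n(1) by linarith
        finally show ?thesis using n(2) by simp
      qed
      have "(norm (b1 - u))\<^sup>2 = 2 - n"
        unfolding power2_norm_eq_inner using u1 ub bb
        by (simp add: inner_diff_left inner_diff_right inner_commute norm_eq_1)
      also have "\<dots> \<le> (2 - n) * (2 + n)" using n by (simp add: mult_le_cancel_left1)
      also have "\<dots> = 2 - 2 * d" using n(1) by (simp add: algebra_simps)
      also have "\<dots> = (norm (b1 - b2))\<^sup>2" using db by simp
      finally have "norm (b1 - u) \<le> norm (b1 - b2)" by (rule power2_le_imp_le) simp
      then have bu: "norm (b1 - u) < c" using False by simp
      have ruw: "refl w x = x - (2 * (x \<bullet> u)) *\<^sub>R u" for x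
        unfolding refl_perp[OF w0] u_def using n dw by simp
      have rb: "refl b1 x = x - (2 * (x \<bullet> b1)) *\<^sub>R b1" for x
        unfolding refl_perp[OF b(1)] bb by simp
      \<comment> \<open>The rotation in the plane of \<open>b1\<close> and \<open>b2\<close>, by
        twice the angle from \<open>b1\<close> to the bisector: \<open>b1\<close> goes to
        \<open>- b1\<close> and then to \<open>b2\<close>.\<close>
      define A where "A = refl w \<circ> refl b1"
      have "A \<in> OG" unfolding A_def using refl_perp_OG w0 wn b(1) b1n by (intro OG_comp) auto
      moreover have "A (e 0) = e 0" unfolding A_def using refl_perp_OG w0 wn b(1) b1n by simp
      moreover have "A b1 = b2"
      proof -
        have "refl b1 b1 = - b1" unfolding rb by (simp add: bb scaleR_2)
        moreover have "refl w (- b1) = b2"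
        proof -
          have "- b1 \<bullet> w = - (1 + d)" unfolding w_def d_def by (simp add: inner_add_right bb)
          then have "(2 * (- b1 \<bullet> w) / (w \<bullet> w)) = - (2 + 2 * d) / (2 + 2 * d)" unfolding dw by simp
          also have "\<dots> = - 1" using dpos by (simp add: divide_eq_eq)
          finally have coeff: "(2 * (- b1 \<bullet> w) / (w \<bullet> w)) = - 1" .
          show ?thesis unfolding refl_perp[OF w0] coeff by (simp add: w_def)
        qed
        ultimately show ?thesis unfolding A_def by simp
      qed
      moreover have "norm (A p - p) < \<epsilon>" if p: "p \<in> F" for p
      proof -
        define z where "z = refl b1 p"
        have pz: "p = refl b1 z" unfolding z_def using refl_refl[of b1 p] b1n b(1) by (simp add: B_perp)
        have nz: "norm z \<le> M" unfolding z_def using norm_refl_perp[OF b(1) b1n] M(2)[OF p] by simp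
        have "A p - p = refl w z - refl b1 z" unfolding A_def comp_def z_def[symmetric] using pz by simp
        also have "\<dots> = (2 * (z \<bullet> (b1 - u))) *\<^sub>R b1 + (2 * (z \<bullet> u)) *\<^sub>R (b1 - u)"
          unfolding ruw rb by (simp add: inner_diff_right algebra_simps)
        also have "norm \<dots> \<le> 2 * \<bar>z \<bullet> (b1 - u)\<bar> * norm b1 + 2 * \<bar>z \<bullet> u\<bar> * norm (b1 - u)"
          by (rule norm_triangle_le) simp
        also have "\<dots> \<le> 2 * (norm z * norm (b1 - u)) * 1 + 2 * (norm z * 1) * norm (b1 - u)"
          using b(3) u1 Cauchy_Schwarz_ineq2[of z "b1 - u"] Cauchy_Schwarz_ineq2[of z u]
          by (intro add_mono mult_mono) auto
        also have "\<dots> = 4 * norm z * norm (b1 - u)" by simp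
        also have "\<dots> \<le> 4 * M * c" using nz bu M(1) by (intro mult_mono) auto
        finally show ?thesis using c(3) by simp
      qed
      ultimately show ?thesis by blast
    qed
  qed
qed

text \<open>The bound of \<open>small_rotation\<close> involves only the inner products of the
  difference with finitely many vectors, so a weak neighbourhood of any point of the ball enforces
  it. That the point itself need not lie on the sphere is what turns the whole ball into the
  completion.\<close>

lemma small_transitive_XT:
  assumes x: "x \<in> topspace XT" and V: "openin TG V" "\<one>\<^bsub>G\<^esub> \<in> V"
  shows "\<exists>W. openin XT W \<and> x \<in> W \<and>
    (\<forall>b1 b2. b1 \<bullet> e 0 = 0 \<longrightarrow> b2 \<bullet> e 0 = 0 \<longrightarrow> norm b1 = 1 \<longrightarrow> norm b2 = 1 \<longrightarrow>
      line b1 \<in> W \<longrightarrow> line b2 \<in> W \<longrightarrow> (\<exists>v\<in>V. hyp_action e v (line b1) = line b2))"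
proof -
  obtain z where z: "z \<in> D" "x = line z" using x topspace_XT by blast
  obtain F \<epsilon> where F: "finite F" "F \<subseteq> H" "\<epsilon> > 0"
    "\<And>A. A \<in> OG \<Longrightarrow> \<forall>p\<in>F. norm (A p - p) < \<epsilon> \<Longrightarrow> iso A \<in> V"
    by (rule TG_nbhd[OF V]) (rule that)
  obtain \<delta> where \<delta>: "\<delta> > 0" "\<And>b1 b2. \<lbrakk>b1 \<bullet> e 0 = 0; b2 \<bullet> e 0 = 0; norm b1 = 1; norm b2 = 1;
      \<forall>p\<in>F. \<bar>p \<bullet> (b1 - b2)\<bar> < \<delta>\<rbrakk> \<Longrightarrow>
    \<exists>A\<in>OG. A (e 0) = e 0 \<and> A b1 = b2 \<and> (\<forall>p\<in>F. norm (A p - p) < \<epsilon>)"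
    by (rule small_rotation[OF F(1,3)]) (rule that)
  define W0 where "W0 = (\<Inter>p\<in>F. {y \<in> topspace Wd. y \<bullet> p \<in> ball (z \<bullet> p) (\<delta> / 2)}) \<inter> D"
  have "openin Wd {y \<in> topspace Wd. y \<bullet> p \<in> ball (z \<bullet> p) (\<delta> / 2)}" for p
    by (rule openin_continuous_map_preimage[OF continuous_map_Wd_inner]) simp
  then have "openin Wd ((\<Inter>p\<in>F. {y \<in> topspace Wd. y \<bullet> p \<in> ball (z \<bullet> p) (\<delta> / 2)}) \<inter> topspace Wd)"
    using F(1) by (rule openin_INT[rotated])
  then have W0: "openin Wd W0" unfolding W0_def by simp
  have "z \<in> W0" unfolding W0_def using z(1) \<delta>(1) by auto
  then have "x \<in> line ` W0" using z(2) by blast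
  moreover have "\<exists>v\<in>V. hyp_action e v (line b1) = line b2"
    if b: "b1 \<bullet> e 0 = 0" "b2 \<bullet> e 0 = 0" "norm b1 = 1" "norm b2 = 1"
      and W: "line b1 \<in> line ` W0" "line b2 \<in> line ` W0" for b1 b2
  proof -
    have bD: "b1 \<in> D" "b2 \<in> D" using b unfolding D_iff by auto
    have W0D: "W0 \<subseteq> D" unfolding W0_def by blast
    have mem: "c \<in> W0" if c: "c \<in> D" "line c \<in> line ` W0" for c
    proof -
      obtain y where "y \<in> W0" "line c = line y" using c(2) by blast
      then show ?thesis using line_inj[OF c(1), of y] W0D by blast
    qed
    have bW: "b1 \<in> W0" "b2 \<in> W0" using mem bD W by auto
    have "\<forall>p\<in>F. \<bar>p \<bullet> (b1 - b2)\<bar> < \<delta>"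
    proof
      fix p assume p: "p \<in> F"
      have "\<bar>z \<bullet> p - b1 \<bullet> p\<bar> < \<delta> / 2" "\<bar>z \<bullet> p - b2 \<bullet> p\<bar> < \<delta> / 2"
        using bW p unfolding W0_def by (auto simp: dist_real_def)
      then have "\<bar>b1 \<bullet> p - b2 \<bullet> p\<bar> < \<delta>" by linarith
      then show "\<bar>p \<bullet> (b1 - b2)\<bar> < \<delta>" by (simp add: inner_diff_right inner_commute)
    qed
    then obtain A where A: "A \<in> OG" "A (e 0) = e 0" "A b1 = b2" "\<forall>p\<in>F. norm (A p - p) < \<epsilon>"
      using \<delta>(2)[OF b] by blast
    have "iso A \<in> V" using F(4)[OF A(1)] A(4) by blast
    moreover have "hyp_action e (iso A) (line b1) = line b2"
      using hyp_action_line(1)[OF iso_carrier[OF A(1)] bD(1)] dact_K[OF A(1,2)] A(3) b(2) by simp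
    ultimately show ?thesis by blast
  qed
  ultimately show ?thesis using openin_XT[OF W0] by blast
qed

section \<open>Contractions towards boundary points, proximality and minimality\<close>

definition contraction :: "'a \<Rightarrow> nat \<Rightarrow> 'a \<Rightarrow> 'a" where
  "contraction b n = refl (e 0 + (1 + 1 / Suc n) *\<^sub>R b)"

text \<open>The reflection vectors are spacelike and tend to the isotropic vector
  \<open>e 0 + b\<close>. As their squares tend to 0, the coefficient of the reflection vector
  explodes and the line of the image tends to the line of \<open>e 0 + b\<close>, unless
  \<open>e 0 + x\<close> is \<open>B\<close>-orthogonal to it, that is,
  \<open>x = b\<close>.\<close>

lemma contraction:
  assumes b: "b \<bullet> e 0 = 0" "norm b = 1"
  shows "contraction b n \<in> OG"
    and "x \<in> D \<Longrightarrow> x \<noteq> b \<Longrightarrow> (\<lambda>n. dact (iso (contraction b n)) x) \<longlonglongrightarrow> b"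
proof -
  define w where "w n = e 0 + (1 + 1 / Suc n) *\<^sub>R b" for n
  have "(\<lambda>n. 1 / real (Suc n)) \<longlonglongrightarrow> 0" using LIMSEQ_inverse_real_of_nat by (simp add: inverse_eq_divide)
  then have "w \<longlonglongrightarrow> e 0 + (1 + 0) *\<^sub>R b" unfolding w_def by (intro tendsto_intros)
  then have wlim: "w \<longlonglongrightarrow> e 0 + b" by simp
  have Bw: "B (w n) (w n) < 0" for n
  proof -
    have "((1 + 1 / Suc n) *\<^sub>R b) \<bullet> e 0 = 0" using b by simp
    from D_e0(2)[OF this] have "B (w n) (w n) = 1 - (1 + 1 / Suc n)\<^sup>2"
      unfolding w_def using b(2) by (simp add: abs_of_pos add_pos_pos)
    moreover have "(1 + 1 / real (Suc n))\<^sup>2 > 1\<^sup>2" by (intro power_strict_mono) auto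
    ultimately show ?thesis by simp
  qed
  have OG: "contraction b n \<in> OG" for n unfolding contraction_def w_def[symmetric] by (rule refl_OG[OF Bw])
  then show "contraction b n \<in> OG" .
  assume x: "x \<in> D" "x \<noteq> b"
  define u where "u = e 0 + x"
  have x0: "x \<bullet> e 0 = 0" and x1: "norm x \<le> 1" using x(1) unfolding D_iff by auto
  have "x \<bullet> b < 1"
  proof -
    have "0 < (norm (x - b))\<^sup>2" using x(2) by simp
    also have "\<dots> = (norm x)\<^sup>2 - 2 * (x \<bullet> b) + 1"
      using b(2) by (simp add: power2_norm_eq_inner inner_diff_left inner_diff_right inner_commute norm_eq_1)
    finally show ?thesis using power_le_one[OF norm_ge_zero x1, of 2] by linarith
  qed
  moreover have "B u (e 0 + b) = 1 - x \<bullet> b"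
    unfolding u_def B_def using x0 b(1) by (simp add: inner_add_left inner_add_right inner_commute)
  ultimately have Bub: "B u (e 0 + b) > 0" by simp
  have lim: "(\<lambda>n. B u (w n)) \<longlonglongrightarrow> B u (e 0 + b)" by (intro tendsto_intros wlim)
  then have ev: "eventually (\<lambda>n. B u (w n) > 0) sequentially" using Bub by (rule order_tendstoD)
  \<comment> \<open>The factor that normalizes the coefficient of the reflection vector to 1: the
    rescaled image is \<open>s n *\<^sub>R u + w n\<close>, and \<open>s\<close> tends to 0.\<close>
  define s where "s n = - B (w n) (w n) / (2 * B u (w n))" for n
  have "B (e 0 + b) (e 0 + b) = 0" using D_e0(2)[OF b(1)] b(2) by simp
  then have "s \<longlonglongrightarrow> - 0 / (2 * B u (e 0 + b))"
    unfolding s_def using tendsto_B[OF wlim wlim] Bub by (intro tendsto_intros wlim lim) auto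
  then have slim: "s \<longlonglongrightarrow> 0" by simp
  have "(\<lambda>n. proj (s n *\<^sub>R u + w n)) \<longlonglongrightarrow> proj (0 *\<^sub>R u + (e 0 + b))"
    unfolding proj_def using D_e0(1)[OF b(1)] by (intro tendsto_intros slim wlim) auto
  then have "(\<lambda>n. proj (s n *\<^sub>R u + w n)) \<longlonglongrightarrow> b" using proj_e0[OF b(1)] by simp
  moreover have "eventually (\<lambda>n. proj (s n *\<^sub>R u + w n) = dact (iso (contraction b n)) x) sequentially"
    using ev
  proof eventually_elim
    case (elim n)
    have "s n \<noteq> 0" "s n * (2 * B u (w n) / B (w n) (w n)) = -1"
      unfolding s_def using elim Bw[of n] by auto
    then have "s n *\<^sub>R refl (w n) u = s n *\<^sub>R u + w n"
      unfolding refl_def scaleR_diff_right scaleR_scaleR by simp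
    then have "proj (s n *\<^sub>R u + w n) = proj (refl (w n) u)" using proj_scale[OF \<open>s n \<noteq> 0\<close>] by metis
    moreover have "dact (iso (contraction b n)) x = proj (refl (w n) u)"
      unfolding dact_iso[OF OG] by (simp add: contraction_def w_def u_def)
    ultimately show ?case by simp
  qed
  ultimately show "(\<lambda>n. dact (iso (contraction b n)) x) \<longlonglongrightarrow> b" by (rule Lim_transform_eventually)
qed

lemma contraction_limitin:
  assumes b: "b \<bullet> e 0 = 0" "norm b = 1" and x: "x \<in> D" "x \<noteq> b"
  shows "limitin XT (\<lambda>n. hyp_action e (iso (contraction b n)) (line x)) (line b) sequentially"
proof -
  have "limitin XT (\<lambda>n. line (dact (iso (contraction b n)) x)) (line b) sequentially"
    by (rule limitin_XT[OF contraction(2)[OF b x]])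
      (use b x hyp_action_line iso_carrier contraction(1) in \<open>auto simp: D_iff[of b]\<close>)
  then show ?thesis
    using hyp_action_line(1)[OF iso_carrier[OF contraction(1)[OF b]] x(1)] by simp
qed

lemma unit_vector_avoiding:
  obtains b where "b \<bullet> e 0 = 0" "norm b = 1" "b \<noteq> x" "b \<noteq> y"
proof -
  have ne: "e i \<noteq> e j" if "i \<noteq> j" for i j
    using that by (metis e_inner zero_neq_one)
  have "e 1 \<noteq> e 2" "e 1 \<noteq> e 3" "e 2 \<noteq> e 3" by (intro ne; simp)+
  then have "(e 1 \<noteq> x \<and> e 1 \<noteq> y) \<or> (e 2 \<noteq> x \<and> e 2 \<noteq> y) \<or> (e 3 \<noteq> x \<and> e 3 \<noteq> y)" by metis
  moreover have "e 1 \<bullet> e 0 = 0" "e 2 \<bullet> e 0 = 0" "e 3 \<bullet> e 0 = 0" by (simp_all add: e_inner)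
  ultimately show ?thesis using that norm_e by metis
qed

text \<open>A single sequence contracts everything except its own centre towards that centre, so it
  is enough to choose a centre different from both points.\<close>

lemma proximal_XT: "proximal_flow G TG XT (hyp_action e)"
  unfolding proximal_flow_def
proof (intro conjI ballI flow_XT)
  fix l1 l2 assume "l1 \<in> topspace XT" "l2 \<in> topspace XT"
  then obtain x1 x2 where x: "x1 \<in> D" "x2 \<in> D" "l1 = line x1" "l2 = line x2"
    unfolding topspace_XT by blast
  obtain b where b: "b \<bullet> e 0 = 0" "norm b = 1" "b \<noteq> x1" "b \<noteq> x2" by (rule unit_vector_avoiding)
  define F where "F = filtermap (\<lambda>n. iso (contraction b n)) sequentially"
  have "F \<noteq> bot" unfolding F_def by (simp add: filtermap_bot_iff)
  moreover have "F \<le> principal (carrier G)"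
    unfolding F_def le_principal eventually_filtermap using iso_carrier contraction(1)[OF b(1,2)] by simp
  moreover have "limitin XT (\<lambda>g. hyp_action e g (line x)) (line b) F" if "x \<in> D" "b \<noteq> x" for x
    using contraction_limitin[OF b(1,2) that(1)] that(2)
    unfolding F_def limitin_def eventually_filtermap by simp
  ultimately show "\<exists>F z. F \<noteq> bot \<and> F \<le> principal (carrier G) \<and>
      limitin XT (\<lambda>g. hyp_action e g l1) z F \<and> limitin XT (\<lambda>g. hyp_action e g l2) z F"
    unfolding x(3,4) using x(1,2) b(3,4) by blast
qed

text \<open>The basis vectors tend weakly to 0, so adding bounded multiples of late ones changes a
  point weakly by little, while its norm can be raised to 1.\<close>

lemma unit_dense:
  assumes "openin XT W" "W \<noteq> {}"
  obtains b where "b \<bullet> e 0 = 0" "norm b = 1" "line b \<in> W"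
proof -
  obtain l where l: "l \<in> W" using assms(2) by blast
  then obtain x where x: "x \<in> D" "l = line x" using openin_subset[OF assms(1)] topspace_XT by blast
  \<comment> \<open>The larger root of the quadratic equation saying that \<open>b n\<close> has
    norm 1; the successor index keeps \<open>b n\<close> orthogonal to \<open>e 0\<close>.\<close>
  define d where "d n = - (x \<bullet> e (Suc n)) + sqrt ((x \<bullet> e (Suc n))\<^sup>2 + 1 - (norm x)\<^sup>2)" for n
  define b where "b n = x + d n *\<^sub>R e (Suc n)" for n
  have x1: "(norm x)\<^sup>2 \<le> 1" using x(1) power_le_one[of "norm x" 2] unfolding D_iff by simp
  have b0: "b n \<bullet> e 0 = 0" for n using x(1) unfolding b_def D_iff by (simp add: inner_add_left)
  have nb: "norm (b n) = 1" for n
  proof -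
    have "0 \<le> (x \<bullet> e (Suc n))\<^sup>2 + 1 - (norm x)\<^sup>2" using x1 zero_le_power2[of "x \<bullet> e (Suc n)"] by linarith
    then have "(d n + x \<bullet> e (Suc n))\<^sup>2 = (x \<bullet> e (Suc n))\<^sup>2 + 1 - (norm x)\<^sup>2"
      unfolding d_def by simp
    then have "(norm x)\<^sup>2 + 2 * d n * (x \<bullet> e (Suc n)) + (d n)\<^sup>2 = 1"
      by (simp add: power2_eq_square algebra_simps)
    moreover have "(norm (b n))\<^sup>2 = (norm x)\<^sup>2 + 2 * d n * (x \<bullet> e (Suc n)) + (d n)\<^sup>2"
      unfolding b_def power2_norm_eq_inner
      by (simp add: inner_add_left inner_add_right inner_commute power2_eq_square)
    ultimately show ?thesis using norm_ge_zero[of "b n"] by (simp add: power2_eq_1_iff)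
  qed
  have dn: "\<bar>d n\<bar> \<le> 2" for n
  proof -
    have "\<bar>d n\<bar> = norm (b n - x)" unfolding b_def by simp
    also have "\<dots> \<le> norm (b n) + norm x" by (rule norm_triangle_ineq4)
    finally show ?thesis using nb x(1) unfolding D_iff by simp
  qed
  have lim: "(\<lambda>n. b n \<bullet> y) \<longlonglongrightarrow> x \<bullet> y" for y
  proof -
    have "(\<lambda>n. 2 * \<bar>y \<bullet> e (Suc n)\<bar>) \<longlonglongrightarrow> 2 * \<bar>0\<bar>"
      using LIMSEQ_Suc[OF inner_e_tendsto_0[of y]] by (intro tendsto_intros)
    then have null: "(\<lambda>n. 2 * \<bar>y \<bullet> e (Suc n)\<bar>) \<longlonglongrightarrow> 0" by simp
    have "\<bar>b n \<bullet> y - x \<bullet> y\<bar> \<le> 2 * \<bar>y \<bullet> e (Suc n)\<bar>" for n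
    proof -
      have "b n \<bullet> y - x \<bullet> y = d n * (y \<bullet> e (Suc n))"
        unfolding b_def inner_add_left by (simp add: inner_commute)
      then show ?thesis using mult_right_mono[OF dn, of "\<bar>y \<bullet> e (Suc n)\<bar>" n] by (simp add: abs_mult)
    qed
    then have "eventually (\<lambda>n. norm (b n \<bullet> y - x \<bullet> y) \<le> 2 * \<bar>y \<bullet> e (Suc n)\<bar>) sequentially" by simp
    from Lim_null_comparison[OF this null] have "(\<lambda>n. b n \<bullet> y - x \<bullet> y) \<longlonglongrightarrow> 0" .
    then show ?thesis by (simp add: LIM_zero_iff)
  qed
  have "limitin weak_topology b x sequentially"
    unfolding limitin_def
  proof (intro conjI allI impI)
    fix S assume S: "openin weak_topology S \<and> x \<in> S"
    have "generate_topology_on {f -` U | (f :: 'a \<Rightarrow> real) U. bounded_linear f \<and> open U} S"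
      using S unfolding weak_topology_def openin_topology_generated_by_iff by blast
    then show "eventually (\<lambda>n. b n \<in> S) sequentially" using conjunct2[OF S]
    proof (induction rule: generate_topology_on.induct)
      case (Int S T)
      then show ?case by (auto intro: eventually_conj)
    next
      case (UN K)
      then obtain S where S: "S \<in> K" "x \<in> S" by blast
      then have "eventually (\<lambda>n. b n \<in> S) sequentially" using UN.IH by blast
      then show ?case by (rule eventually_mono) (use S in blast)
    next
      case (Basis S)
      then obtain f :: "'a \<Rightarrow> real" and U where f: "S = f -` U" "bounded_linear f" "open U" by blast
      obtain y where y: "\<And>x. f x = x \<bullet> y" using riesz f(2) by blast
      have "eventually (\<lambda>n. b n \<bullet> y \<in> U) sequentially"
        using lim[of y] f Basis y by (intro topological_tendstoD[OF lim]) auto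
      then show ?case using f y by simp
    qed simp
  qed simp
  moreover have "b n \<in> D" for n using b0 nb unfolding D_iff by simp
  ultimately have "limitin Wd b x sequentially" using x(1) by (simp add: limitin_subtopology)
  then have "eventually (\<lambda>n. b n \<in> {x \<in> D. line x \<in> W}) sequentially"
    using openin_XT'[OF assms(1)] l x unfolding limitin_def by blast
  then obtain n where "line (b n) \<in> W" using eventually_happens' by force
  then show ?thesis using that b0 nb by blast
qed

lemma transitive_boundary:
  assumes "b1 \<bullet> e 0 = 0" "b2 \<bullet> e 0 = 0" "norm b1 = 1" "norm b2 = 1"
  obtains g where "g \<in> carrier G" "hyp_action e g (line b1) = line b2"
proof -
  obtain A where A: "A \<in> OG" "A (e 0) = e 0" "A b1 = b2"
  proof (cases "b1 = b2")
    case True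
    then show ?thesis using that[of id] OG_id by simp
  next
    case False
    then show ?thesis
      using that[of "refl (b1 - b2)"] refl_perp_OG[of "b1 - b2"] refl_unit_swap[of b1 b2] assms
      by (simp add: inner_diff_left)
  qed
  have "b1 \<in> D" using assms unfolding D_iff by simp
  then have "hyp_action e (iso A) (line b1) = line b2"
    using hyp_action_line(1)[OF iso_carrier[OF A(1)]] dact_K[OF A(1,2)] A(3) assms(2) by simp
  then show ?thesis using that iso_carrier[OF A(1)] by blast
qed

sublocale X: flow G TG XT "hyp_action e"
  by unfold_locales (rule flow_XT, rule topspace_TG)

text \<open>A contraction brings the given point close to some \<open>b\<close> on the sphere, and
  by transitivity on the sphere an isometry takes \<open>b\<close> into the prescribed open set,
  which meets the sphere by \<open>unit_dense\<close>.\<close>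

lemma minimal_XT: "minimal_flow G TG XT (hyp_action e)"
  unfolding minimal_flow_def
proof (intro conjI ballI flow_XT)
  fix l assume l: "l \<in> topspace XT"
  then obtain x where x: "x \<in> D" "l = line x" unfolding topspace_XT by blast
  have "y \<in> XT closure_of (orbit G (hyp_action e) l)" if y: "y \<in> topspace XT" for y
    unfolding in_closure_of
  proof (intro conjI allI impI y)
    fix W assume W: "y \<in> W \<and> openin XT W"
    obtain b' where b': "b' \<bullet> e 0 = 0" "norm b' = 1" "line b' \<in> W" using unit_dense[of W] W by blast
    obtain b where b: "b \<bullet> e 0 = 0" "norm b = 1" "b \<noteq> x" by (rule unit_vector_avoiding)
    obtain g where g: "g \<in> carrier G" "hyp_action e g (line b) = line b'"
      by (rule transitive_boundary[OF b(1) b'(1) b(2) b'(2)])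
    have "openin XT {z \<in> topspace XT. hyp_action e g z \<in> W}" using X.openin_preimage[OF g(1)] W by blast
    moreover have "line b \<in> {z \<in> topspace XT. hyp_action e g z \<in> W}"
      unfolding topspace_XT using b g b' by (auto simp: D_iff)
    ultimately have "eventually (\<lambda>n. hyp_action e (iso (contraction b n)) l \<in> {z \<in> topspace XT. hyp_action e g z \<in> W}) sequentially"
      using contraction_limitin[OF b(1,2) x(1)] b(3) unfolding x(2) limitin_def by blast
    then obtain n where n: "hyp_action e g (hyp_action e (iso (contraction b n)) l) \<in> W"
      using eventually_happens' by force
    have "iso (contraction b n) \<in> carrier G" using iso_carrier contraction(1)[OF b(1,2)] by blast
    then have "hyp_action e g (hyp_action e (iso (contraction b n)) l) \<in> orbit G (hyp_action e) l"
      unfolding orbit_def using X.act_mult[OF g(1) _ l] g(1) by (metis (mono_tags, lifting) G.m_closed mem_Collect_eq)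
    then show "\<exists>z. z \<in> orbit G (hyp_action e) l \<and> z \<in> W" using n by (intro exI conjI)
  qed
  then show "XT closure_of (orbit G (hyp_action e) l) = topspace XT"
    by (intro equalityI closure_of_subset_topspace subsetI)
qed

lemma boundary_invariant:
  assumes "b \<bullet> e 0 = 0" "norm b = 1" "g \<in> carrier G"
  obtains b' where "b' \<bullet> e 0 = 0" "norm b' = 1" "hyp_action e g (line b) = line b'"
proof -
  have bD: "b \<in> D" using assms unfolding D_iff by simp
  have dD: "dact g b \<in> D" using hyp_action_line(2)[OF assms(3) bD] .
  then have d0: "dact g b \<bullet> e 0 = 0" unfolding D_iff by simp
  have "B (L g (e 0 + b)) (L g (e 0 + b)) = 0"
    using OG_B[OF L_OG[OF assms(3)]] D_e0(2)[OF assms(1)] assms(2) by simp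
  then have "B (e 0 + dact g b) (e 0 + dact g b) = 0"
    unfolding dact_def e0_proj by (simp add: B_simps)
  then have "norm (dact g b) = 1 \<or> norm (dact g b) = - 1"
    unfolding D_e0(2)[OF d0] by (simp add: power2_eq_1_iff)
  then have "norm (dact g b) = 1" using norm_ge_zero[of "dact g b"] by linarith
  then show ?thesis using that d0 hyp_action_line(1)[OF assms(3) bD] by blast
qed

lemma homogeneous_XT:
  assumes \<xi>: "\<xi> \<in> hyp_boundary e"
  shows "homogeneous_flow G TG XT (hyp_action e) \<xi>"
proof unfold_locales
  show "minimal_flow G TG XT (hyp_action e)" by (rule minimal_XT)
  show "\<xi> \<in> topspace XT" using \<xi> unfolding topspace_XT hyp_closure_eq[symmetric] hyp_closure_def by blast
  obtain b where b: "b \<bullet> e 0 = 0" "norm b = 1" "\<xi> = line b" using \<xi> hyp_boundary_eq by blast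
  fix x V assume xV: "x \<in> topspace XT" "openin TG V" "\<one>\<^bsub>G\<^esub> \<in> V"
  obtain W where W: "openin XT W" "x \<in> W"
    "\<forall>b1 b2. b1 \<bullet> e 0 = 0 \<longrightarrow> b2 \<bullet> e 0 = 0 \<longrightarrow> norm b1 = 1 \<longrightarrow> norm b2 = 1 \<longrightarrow>
      line b1 \<in> W \<longrightarrow> line b2 \<in> W \<longrightarrow> (\<exists>v\<in>V. hyp_action e v (line b1) = line b2)"
    using small_transitive_XT[OF xV] by blast
  have "\<exists>v\<in>V. hyp_action e v (hyp_action e g \<xi>) = hyp_action e h \<xi>"
    if gh: "g \<in> carrier G" "h \<in> carrier G" "hyp_action e g \<xi> \<in> W" "hyp_action e h \<xi> \<in> W" for g h
  proof -
    obtain b1 where b1: "b1 \<bullet> e 0 = 0" "norm b1 = 1" "hyp_action e g (line b) = line b1"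
      by (rule boundary_invariant[OF b(1,2) gh(1)])
    obtain b2 where b2: "b2 \<bullet> e 0 = 0" "norm b2 = 1" "hyp_action e h (line b) = line b2"
      by (rule boundary_invariant[OF b(1,2) gh(2)])
    show ?thesis using W(3) b1 b2 gh(3,4) unfolding b(3) by simp
  qed
  then show "\<exists>W. openin XT W \<and> x \<in> W \<and>
      (\<forall>g\<in>carrier G. \<forall>h\<in>carrier G. hyp_action e g \<xi> \<in> W \<longrightarrow> hyp_action e h \<xi> \<in> W \<longrightarrow>
        (\<exists>v\<in>V. hyp_action e v (hyp_action e g \<xi>) = hyp_action e h \<xi>))"
    using W by blast
qed

section \<open>Fixed points of the stabilizer of a point of hyperbolic space\<close>

text \<open>The stabilizer of \<open>e 0\<close>. It preserves both \<open>B\<close> and the time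
  coordinate, hence the inner product: it is the orthogonal group of the hyperplane orthogonal to
  \<open>e 0\<close>.\<close>

definition K :: "('a \<Rightarrow> 'a) set" where "K = {A \<in> OG. A (e 0) = e 0}"

lemma K_OG: "A \<in> K \<Longrightarrow> A \<in> OG" and K_e0: "A \<in> K \<Longrightarrow> A (e 0) = e 0" and K_linear: "A \<in> K \<Longrightarrow> linear A"
  unfolding K_def using OG_linear by auto

lemma K_inner_e0: "A \<in> K \<Longrightarrow> A x \<bullet> e 0 = x \<bullet> e 0"
  using OG_B[OF K_OG, of A x "e 0"] by (simp add: K_e0 B_e0)

lemma K_inner: "A \<in> K \<Longrightarrow> A x \<bullet> A y = x \<bullet> y"
  using OG_B[OF K_OG, of A x y] unfolding B_def by (simp add: K_inner_e0)

lemma K_norm: "A \<in> K \<Longrightarrow> norm (A x) = norm x"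
  unfolding norm_eq by (rule K_inner)

lemma K_comp: "A \<in> K \<Longrightarrow> A' \<in> K \<Longrightarrow> A \<circ> A' \<in> K"
  unfolding K_def using OG_comp by simp

lemma K_finv: assumes "A \<in> K" shows "finv A \<in> K"
proof -
  have "finv A (A (e 0)) = e 0" by (rule OG_inv(3)[OF K_OG[OF assms]])
  then show ?thesis using OG_inv(1)[OF K_OG[OF assms]] K_e0[OF assms] unfolding K_def by simp
qed

lemma K_refl: "w \<bullet> e 0 = 0 \<Longrightarrow> w \<noteq> 0 \<Longrightarrow> refl w \<in> K"
  unfolding K_def using refl_perp_OG by simp

lemma K_diff: "A \<in> K \<Longrightarrow> A (x - y) = A x - A y"
  using K_linear linear_diff by blast

text \<open>By the lemma \<open>RG_extend\<close> below, \<open>RG\<close> is dense in \<open>K\<close>.\<close>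
inductive_set RG :: "('a \<Rightarrow> 'a) set" where
  RG_id: "id \<in> RG"
| RG_refl: "A \<in> RG \<Longrightarrow> w \<bullet> e 0 = 0 \<Longrightarrow> w \<noteq> 0 \<Longrightarrow> refl w \<circ> A \<in> RG"

lemma RG_K: "A \<in> RG \<Longrightarrow> A \<in> K"
proof (induction rule: RG.induct)
  case RG_id
  then show ?case using OG_id unfolding K_def id_def by simp
next
  case (RG_refl A w)
  then show ?case using K_comp K_refl by blast
qed

text \<open>Witt's extension theorem for finite families, with one reflection per vector at most.
  The reflection that corrects the image of \<open>b m\<close> has its vector orthogonal to all
  earlier \<open>c i\<close>, since the inner products agree, and does not disturb them.\<close>

lemma RG_extend:
  fixes b c :: "nat \<Rightarrow> 'a"
  assumes "\<And>i. i < m \<Longrightarrow> b i \<bullet> e 0 = 0 \<and> c i \<bullet> e 0 = 0"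
    and "\<And>i j. i < m \<Longrightarrow> j < m \<Longrightarrow> b i \<bullet> b j = c i \<bullet> c j"
  shows "\<exists>A\<in>RG. \<forall>i<m. A (b i) = c i"
  using assms
proof (induction m)
  case 0
  then show ?case using RG_id by blast
next
  case (Suc m)
  then obtain A where A: "A \<in> RG" "\<forall>i<m. A (b i) = c i" by (metis less_Suc_eq)
  note AK = RG_K[OF A(1)]
  define w where "w = A (b m) - c m"
  show ?case
  proof (cases "w = 0")
    case True
    then have "\<forall>i<Suc m. A (b i) = c i" using A(2) unfolding w_def by (simp add: less_Suc_eq)
    then show ?thesis using A(1) by blast
  next
    case False
    have b0: "A (b m) \<bullet> e 0 = 0" using Suc.prems(1)[of m] K_inner_e0[OF AK] by simp
    have w0: "w \<bullet> e 0 = 0" unfolding w_def using b0 Suc.prems(1)[of m] by (simp add: inner_diff_left)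
    have "refl w (A (b m)) = c m"
      unfolding w_def
    proof (rule refl_unit_swap[OF b0])
      show "c m \<bullet> e 0 = 0" using Suc.prems(1)[of m] by simp
      show "norm (A (b m)) = norm (c m)"
        using Suc.prems(2)[of m m] K_norm[OF AK] by (simp add: norm_eq)
      show "A (b m) \<noteq> c m" using False unfolding w_def by simp
    qed
    moreover have "refl w (A (b i)) = c i" if "i < m" for i
    proof -
      have "c i \<bullet> A (b m) = A (b i) \<bullet> A (b m)" using A(2) that by simp
      also have "\<dots> = c i \<bullet> c m" using Suc.prems(2)[of i m] that K_inner[OF AK] by simp
      finally have "c i \<bullet> w = 0" unfolding w_def by (simp add: inner_diff_right)
      then show ?thesis using A(2) that unfolding refl_perp[OF w0] by simp
    qed
    ultimately have "\<forall>i<Suc m. (refl w \<circ> A) (b i) = c i" by (simp add: less_Suc_eq)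
    then show ?thesis using RG_refl[OF A(1) w0 False] by blast
  qed
qed

lemma e0_tail: "x = (x \<bullet> e 0) *\<^sub>R e 0 + tail x"
  unfolding tail_def by simp

lemma K_tail: assumes "A \<in> K" shows "A x = (x \<bullet> e 0) *\<^sub>R e 0 + A (tail x)"
proof -
  have "A x = A ((x \<bullet> e 0) *\<^sub>R e 0 + tail x)" using e0_tail by simp
  then show ?thesis using K_linear[OF assms] K_e0[OF assms] by (simp add: linear_add linear_scale)
qed

text \<open>On the finite set defining a neighbourhood of the identity, \<open>A\<close> agrees with
  a product \<open>R\<close> of reflections up to order: \<open>v = A \<circ> finv R\<close> fixes
  that set pointwise. Then \<open>A\<close> moves \<open>y\<close> as the small element
  \<open>v\<close> does, for every neighbourhood.\<close>

lemma fixed_by_reflections: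
  assumes Y: "G_flow G TG Y \<psi>" and y: "y \<in> topspace Y"
    and fix_refl: "\<And>w. w \<bullet> e 0 = 0 \<Longrightarrow> w \<noteq> 0 \<Longrightarrow> \<psi> (iso (refl w)) y = y"
    and A: "A \<in> K"
  shows "\<psi> (iso A) y = y"
proof (rule ccontr)
  interpret Y: flow G TG Y \<psi> by unfold_locales (rule Y, rule topspace_TG)
  have fixR: "\<psi> (iso R) y = y" if "R \<in> RG" for R
    using that
  proof (induction rule: RG.induct)
    case RG_id
    have "iso (\<lambda>a. a) = \<one>\<^bsub>G\<^esub>" by (simp add: iso_def one_G)
    then show ?case using Y.act_one[OF y] by simp
  next
    case (RG_refl R w)
    have OG: "R \<in> OG" "refl w \<in> OG" using K_OG[OF RG_K] K_OG[OF K_refl] RG_refl by auto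
    have "iso (\<lambda>a. refl w (R a)) = iso (refl w) \<otimes>\<^bsub>G\<^esub> iso R"
      using iso_comp[OF OG(2,1)] by (simp add: comp_def)
    then show ?case using fix_refl y OG RG_refl by (simp add: iso_carrier Y.act_mult)
  qed
  have isoA: "iso A \<in> carrier G" using iso_carrier K_OG[OF A] by blast
  assume "\<psi> (iso A) y \<noteq> y"
  then obtain V U U' where V: "openin TG V" "\<one>\<^bsub>G\<^esub> \<in> V" "openin Y U" "y \<in> U" "openin Y U'" "\<psi> (iso A) y \<in> U'"
    "\<And>v z. v \<in> V \<Longrightarrow> z \<in> U \<Longrightarrow> \<psi> v z \<notin> U'"
    using Y.separation[OF y Y.act_closed[OF isoA y]] by metis
  obtain F \<epsilon> where F: "finite F" "F \<subseteq> H" "\<epsilon> > 0"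
    "\<And>A. A \<in> OG \<Longrightarrow> \<forall>p\<in>F. norm (A p - p) < \<epsilon> \<Longrightarrow> iso A \<in> V"
    by (rule TG_nbhd[OF V(1,2)]) (rule that)
  obtain m and f :: "nat \<Rightarrow> 'a" where f: "F = f ` {i. i < m}"
    using finite_imp_nat_seg_image_inj_on[OF F(1)] by blast
  have A': "finv A \<in> K" by (rule K_finv[OF A])
  have "\<exists>R\<in>RG. \<forall>i<m. R (finv A (tail (f i))) = tail (f i)"
    by (rule RG_extend) (simp_all add: K_inner_e0[OF A'] K_inner[OF A'])
  then obtain R where R: "R \<in> RG" "\<forall>i<m. R (finv A (tail (f i))) = tail (f i)" by blast
  note RK = RG_K[OF R(1)]
  define v where "v = A \<circ> finv R"
  have vK: "v \<in> K" unfolding v_def using K_comp[OF A K_finv[OF RK]] .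
  have "v p = p" if p: "p \<in> F" for p
  proof -
    obtain i where i: "i < m" "p = f i" using p f by blast
    have "R (finv A p) = p"
      using K_tail[OF K_comp[OF RK A'], of p] R(2) i e0_tail[of p] by simp
    then have "finv R p = finv A p" using OG_inv(3)[OF K_OG[OF RK], of "finv A p"] by simp
    then show ?thesis unfolding v_def using OG_inv(2)[OF K_OG[OF A]] by simp
  qed
  then have vV: "iso v \<in> V" using F(3) by (intro F(4) K_OG[OF vK]) simp
  have "v \<circ> R = A" unfolding v_def using OG_inv(3)[OF K_OG[OF RK]] by (simp add: fun_eq_iff)
  then have "iso A = iso v \<otimes>\<^bsub>G\<^esub> iso R" using iso_comp[OF K_OG[OF vK] K_OG[OF RK]] by simp
  then have "\<psi> (iso A) y = \<psi> (iso v) y"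
    using fixR[OF R(1)] y iso_carrier K_OG[OF vK] K_OG[OF RK] by (simp add: Y.act_mult)
  then show False using V(7)[OF vV V(4)] V(6) by simp
qed

subsection \<open>Block embeddings\<close>

text \<open>The copies use disjoint blocks of \<open>d\<close> consecutive basis vectors, beginning
  after \<open>e 0\<close>. Each is realized by an element of \<open>K\<close>, so no separate
  notion of partial isometry is required.\<close>

lemma orthogonal_copies:
  fixes b :: "nat \<Rightarrow> 'a"
  assumes b: "\<And>i j. i < d \<Longrightarrow> j < d \<Longrightarrow> b i \<bullet> b j = (if i = j then 1 else 0)"
    and b0: "\<And>i. i < d \<Longrightarrow> b i \<bullet> e 0 = 0"
  obtains T :: "nat \<Rightarrow> 'a \<Rightarrow> 'a" where "\<And>j. T j \<in> K"
    "\<And>j k z z'. j \<noteq> k \<Longrightarrow> z \<in> span (b ` {..<d}) \<Longrightarrow> z' \<in> span (b ` {..<d}) \<Longrightarrow> T j z \<bullet> T k z' = 0"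
proof -
  have ne: "Suc (j * d + i) \<noteq> Suc (k * d + l)" if "j \<noteq> k" "i < d" "l < d" for i j k l
  proof
    assume "Suc (j * d + i) = Suc (k * d + l)"
    then have "(j * d + i) div d = (k * d + l) div d" by simp
    then show False using that by simp
  qed
  have "\<exists>A\<in>RG. \<forall>i<d. A (b i) = e (Suc (j * d + i))" for j
  proof (rule RG_extend)
    fix i l assume "i < d" "l < d"
    then show "b i \<bullet> b l = e (Suc (j * d + i)) \<bullet> e (Suc (j * d + l))" using b by (simp add: e_inner)
  qed (use b0 in simp)
  then obtain T where T: "\<And>j. T j \<in> RG" "\<And>j i. i < d \<Longrightarrow> T j (b i) = e (Suc (j * d + i))" by metis
  have TK: "T j \<in> K" for j using RG_K T(1) by blast
  have orth: "T j z \<bullet> T k z' = 0"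
    if jk: "j \<noteq> k" and z: "z \<in> span (b ` {..<d})" "z' \<in> span (b ` {..<d})" for j k z z'
  proof -
    have 1: "T j (b i) \<bullet> T k z' = 0" if i: "i < d" for i
      using z(2)
    proof (induction rule: span_induct_alt)
      case base
      then show ?case using linear_0[OF K_linear[OF TK]] by simp
    next
      case (step c x y)
      then obtain l where "l < d" "x = b l" by blast
      then show ?case using step.IH T(2) i ne[OF jk i]
        by (simp add: linear_add[OF K_linear[OF TK]] linear_scale[OF K_linear[OF TK]] inner_add_right e_inner)
    qed
    show ?thesis using z(1)
    proof (induction rule: span_induct_alt)
      case base
      then show ?case using linear_0[OF K_linear[OF TK]] by simp
    next
      case (step c x y)
      then obtain l where "l < d" "x = b l" by blast
      then show ?case using step.IH 1
        by (simp add: linear_add[OF K_linear[OF TK]] linear_scale[OF K_linear[OF TK]] inner_add_left)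
    qed
  qed
  show ?thesis by (rule that[of T]) (rule TK, rule orth)
qed

lemma inner_block_sum:
  fixes N :: nat
  assumes T: "\<And>j. T j \<in> K" "\<And>j k z z'. j \<noteq> k \<Longrightarrow> z \<in> S \<Longrightarrow> z' \<in> S \<Longrightarrow> T j z \<bullet> T k z' = 0"
    and z: "\<And>j. j < N \<Longrightarrow> z j \<in> S" "\<And>j. j < N \<Longrightarrow> z' j \<in> S"
  shows "(\<Sum>j<N. T j (z j)) \<bullet> (\<Sum>j<N. T j (z' j)) = (\<Sum>j<N. z j \<bullet> z' j)"
proof -
  have "(\<Sum>j<N. T j (z j)) \<bullet> (\<Sum>k<N. T k (z' k)) = (\<Sum>j<N. \<Sum>k<N. T j (z j) \<bullet> T k (z' k))"
    by (subst inner_sum_left) (simp add: inner_sum_right)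
  also have "\<dots> = (\<Sum>j<N. \<Sum>k<N. if j = k then z j \<bullet> z' j else 0)"
  proof (intro sum.cong refl)
    fix j k assume "j \<in> {..<N}" "k \<in> {..<N}"
    then show "T j (z j) \<bullet> T k (z' k) = (if j = k then z j \<bullet> z' j else 0)"
      using T(2)[of j k "z j" "z' k"] z K_inner[OF T(1)] by auto
  qed
  also have "\<dots> = (\<Sum>j<N. z j \<bullet> z' j)" by simp
  finally show ?thesis .
qed

text \<open>Each of the \<open>N\<close> orthogonal summands preserves inner products, so the factor
  \<open>1 / sqrt N\<close> makes the sum isometric on \<open>S\<close>. An isometric map of a
  finite-dimensional space extends to \<open>K\<close> by \<open>RG_extend\<close>; a word of
  \<open>N\<close> letters becomes a group element in this way.\<close>

lemma block_embedding:
  fixes b :: "nat \<Rightarrow> 'a" and N :: nat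
  assumes b: "\<And>i j. i < d \<Longrightarrow> j < d \<Longrightarrow> b i \<bullet> b j = (if i = j then 1 else 0)"
    and b0: "\<And>i. i < d \<Longrightarrow> b i \<bullet> e 0 = 0"
    and S: "S = span (b ` {..<d})"
    and T: "\<And>j. T j \<in> K" "\<And>j k z z'. j \<noteq> k \<Longrightarrow> z \<in> S \<Longrightarrow> z' \<in> S \<Longrightarrow> T j z \<bullet> T k z' = 0"
    and q: "\<And>j. j < N \<Longrightarrow> q j \<in> K" "\<And>j z. j < N \<Longrightarrow> z \<in> S \<Longrightarrow> q j z \<in> S"
    and N: "N > 0"
  shows "\<exists>\<gamma>\<in>K. \<forall>z\<in>S. \<gamma> z = (1 / sqrt N) *\<^sub>R (\<Sum>j<N. T j (q j z))"
proof -
  define c where "c z = (1 / sqrt N) *\<^sub>R (\<Sum>j<N. T j (q j z))" for z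
  have bS: "b i \<in> S" if "i < d" for i unfolding S using that by (intro span_base) simp
  have inner_c: "c z \<bullet> c z' = z \<bullet> z'" if "z \<in> S" "z' \<in> S" for z z'
  proof -
    have "c z \<bullet> c z' = (1 / N) * (\<Sum>j<N. q j z \<bullet> q j z')"
      unfolding c_def using inner_block_sum[where N = N and z = "\<lambda>j. q j z" and z' = "\<lambda>j. q j z'", OF T] q(2) that by simp
    also have "(\<Sum>j<N. q j z \<bullet> q j z') = (\<Sum>j<N. z \<bullet> z')"
      using K_inner[OF q(1)] by (intro sum.cong) auto
    finally show ?thesis using N by simp
  qed
  have c0: "c (b i) \<bullet> e 0 = 0" if "i < d" for i
    unfolding c_def inner_scaleR_left inner_sum_left
    using b0[OF that] K_inner_e0[OF T(1)] K_inner_e0[OF q(1)] by simp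
  have "\<exists>\<gamma>\<in>RG. \<forall>i<d. \<gamma> (b i) = c (b i)"
    by (rule RG_extend) (use b0 c0 inner_c bS in auto)
  then obtain \<gamma> where \<gamma>: "\<gamma> \<in> RG" "\<forall>i<d. \<gamma> (b i) = c (b i)" by blast
  note lin = K_linear[OF RG_K[OF \<gamma>(1)]]
  have qlin: "q j (x *\<^sub>R y + z) = x *\<^sub>R q j y + q j z" if "j < N" for j x y z
    using K_linear[OF q(1)[OF that]] by (simp add: linear_add linear_scale)
  have Tlin: "T j (x *\<^sub>R y + z) = x *\<^sub>R T j y + T j z" for j x y z
    using K_linear[OF T(1)] by (simp add: linear_add linear_scale)
  have clin: "c (x *\<^sub>R y + z) = x *\<^sub>R c y + c z" for x y z
  proof -
    have "(\<Sum>j<N. T j (q j (x *\<^sub>R y + z))) = (\<Sum>j<N. x *\<^sub>R T j (q j y) + T j (q j z))"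
      by (intro sum.cong refl) (simp add: qlin Tlin)
    then show ?thesis
      unfolding c_def by (simp add: sum.distrib scaleR_add_right scaleR_sum_right[symmetric])
  qed
  have "\<gamma> z = c z" if "z \<in> S" for z
    using that unfolding S
  proof (induction rule: span_induct_alt)
    case base
    have "c 0 = 0" using clin[of "-1" 0 0] by simp
    then show ?case using linear_0[OF lin] by simp
  next
    case (step x y z)
    then show ?case using \<gamma>(2) clin by (auto simp: linear_add[OF lin] linear_scale[OF lin])
  qed
  then show ?thesis unfolding c_def using RG_K[OF \<gamma>(1)] by blast
qed

text \<open>The distance between two embeddings is a quadratic mean over the letters. Changing a
  small proportion of the letters arbitrarily, or all letters slightly, therefore changes the
  embedding little; the Hamming distance fits this.\<close>

lemma block_distance:
  fixes N :: nat
  assumes T: "\<And>j. T j \<in> K" "\<And>j k z z'. j \<noteq> k \<Longrightarrow> z \<in> S \<Longrightarrow> z' \<in> S \<Longrightarrow> T j z \<bullet> T k z' = 0"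
    and S: "subspace S"
    and q: "\<And>j. j < N \<Longrightarrow> q j \<in> S" "\<And>j. j < N \<Longrightarrow> q' j \<in> S" and N: "N > 0"
  shows "(norm ((1 / sqrt N) *\<^sub>R (\<Sum>j<N. T j (q j)) - (1 / sqrt N) *\<^sub>R (\<Sum>j<N. T j (q' j))))\<^sup>2
    = (\<Sum>j<N. (norm (q j - q' j))\<^sup>2) / N"
proof -
  have "(1 / sqrt N) *\<^sub>R (\<Sum>j<N. T j (q j)) - (1 / sqrt N) *\<^sub>R (\<Sum>j<N. T j (q' j))
    = (1 / sqrt N) *\<^sub>R (\<Sum>j<N. T j (q j - q' j))"
    by (simp add: K_diff[OF T(1)] sum_subtractf scaleR_diff_right)
  moreover have "(\<Sum>j<N. T j (q j - q' j)) \<bullet> (\<Sum>j<N. T j (q j - q' j)) = (\<Sum>j<N. (q j - q' j) \<bullet> (q j - q' j))"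
    using q by (intro inner_block_sum[OF T]) (auto intro: subspace_diff[OF S])
  ultimately show ?thesis unfolding power2_norm_eq_inner by simp
qed

subsection \<open>Nets in finite-dimensional orthogonal groups\<close>

definition close_on :: "'a set \<Rightarrow> real \<Rightarrow> ('a \<Rightarrow> 'a) \<Rightarrow> ('a \<Rightarrow> 'a) \<Rightarrow> bool" where
  "close_on S \<epsilon> q q' \<longleftrightarrow> (\<forall>z\<in>S. norm (q z - q' z) \<le> \<epsilon> * norm z)"

text \<open>Total boundedness of the orthogonal group of \<open>S\<close>: the matrix entries are
  rounded down to multiples of \<open>1/k\<close>, and one element is chosen for each of the
  finitely many patterns.\<close>

lemma finite_net:
  fixes b :: "nat \<Rightarrow> 'a"
  assumes b: "\<And>i j. i < d \<Longrightarrow> j < d \<Longrightarrow> b i \<bullet> b j = (if i = j then 1 else 0)"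
    and S: "S = span (b ` {..<d})" and \<epsilon>: "\<epsilon> > 0"
    and M: "\<And>q. q \<in> M \<Longrightarrow> q \<in> K" "\<And>q z. q \<in> M \<Longrightarrow> z \<in> S \<Longrightarrow> q z \<in> S"
  shows "\<exists>Q. finite Q \<and> Q \<subseteq> M \<and> (\<forall>q\<in>M. \<exists>a\<in>Q. close_on S \<epsilon> q a)"
proof -
  \<comment> \<open>Entries that differ by at most \<open>1/k\<close> give an operator norm of at
    most \<open>d * d / k\<close>, once \<open>d\<close> for the columns and once for the
    coordinates of \<open>z\<close>.\<close>
  obtain k :: nat where k: "real k > (real d * real d) / \<epsilon>" using reals_Archimedean2 by blast
  have k0: "real k > 0" using k \<epsilon> by (meson divide_nonneg_pos le_less_trans mult_nonneg_nonneg of_nat_0_le_iff)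
  define code where "code q = (\<lambda>p\<in>{..<d} \<times> {..<d}. \<lfloor>k * (q (b (fst p)) \<bullet> b (snd p))\<rfloor>)" for q :: "'a \<Rightarrow> 'a"
  have bS: "b i \<in> S" if "i < d" for i unfolding S using that by (intro span_base) simp
  have nb: "norm (b i) = 1" if "i < d" for i using b[OF that that] by (simp add: norm_eq_1)
  have "code q \<in> ({..<d} \<times> {..<d}) \<rightarrow>\<^sub>E {- int k..int k}" if q: "q \<in> M" for q
  proof -
    have "\<lfloor>k * (q (b i) \<bullet> b j)\<rfloor> \<in> {- int k..int k}" if ij: "i < d" "j < d" for i j
    proof -
      have "\<bar>q (b i) \<bullet> b j\<bar> \<le> norm (q (b i)) * norm (b j)" by (rule Cauchy_Schwarz_ineq2)
      then have "\<bar>q (b i) \<bullet> b j\<bar> \<le> 1" using K_norm[OF M(1)[OF q]] nb ij by simp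
      then have "\<bar>real k * (q (b i) \<bullet> b j)\<bar> \<le> real k" using k0 by (simp add: abs_mult mult_le_cancel_left1)
      then show ?thesis by (auto simp: le_floor_iff floor_le_iff abs_le_iff)
    qed
    then show ?thesis unfolding code_def by auto
  qed
  then have "code ` M \<subseteq> ({..<d} \<times> {..<d}) \<rightarrow>\<^sub>E {- int k..int k}" by blast
  then have fin: "finite (code ` M)" by (rule finite_subset) (intro finite_PiE; simp)
  define rep where "rep c = (SOME q. q \<in> M \<and> code q = c)" for c
  have rep: "rep (code q) \<in> M" "code (rep (code q)) = code q" if "q \<in> M" for q
    unfolding rep_def using someI[of "\<lambda>q'. q' \<in> M \<and> code q' = code q" q] that by auto
  have expand: "z = (\<Sum>i<d. (z \<bullet> b i) *\<^sub>R b i)" if "z \<in> S" for z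
    using that unfolding S by (intro orthonormal_expansion b)
  have close: "close_on S \<epsilon> q q'" if qq: "q \<in> M" "q' \<in> M" "code q = code q'" for q q'
    unfolding close_on_def
  proof
    fix z assume z: "z \<in> S"
    have entry: "\<bar>(q (b i) - q' (b i)) \<bullet> b j\<bar> \<le> 1 / k" if ij: "i < d" "j < d" for i j
    proof -
      have "code q (i, j) = code q' (i, j)" using qq(3) by simp
      then have "\<lfloor>k * (q (b i) \<bullet> b j)\<rfloor> = \<lfloor>k * (q' (b i) \<bullet> b j)\<rfloor>" unfolding code_def using ij by simp
      then have "\<bar>real k * (q (b i) \<bullet> b j) - real k * (q' (b i) \<bullet> b j)\<bar> \<le> 1" by linarith
      moreover have "real k * \<bar>(q (b i) - q' (b i)) \<bullet> b j\<bar> = \<bar>real k * (q (b i) \<bullet> b j) - real k * (q' (b i) \<bullet> b j)\<bar>"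
        unfolding inner_diff_left right_diff_distrib[symmetric] abs_mult by simp
      ultimately have "real k * \<bar>(q (b i) - q' (b i)) \<bullet> b j\<bar> \<le> 1" by simp
      then show ?thesis using k0 by (simp add: field_simps)
    qed
    have col: "norm (q (b i) - q' (b i)) \<le> d / k" if i: "i < d" for i
    proof -
      have "q (b i) - q' (b i) \<in> S"
        using M(2) qq bS[OF i] unfolding S by (intro span_diff) auto
      then have "q (b i) - q' (b i) = (\<Sum>j<d. ((q (b i) - q' (b i)) \<bullet> b j) *\<^sub>R b j)"
        by (rule expand)
      then have "norm (q (b i) - q' (b i)) \<le> (\<Sum>j<d. norm (((q (b i) - q' (b i)) \<bullet> b j) *\<^sub>R b j))"
        by (metis norm_sum)
      also have "\<dots> \<le> (\<Sum>j<d. 1 / k)" using entry[OF i] nb by (intro sum_mono) auto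
      finally show ?thesis by simp
    qed
    have zb: "z = (\<Sum>i<d. (z \<bullet> b i) *\<^sub>R b i)" using z by (rule expand)
    have lin: "linear q" "linear q'" using K_linear M(1) qq by auto
    have "q z - q' z = (\<Sum>i<d. (z \<bullet> b i) *\<^sub>R (q (b i) - q' (b i)))"
      by (subst (1 2) zb) (simp add: linear_sum[OF lin(1)] linear_sum[OF lin(2)] linear_scale[OF lin(1)]
          linear_scale[OF lin(2)] scaleR_diff_right sum_subtractf)
    then have "norm (q z - q' z) \<le> (\<Sum>i<d. norm ((z \<bullet> b i) *\<^sub>R (q (b i) - q' (b i))))"
      by (metis norm_sum)
    also have "\<dots> \<le> (\<Sum>i<d. norm z * (d / k))"
    proof (rule sum_mono)
      fix i assume "i \<in> {..<d}"
      then have i: "i < d" by simp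
      have "\<bar>z \<bullet> b i\<bar> \<le> norm z" using Cauchy_Schwarz_ineq2[of z "b i"] nb[OF i] by simp
      then show "norm ((z \<bullet> b i) *\<^sub>R (q (b i) - q' (b i))) \<le> norm z * (d / k)"
        using col[OF i] by (simp del: times_divide_eq_right) (intro mult_mono; simp)
    qed
    also have "\<dots> = (real d * real d / k) * norm z" by simp
    also have "\<dots> \<le> \<epsilon> * norm z"
      using k k0 \<epsilon> by (intro mult_right_mono) (simp_all add: field_simps)
    finally show "norm (q z - q' z) \<le> \<epsilon> * norm z" .
  qed
  show ?thesis
  proof (intro exI[of _ "rep ` (code ` M)"] conjI ballI)
    show "finite (rep ` (code ` M))" using fin by simp
    show "rep ` (code ` M) \<subseteq> M" using rep by blast
    fix q assume q: "q \<in> M"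
    then have "close_on S \<epsilon> q (rep (code q))" using close rep by simp
    then show "\<exists>a\<in>rep ` (code ` M). close_on S \<epsilon> q a" using q by blast
  qed
qed

text \<open>Minimality of the net makes no reference to \<open>w\<close>, so one and the same net is
  almost invariant under right multiplication by every reflection of \<open>S\<close>. It plays the
  part of an invariant measure; the constant doubles because two net points are compared through a
  third point.\<close>

lemma net_with_permutations:
  fixes b :: "nat \<Rightarrow> 'a"
  assumes b: "\<And>i j. i < d \<Longrightarrow> j < d \<Longrightarrow> b i \<bullet> b j = (if i = j then 1 else 0)"
    and S: "S = span (b ` {..<d})" and \<epsilon>: "\<epsilon> > 0"
  shows "\<exists>Q. finite Q \<and> Q \<noteq> {} \<and> (\<forall>q\<in>Q. q \<in> K \<and> q ` S \<subseteq> S) \<and>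
    (\<forall>w\<in>S. w \<bullet> e 0 = 0 \<longrightarrow> w \<noteq> 0 \<longrightarrow>
      (\<exists>\<sigma>. bij_betw \<sigma> Q Q \<and> (\<forall>a\<in>Q. close_on S (2 * \<epsilon>) (a \<circ> refl w) (\<sigma> a))))"
proof -
  define M where "M = {q \<in> K. q ` S \<subseteq> S}"
  define net where "net Q \<longleftrightarrow> finite Q \<and> Q \<subseteq> M \<and> (\<forall>q\<in>M. \<exists>a\<in>Q. close_on S \<epsilon> q a)" for Q
  have "\<exists>Q. net Q"
    unfolding net_def by (rule finite_net[OF b S \<epsilon>]) (auto simp: M_def)
  then obtain Q where Q: "net Q" "\<And>Q'. net Q' \<Longrightarrow> card Q \<le> card Q'"
    using ex_has_least_nat[of net _ card] by blast
  have "id \<in> M" unfolding M_def K_def using OG_id by simp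
  then have "Q \<noteq> {}" using Q(1) unfolding net_def by blast
  moreover have "\<exists>\<sigma>. bij_betw \<sigma> Q Q \<and> (\<forall>a\<in>Q. close_on S (2 * \<epsilon>) (a \<circ> refl w) (\<sigma> a))"
    if w: "w \<in> S" "w \<bullet> e 0 = 0" "w \<noteq> 0" for w
  proof (rule minimal_net_matching[where M = M and r = "\<lambda>q. q \<circ> refl w" and ?close1.0 = "close_on S \<epsilon>"])
    have rS: "refl w z \<in> S" if "z \<in> S" for z
      using that w(1) unfolding refl_def S by (intro span_diff span_scale)
    have rr: "refl w (refl w z) = z" for z using w by (intro refl_refl) (simp add: B_perp)
    show "finite Q" "Q \<subseteq> M" using Q(1) unfolding net_def by auto
    show "\<exists>a\<in>Q. close_on S \<epsilon> q a" if "q \<in> M" for q using Q(1) that unfolding net_def by blast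
    show "card Q \<le> card Q'"
      if "finite Q'" "Q' \<subseteq> M" "\<And>q. q \<in> M \<Longrightarrow> \<exists>a\<in>Q'. close_on S \<epsilon> q a" for Q'
      using Q(2)[of Q'] that unfolding net_def by blast
    show "q \<circ> refl w \<in> M" if "q \<in> M" for q
      using that K_comp K_refl[OF w(2,3)] rS unfolding M_def by fastforce
    show "q \<circ> refl w \<circ> refl w = q" for q by (simp add: fun_eq_iff rr)
    show "close_on S \<epsilon> (q \<circ> refl w) (q' \<circ> refl w)" if "close_on S \<epsilon> q q'" for q q'
      using that rS norm_refl_perp[OF w(2,3)] unfolding close_on_def by fastforce
    show "close_on S (2 * \<epsilon>) a a'" if "close_on S \<epsilon> q a" "close_on S \<epsilon> q a'" for q a a'
      unfolding close_on_def
    proof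
      fix z assume z: "z \<in> S"
      have "norm (a z - a' z) \<le> norm (a z - q z) + norm (q z - a' z)" using norm_triangle_ineq[of "a z - q z" "q z - a' z"] by simp
      also have "\<dots> \<le> \<epsilon> * norm z + \<epsilon> * norm z"
        using that z unfolding close_on_def by (intro add_mono) (auto simp: norm_minus_commute)
      finally show "norm (a z - a' z) \<le> 2 * \<epsilon> * norm z" by simp
    qed
  qed
  moreover have "finite Q" "\<forall>q\<in>Q. q \<in> K \<and> q ` S \<subseteq> S" using Q(1) unfolding net_def M_def by blast+
  ultimately show ?thesis by blast
qed

subsection \<open>Extreme amenability\<close>

text \<open>
  The argument of Gromov and Milman. If no point is fixed by all reflections, finitely many open
  sets \<open>O\<^sub>s\<close> cover the flow, each of which is moved off itself by a reflection in \<open>w s\<close>, even up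
  to a neighbourhood of the identity. All the \<open>w s\<close> lie in a finite-dimensional space \<open>S\<close>. A word
  of \<open>N\<close> elements of (a net of) the orthogonal group of \<open>S\<close> defines an isometric embedding of \<open>S\<close>
  in the sum of \<open>N\<close> copies of \<open>S\<close>. By concentration of measure, one of the \<open>O\<^sub>s\<close> contains, up to a
  small Hamming distance, the points of the orbit that belong to more than half of the words, hence
  also points that belong to a word and to its translate by the reflection in \<open>w s\<close>.
\<close>
theorem K_fixed_point:
  assumes Y: "G_flow G TG Y \<psi>"
  shows "\<exists>y\<in>topspace Y. \<forall>A\<in>K. \<psi> (iso A) y = y"
proof -
  interpret Y: flow G TG Y \<psi> by unfold_locales (rule Y, rule topspace_TG)
  have isoK: "iso A \<in> carrier G" if "A \<in> K" for A using iso_carrier K_OG[OF that] by blast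
  have "\<exists>y\<in>topspace Y. \<forall>w. w \<bullet> e 0 = 0 \<longrightarrow> w \<noteq> 0 \<longrightarrow> \<psi> (iso (refl w)) y = y"
  proof (rule ccontr)
    assume "\<not> ?thesis"
    then have ex: "\<exists>w. w \<bullet> e 0 = 0 \<and> w \<noteq> 0 \<and> \<psi> (iso (refl w)) y \<noteq> y" if "y \<in> topspace Y" for y
      using that by blast
    \<comment> \<open>Three independent small elements are allowed: \<open>v'\<close> and
      \<open>v''\<close> will correct the Hamming errors of a word and of its translate, and
      \<open>v\<close> the error of the matching.\<close>
    define good where "good w O' V \<longleftrightarrow> openin Y O' \<and> openin TG V \<and> \<one>\<^bsub>G\<^esub> \<in> V \<and> w \<bullet> e 0 = 0 \<and> w \<noteq> 0 \<and>
      (\<forall>v\<in>V. \<forall>v'\<in>V. \<forall>v''\<in>V. \<forall>z\<in>O'. \<forall>z'\<in>O'. \<psi> v (\<psi> (iso (refl w)) (\<psi> v' z)) \<noteq> \<psi> v'' z')" for w O' V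
    have "\<exists>w O' V. good w O' V \<and> y \<in> O'" if y: "y \<in> topspace Y" for y
    proof -
      obtain w where w: "w \<bullet> e 0 = 0" "w \<noteq> 0" "\<psi> (iso (refl w)) y \<noteq> y" using ex[OF y] by blast
      define \<rho> where "\<rho> = iso (refl w)"
      have \<rho>: "\<rho> \<in> carrier G" unfolding \<rho>_def by (intro isoK K_refl w)
      obtain U1 U2 where U: "openin Y U1" "openin Y U2" "y \<in> U1" "\<psi> \<rho> y \<in> U2" "disjnt U1 U2"
        using Y.Hausdorff y Y.act_closed[OF \<rho> y] w(3) unfolding Hausdorff_space_def \<rho>_def by metis
      obtain V1 U3 where V1: "openin TG V1" "\<one>\<^bsub>G\<^esub> \<in> V1" "openin Y U3" "\<psi> \<rho> y \<in> U3"
        "\<And>h z. h \<in> V1 \<Longrightarrow> z \<in> U3 \<Longrightarrow> \<psi> h z \<in> U2" using Y.nbhd_one[OF U(2,4)] by metis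
      define U5 where "U5 = {z \<in> topspace Y. \<psi> \<rho> z \<in> U3} \<inter> U1"
      have U5: "openin Y U5" "y \<in> U5"
        unfolding U5_def using Y.openin_preimage[OF \<rho> V1(3)] U(1,3) V1(4) y by auto
      obtain V2 O' where V2: "openin TG V2" "\<one>\<^bsub>G\<^esub> \<in> V2" "openin Y O'" "y \<in> O'"
        "\<And>h z. h \<in> V2 \<Longrightarrow> z \<in> O' \<Longrightarrow> \<psi> h z \<in> U5" using Y.nbhd_one[OF U5] by metis
      have "\<psi> v (\<psi> \<rho> (\<psi> v' z)) \<noteq> \<psi> v'' z'"
        if "v \<in> V1 \<inter> V2" "v' \<in> V1 \<inter> V2" "v'' \<in> V1 \<inter> V2" "z \<in> O'" "z' \<in> O'" for v v' v'' z z'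
      proof -
        have "\<psi> v' z \<in> U5" "\<psi> v'' z' \<in> U5" using V2(5) that by auto
        then have "\<psi> v (\<psi> \<rho> (\<psi> v' z)) \<in> U2" "\<psi> v'' z' \<in> U1"
          using V1(5) that(1) unfolding U5_def by auto
        then show ?thesis using U(5) unfolding disjnt_def by auto
      qed
      then have "good w O' (V1 \<inter> V2)"
        unfolding good_def \<rho>_def using V1(1,2) V2(1-3) w(1,2) by blast
      then show ?thesis using V2(4) by blast
    qed
    then have "\<forall>y\<in>topspace Y. \<exists>t. good (fst t) (fst (snd t)) (snd (snd t)) \<and> y \<in> fst (snd t)" by simp
    then obtain t where t: "\<And>y. y \<in> topspace Y \<Longrightarrow> good (fst (t y)) (fst (snd (t y))) (snd (snd (t y)))"
      "\<And>y. y \<in> topspace Y \<Longrightarrow> y \<in> fst (snd (t y))" by metis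
    define w where "w y = fst (t y)" for y
    define Ob where "Ob y = fst (snd (t y))" for y
    define Vb where "Vb y = snd (snd (t y))" for y
    have good: "good (w y) (Ob y) (Vb y)" "y \<in> Ob y" if "y \<in> topspace Y" for y
      using t[OF that] unfolding w_def Ob_def Vb_def by auto
    have "\<forall>U\<in>Ob ` topspace Y. openin Y U" using good unfolding good_def by blast
    moreover have "topspace Y \<subseteq> \<Union>(Ob ` topspace Y)" using good(2) by blast
    ultimately obtain \<F> where \<F>: "finite \<F>" "\<F> \<subseteq> Ob ` topspace Y" "topspace Y \<subseteq> \<Union>\<F>"
      using Y.compact unfolding compact_space_alt by meson
    obtain I where I: "I \<subseteq> topspace Y" "finite I" "\<F> = Ob ` I" using finite_subset_image[OF \<F>(1,2)] by blast
    obtain y0 where y0: "y0 \<in> topspace Y" using Y.nonempty by blast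
    have Ine: "I \<noteq> {}" using \<F>(3) y0 unfolding I(3) by blast
    have wI: "w s \<bullet> e 0 = 0" "w s \<noteq> 0" if "s \<in> I" for s using good(1) I(1) that unfolding good_def by blast+
    define V where "V = (\<Inter>s\<in>I. Vb s) \<inter> topspace TG"
    have Vb: "openin TG (Vb s)" "\<one>\<^bsub>G\<^esub> \<in> Vb s" if "s \<in> I" for s
      using good(1) I(1) that unfolding good_def by blast+
    have V: "openin TG V" "\<one>\<^bsub>G\<^esub> \<in> V"
    proof -
      show "openin TG V" unfolding V_def by (rule openin_INT[OF I(2)]) (rule Vb(1))
      show "\<one>\<^bsub>G\<^esub> \<in> V" unfolding V_def using Vb(2) by (simp add: topspace_TG)
    qed
    obtain F \<epsilon> where F: "finite F" "F \<subseteq> H" "\<epsilon> > 0"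
      "\<And>A. A \<in> OG \<Longrightarrow> \<forall>p\<in>F. norm (A p - p) < \<epsilon> \<Longrightarrow> iso A \<in> V"
      by (rule TG_nbhd[OF V]) (rule that)
    \<comment> \<open>The space \<open>S\<close> has to contain the reflection vectors, so that the
      reflections preserve it, and the tails of the points of \<open>F\<close>, on which membership
      in \<open>V\<close> is tested. Elements of \<open>K\<close> fix the \<open>e 0\<close>
      component.\<close>
    define R where "R = w ` I \<union> tail ` F"
    have "finite R" unfolding R_def using I(2) F(1) by simp
    then obtain d and b :: "nat \<Rightarrow> 'a" where b: "\<And>i j. i < d \<Longrightarrow> j < d \<Longrightarrow> b i \<bullet> b j = (if i = j then 1 else 0)"
      and spanb: "span (b ` {..<d}) = span R" by (rule orthonormal_basis) (rule that)
    define S where "S = span (b ` {..<d})"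
    have RS: "R \<subseteq> S" unfolding S_def spanb using span_superset by blast
    have "R \<subseteq> {x. e 0 \<bullet> x = 0}" unfolding R_def using wI by (auto simp: inner_commute[of "e 0"])
    then have "S \<subseteq> {x. e 0 \<bullet> x = 0}" unfolding S_def spanb by (rule span_minimal) (rule subspace_hyperplane)
    then have S0: "z \<bullet> e 0 = 0" if "z \<in> S" for z using that by (auto simp: inner_commute)
    have b0: "b i \<bullet> e 0 = 0" if "i < d" for i
      by (rule S0) (use that in \<open>simp add: S_def span_base\<close>)
    obtain M where M: "M > 0" "\<And>p. p \<in> F \<Longrightarrow> norm (tail p) \<le> M"
      using finite_imp_bounded[of "tail ` F"] F(1) unfolding bounded_pos by auto
    \<comment> \<open>A differing letter contributes at most \<open>(2 * M)\<^sup>2\<close>, so a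
      proportion \<delta> of them gives a mean square of at most
      \<open>\<epsilon>\<^sup>2 / 2\<close>. Similarly \<eta> is such that a matching error of
      \<open>2 * \<eta>\<close> moves a tail of norm at most \<open>M\<close> by at most
      \<epsilon>/2.\<close>
    define \<delta> where "\<delta> = \<epsilon>\<^sup>2 / (8 * M\<^sup>2)"
    define \<eta> where "\<eta> = \<epsilon> / (4 * M)"
    have \<delta>: "\<delta> > 0" and \<eta>: "\<eta> > 0" unfolding \<delta>_def \<eta>_def using F(3) M(1) by auto
    have "\<exists>Q. finite Q \<and> Q \<noteq> {} \<and> (\<forall>q\<in>Q. q \<in> K \<and> q ` S \<subseteq> S) \<and>
      (\<forall>w\<in>S. w \<bullet> e 0 = 0 \<longrightarrow> w \<noteq> 0 \<longrightarrow>
        (\<exists>\<sigma>. bij_betw \<sigma> Q Q \<and> (\<forall>a\<in>Q. close_on S (2 * \<eta>) (a \<circ> refl w) (\<sigma> a))))"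
      using b S_def \<eta> by (rule net_with_permutations)
    then obtain Q where Q1: "finite Q" "Q \<noteq> {}" "\<forall>q\<in>Q. q \<in> K \<and> q ` S \<subseteq> S"
      and perm: "\<forall>w\<in>S. w \<bullet> e 0 = 0 \<longrightarrow> w \<noteq> 0 \<longrightarrow>
        (\<exists>\<sigma>. bij_betw \<sigma> Q Q \<and> (\<forall>a\<in>Q. close_on S (2 * \<eta>) (a \<circ> refl w) (\<sigma> a)))"
      by (elim exE conjE) (rule that)
    have Q: "finite Q" "Q \<noteq> {}" "\<And>q. q \<in> Q \<Longrightarrow> q \<in> K" "\<And>q z. q \<in> Q \<Longrightarrow> z \<in> S \<Longrightarrow> q z \<in> S"
      using Q1 by blast+
    have "card I > 0" using I(2) Ine by (simp add: card_gt_0_iff)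
    from hamming_blow_up[OF Q(1,2) this \<delta>]
    obtain N where N: "N > 0" and blow_up: "\<forall>A\<subseteq>words Q N. card (words Q N) \<le> card I * card A \<longrightarrow>
      card (words Q N) < 2 * card {x \<in> words Q N. \<exists>a\<in>A. hamming x a \<le> \<delta> * N}"
      by (elim exE conjE) (rule that)
    obtain T :: "nat \<Rightarrow> 'a \<Rightarrow> 'a" where T: "\<And>j. T j \<in> K"
      "\<And>j k z z'. j \<noteq> k \<Longrightarrow> z \<in> S \<Longrightarrow> z' \<in> S \<Longrightarrow> T j z \<bullet> T k z' = 0"
    proof (rule orthogonal_copies[where b = b and d = d])
      show "b i \<bullet> b j = (if i = j then 1 else 0)" if "i < d" "j < d" for i j by (rule b[OF that])
      show "b i \<bullet> e 0 = 0" if "i < d" for i by (rule b0[OF that])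
      fix T' :: "nat \<Rightarrow> 'a \<Rightarrow> 'a"
      assume T': "\<And>j. T' j \<in> K" "\<And>j k z z'. j \<noteq> k \<Longrightarrow> z \<in> span (b ` {..<d}) \<Longrightarrow>
        z' \<in> span (b ` {..<d}) \<Longrightarrow> T' j z \<bullet> T' k z' = 0"
      show thesis by (rule that[of T']) (rule T'(1), rule T'(2), simp_all add: S_def)
    qed
    have letter: "x ! j \<in> Q" if "x \<in> words Q N" "j < N" for x j
      using that nth_mem unfolding words_def by blast
    have "\<exists>\<gamma>\<in>K. \<forall>z\<in>S. \<gamma> z = (1 / sqrt N) *\<^sub>R (\<Sum>j<N. T j ((x ! j) z))" if x: "x \<in> words Q N" for x
      by (rule block_embedding[where b = b and d = d])
        (use b b0 S_def T N Q(3,4) letter[OF x] in auto)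
    then obtain \<gamma> where \<gamma>: "\<And>x. x \<in> words Q N \<Longrightarrow> \<gamma> x \<in> K"
      "\<And>x z. x \<in> words Q N \<Longrightarrow> z \<in> S \<Longrightarrow> \<gamma> x z = (1 / sqrt N) *\<^sub>R (\<Sum>j<N. T j ((x ! j) z))"
      by metis
    \<comment> \<open>Applying the isometry \<open>\<gamma> x'\<close> turns the displacement of a
      tail into the difference of two block embeddings, whose norm is the quadratic mean in the
      hypothesis.\<close>
    have small: "iso (finv (\<gamma> x') \<circ> \<gamma> x \<circ> k) \<in> V"
      if x: "x \<in> words Q N" "x' \<in> words Q N" and k: "k \<in> K" "\<And>z. z \<in> S \<Longrightarrow> k z \<in> S"
        and sq: "\<And>p. p \<in> F \<Longrightarrow> (\<Sum>j<N. (norm ((x ! j) (k (tail p)) - (x' ! j) (tail p)))\<^sup>2) < N * \<epsilon>\<^sup>2" for x x' k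
    proof (rule F(4))
      define A where "A = finv (\<gamma> x') \<circ> \<gamma> x \<circ> k"
      have AK: "A \<in> K" unfolding A_def by (intro K_comp K_finv \<gamma> x k)
      then show "finv (\<gamma> x') \<circ> \<gamma> x \<circ> k \<in> OG" unfolding A_def by (rule K_OG)
      have "norm (A p - p) < \<epsilon>" if p: "p \<in> F" for p
      proof -
        define u where "u = tail p"
        have u: "u \<in> S" unfolding u_def using p RS unfolding R_def by blast
        have "A p - p = A u - u"
          using K_tail[OF AK, of p] e0_tail[of p] unfolding u_def by (metis add_diff_cancel_left)
        then have "norm (A p - p) = norm (\<gamma> x' (A u - u))" using K_norm[OF \<gamma>(1)[OF x(2)]] by simp
        also have "\<gamma> x' (A u - u) = \<gamma> x (k u) - \<gamma> x' u"
          unfolding K_diff[OF \<gamma>(1)[OF x(2)]] A_def using OG_inv(2)[OF K_OG[OF \<gamma>(1)[OF x(2)]]] by simp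
        finally have "(norm (A p - p))\<^sup>2 = (\<Sum>j<N. (norm ((x ! j) (k u) - (x' ! j) u))\<^sup>2) / N"
          unfolding \<gamma>(2)[OF x(1) k(2)[OF u]] \<gamma>(2)[OF x(2) u]
          by (simp only:) (rule block_distance[where S = S];
            use T S_def subspace_span Q(4) letter x u k(2) N in auto)
        also have "\<dots> < \<epsilon>\<^sup>2" using sq[OF p] N unfolding u_def by (simp add: divide_less_eq mult.commute)
        finally show ?thesis by (rule power_less_imp_less_base) (use F(3) in simp)
      qed
      then show "\<forall>p\<in>F. norm ((finv (\<gamma> x') \<circ> \<gamma> x \<circ> k) p - p) < \<epsilon>" unfolding A_def by blast
    qed
    \<comment> \<open>The inverse is essential: multiplying a word letterwise by \<open>k\<close> on
      the right acts on the points by the inverse of \<open>k\<close> on the left, and words that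
      are close give points differing by a small left factor.\<close>
    define pt where "pt x = \<psi> (iso (finv (\<gamma> x))) y0" for x
    have pt: "pt x \<in> topspace Y" if "x \<in> words Q N" for x
      unfolding pt_def by (intro Y.act_closed isoK K_finv \<gamma> that y0)
    have pt_step: "pt x' = \<psi> (iso (finv (\<gamma> x') \<circ> \<gamma> x \<circ> k)) (\<psi> (iso k) (pt x))"
      if x: "x \<in> words Q N" "x' \<in> words Q N" and k: "k \<in> K" "\<And>z. k (k z) = z" for x x' k
    proof -
      have K: "finv (\<gamma> x') \<circ> \<gamma> x \<circ> k \<in> K" "finv (\<gamma> x) \<in> K" by (intro K_comp K_finv \<gamma> x k)+
      have "(finv (\<gamma> x') \<circ> \<gamma> x \<circ> k) \<circ> (k \<circ> finv (\<gamma> x)) = finv (\<gamma> x')"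
        using k(2) OG_inv(2)[OF K_OG[OF \<gamma>(1)[OF x(1)]]] by (simp add: fun_eq_iff)
      then have "iso (finv (\<gamma> x')) = iso (finv (\<gamma> x') \<circ> \<gamma> x \<circ> k) \<otimes>\<^bsub>G\<^esub> (iso k \<otimes>\<^bsub>G\<^esub> iso (finv (\<gamma> x)))"
        using iso_comp[OF K_OG[OF K(1)] OG_comp[OF K_OG[OF k(1)] K_OG[OF K(2)]]]
          iso_comp[OF K_OG[OF k(1)] K_OG[OF K(2)]] by simp
      then show ?thesis
        unfolding pt_def using y0 isoK K k(1) by (simp add: Y.act_mult Y.act_closed)
    qed
    define cell where "cell s = {x \<in> words Q N. pt x \<in> Ob s}" for s
    have finW: "finite (words Q N)" using Q(1) by simp
    \<comment> \<open>Pigeonhole: the open sets cover the flow, so one of the finitely many cells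
      has at least the average size, a proportion that is independent of \<open>N\<close>.\<close>
    have "\<exists>s\<in>I. card (words Q N) \<le> card I * card (cell s)"
    proof (rule ccontr)
      assume "\<not> ?thesis"
      then have lt: "card I * card (cell s) < card (words Q N)" if "s \<in> I" for s using that by (meson not_le)
      have "words Q N \<subseteq> (\<Union>s\<in>I. cell s)" using pt \<F>(3) unfolding cell_def I(3) by blast
      then have "card (words Q N) \<le> card (\<Union>s\<in>I. cell s)"
        by (rule card_mono[rotated]) (use I(2) finW in \<open>simp add: cell_def\<close>)
      also have "\<dots> \<le> (\<Sum>s\<in>I. card (cell s))" by (rule card_UN_le[OF I(2)])
      finally have "card I * card (words Q N) \<le> (\<Sum>s\<in>I. card I * card (cell s))"
        by (simp add: sum_distrib_left[symmetric])
      also have "\<dots> < (\<Sum>s\<in>I. card (words Q N))" using I(2) Ine lt by (rule sum_strict_mono)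
      finally show False by simp
    qed
    then obtain s where s: "s \<in> I" "card (words Q N) \<le> card I * card (cell s)" by blast
    define near where "near = {x \<in> words Q N. \<exists>a\<in>cell s. hamming x a \<le> \<delta> * N}"
    have half: "card (words Q N) < 2 * card near"
      unfolding near_def using blow_up[rule_format, of "cell s"] s(2) unfolding cell_def by blast
    have wS: "w s \<in> S" using RS s(1) unfolding R_def by blast
    note w0 = wI[OF s(1)]
    obtain \<sigma> where \<sigma>: "bij_betw \<sigma> Q Q" "\<And>a. a \<in> Q \<Longrightarrow> close_on S (2 * \<eta>) (a \<circ> refl (w s)) (\<sigma> a)"
      using perm[rule_format, OF wS w0] by blast
    have map\<sigma>: "map \<sigma> x \<in> words Q N" if "x \<in> words Q N" for x
      using that bij_betw_imp_surj_on[OF \<sigma>(1)] unfolding words_def by auto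
    have inj_map: "inj_on (map \<sigma>) (words Q N)"
    proof (rule inj_onI)
      fix x x' assume x: "x \<in> words Q N" "x' \<in> words Q N" "map \<sigma> x = map \<sigma> x'"
      have "inj_on \<sigma> (set x \<union> set x')"
        using x(1,2) bij_betw_imp_inj_on[OF \<sigma>(1)] unfolding words_def by (auto intro: inj_on_subset)
      then show "x = x'" using x(3) by (rule map_inj_on[rotated])
    qed
    \<comment> \<open>Applying the permutation to each letter is injective on words, and two sets
      containing more than half of all words must meet.\<close>
    have "\<exists>x\<in>near. map \<sigma> x \<in> near"
    proof (rule ccontr)
      assume none: "\<not> (\<exists>x\<in>near. map \<sigma> x \<in> near)"
      have sub: "near \<subseteq> words Q N" unfolding near_def by blast
      have "card (near \<union> map \<sigma> ` near) \<le> card (words Q N)"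
        using sub map\<sigma> by (intro card_mono finW) auto
      moreover have "card (near \<union> map \<sigma> ` near) = card near + card (map \<sigma> ` near)"
        using none sub finW by (intro card_Un_disjoint) (auto intro: finite_subset)
      moreover have "card (map \<sigma> ` near) = card near"
        using inj_on_subset[OF inj_map sub] by (rule card_image)
      ultimately show False using half by linarith
    qed
    then obtain x where x: "x \<in> near" "map \<sigma> x \<in> near" by blast
    have near_step: "\<exists>v\<in>V. \<exists>z\<in>Ob s. pt x = \<psi> v z" if x: "x \<in> near" for x
    proof -
      obtain a where a: "a \<in> words Q N" "pt a \<in> Ob s" "hamming x a \<le> \<delta> * N" and xW: "x \<in> words Q N"
        using x unfolding near_def cell_def by blast
      have "(\<Sum>j<N. (norm ((a ! j) (id (tail p)) - (x ! j) (tail p)))\<^sup>2) < N * \<epsilon>\<^sup>2" if p: "p \<in> F" for p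
      proof -
        define u where "u = tail p"
        define X where "X = {j. j < length x \<and> x ! j \<noteq> a ! j}"
        have len: "length x = N" using xW unfolding words_def by blast
        have "(norm ((a ! j) u - (x ! j) u))\<^sup>2 \<le> (if j \<in> X then 4 * M\<^sup>2 else 0)" if j: "j < N" for j
        proof (cases "j \<in> X")
          case True
          have "norm ((a ! j) u - (x ! j) u) \<le> norm ((a ! j) u) + norm ((x ! j) u)" by (rule norm_triangle_ineq4)
          also have "\<dots> = 2 * norm u" using K_norm Q(3) letter a(1) xW j by simp
          also have "\<dots> \<le> 2 * M" using M(2)[OF p] unfolding u_def by simp
          finally have "(norm ((a ! j) u - (x ! j) u))\<^sup>2 \<le> (2 * M)\<^sup>2" by (rule power_mono) simp
          then show ?thesis using True by (simp add: power_mult_distrib)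
        next
          case False
          then have "x ! j = a ! j" using j len unfolding X_def by blast
          then show ?thesis using False by simp
        qed
        then have "(\<Sum>j<N. (norm ((a ! j) u - (x ! j) u))\<^sup>2) \<le> (\<Sum>j<N. if j \<in> X then 4 * M\<^sup>2 else 0)"
          by (intro sum_mono) simp
        also have "\<dots> = card X * (4 * M\<^sup>2)"
        proof -
          have "{..<N} \<inter> X = X" unfolding X_def using len by auto
          then show ?thesis by (simp add: sum.If_cases)
        qed
        also have "\<dots> \<le> (\<delta> * N) * (4 * M\<^sup>2)"
          using a(3) unfolding hamming_def X_def by (intro mult_right_mono) auto
        also have "\<dots> = N * \<epsilon>\<^sup>2 / 2" unfolding \<delta>_def using M(1) by simp
        also have "\<dots> < N * \<epsilon>\<^sup>2" using N F(3) by simp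
        finally show ?thesis unfolding u_def by simp
      qed
      then have "iso (finv (\<gamma> x) \<circ> \<gamma> a \<circ> id) \<in> V"
        using a(1) xW OG_id by (intro small) (auto simp: K_def)
      moreover have "iso id = \<one>\<^bsub>G\<^esub>" by (simp add: iso_def one_G id_def)
      then have "pt x = \<psi> (iso (finv (\<gamma> x) \<circ> \<gamma> a \<circ> id)) (pt a)"
        using pt_step[OF a(1) xW, of id] OG_id pt[OF a(1)] by (simp add: K_def Y.act_one)
      ultimately show ?thesis using a(2) by blast
    qed
    have rS: "refl (w s) z \<in> S" if "z \<in> S" for z
      using that wS unfolding refl_def S_def by (intro span_diff span_scale)
    have rr: "refl (w s) (refl (w s) z) = z" for z using w0 by (intro refl_refl) (simp add: B_perp)
    have xW: "x \<in> words Q N" using x(1) unfolding near_def by blast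
    define v where "v = iso (finv (\<gamma> (map \<sigma> x)) \<circ> \<gamma> x \<circ> refl (w s))"
    have "v \<in> V"
      unfolding v_def
    proof (rule small[OF xW map\<sigma>[OF xW] K_refl[OF w0] rS])
      fix p assume p: "p \<in> F"
      define u where "u = tail p"
      have u: "u \<in> S" "norm u \<le> M" using p RS M(2)[OF p] unfolding R_def u_def by auto
      have "(norm ((x ! j) (refl (w s) u) - (map \<sigma> x ! j) u))\<^sup>2 \<le> (\<epsilon> / 2)\<^sup>2" if j: "j < N" for j
      proof -
        have "map \<sigma> x ! j = \<sigma> (x ! j)" using j xW unfolding words_def by auto
        then have "norm ((x ! j) (refl (w s) u) - (map \<sigma> x ! j) u) \<le> 2 * \<eta> * norm u"
          using \<sigma>(2)[OF letter[OF xW j]] u(1) unfolding close_on_def by simp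
        also have "\<dots> \<le> 2 * \<eta> * M" using u(2) \<eta> by (intro mult_left_mono) auto
        also have "\<dots> = \<epsilon> / 2" unfolding \<eta>_def using M(1) by simp
        finally show ?thesis by (rule power_mono) simp
      qed
      then have "(\<Sum>j<N. (norm ((x ! j) (refl (w s) u) - (map \<sigma> x ! j) u))\<^sup>2) \<le> (\<Sum>j<N. (\<epsilon> / 2)\<^sup>2)"
        by (intro sum_mono) simp
      also have "\<dots> < N * \<epsilon>\<^sup>2" using N F(3) by (simp add: power_divide)
      finally show "(\<Sum>j<N. (norm ((x ! j) (refl (w s) (tail p)) - (map \<sigma> x ! j) (tail p)))\<^sup>2) < N * \<epsilon>\<^sup>2"
        unfolding u_def .
    qed
    obtain v1 z1 where 1: "v1 \<in> V" "z1 \<in> Ob s" "pt x = \<psi> v1 z1" using near_step[OF x(1)] by blast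
    obtain v2 z2 where 2: "v2 \<in> V" "z2 \<in> Ob s" "pt (map \<sigma> x) = \<psi> v2 z2" using near_step[OF x(2)] by blast
    \<comment> \<open>The two points of \<open>Ob s\<close> are now linked by the reflection in
      \<open>w s\<close> and three elements of \<open>V\<close>, which \<open>good\<close>
      excludes.\<close>
    have "\<psi> v (\<psi> (iso (refl (w s))) (\<psi> v1 z1)) = \<psi> v2 z2"
      using pt_step[OF xW map\<sigma>[OF xW] K_refl[OF w0] rr] 1(3) 2(3) unfolding v_def by simp
    moreover have "V \<subseteq> Vb s" unfolding V_def using s(1) by blast
    moreover have "good (w s) (Ob s) (Vb s)" using good(1) s(1) I(1) by blast
    moreover have "\<psi> v (\<psi> (iso (refl (w s))) (\<psi> v1 z1)) \<noteq> \<psi> v2 z2"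
      if "good (w s) (Ob s) W" "V \<subseteq> W" for W
      using that \<open>v \<in> V\<close> 1(1,2) 2(1,2) unfolding good_def by (meson subsetD)
    ultimately show False by metis
  qed
  then obtain y where y: "y \<in> topspace Y" "\<And>w. w \<bullet> e 0 = 0 \<Longrightarrow> w \<noteq> 0 \<Longrightarrow> \<psi> (iso (refl w)) y = y"
    by blast
  have "\<psi> (iso A) y = y" if "A \<in> K" for A
    by (rule fixed_by_reflections[OF Y y(1) _ that]) (rule y(2))
  then show ?thesis using y(1) by blast
qed

section \<open>Fixed points of the stabilizer of a boundary point\<close>

text \<open>
  The points \<open>x n\<close> of a geodesic ray that converges to the boundary point are moved by \<open>g\<close> by
  distances that tend to \<open>0\<close>. With a third point \<open>h (x n)\<close> far away from both, the product of two
  reflections exchanging \<open>x n\<close> and \<open>h (x n)\<close>, respectively \<open>h (x n)\<close> and \<open>g (x n)\<close>, takes \<open>x n\<close> to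
  \<open>g (x n)\<close> and tends to the identity.
\<close>
lemma horospherical_fixed_point:
  assumes Y: "G_flow G TG Y \<psi>" and b: "b \<bullet> e 0 = 0" "norm b = 1"
  shows "\<exists>y\<in>topspace Y. \<forall>g\<in>carrier G. L g (e 0 + b) = e 0 + b \<longrightarrow> \<psi> g y = y"
proof -
  interpret Y: flow G TG Y \<psi> by unfold_locales (rule Y, rule topspace_TG)
  obtain y0 where y0: "y0 \<in> topspace Y" "\<And>A. A \<in> K \<Longrightarrow> \<psi> (iso A) y0 = y0"
    using K_fixed_point[OF Y] by blast
  define u where "u = e 0 + b"
  define u' where "u' = e 0 - b"
  have bb: "b \<bullet> b = 1" using b(2) by (simp add: norm_eq_1)
  have Bu: "B u u = 0" "B u' u' = 0" "B u u' = 2" "B u' u = 2"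
    unfolding u_def u'_def B_def using b(1) bb
    by (simp_all add: inner_add_left inner_add_right inner_diff_left inner_diff_right inner_commute[of "e 0" b])
  define s where "s n = real (Suc n)" for n
  have s: "s n > 0" for n unfolding s_def by simp
  \<comment> \<open>The points of the geodesic from the line of \<open>u'\<close> to the line of
    \<open>u\<close>. Since \<open>B u u' = 2\<close>, the coefficient
    \<open>1 / (4 * (s n * s n))\<close> is the one that gives the square 1.\<close>
  define x where "x n = s n *\<^sub>R (u + (1 / (4 * (s n * s n))) *\<^sub>R u')" for n
  have xH: "x n \<in> H" for n
  proof -
    have "B (x n) (x n) = 1" unfolding x_def using s[of n] by (simp add: B_simps Bu)
    moreover have "u \<bullet> e 0 = 1" "u' \<bullet> e 0 = 1"
      unfolding u_def u'_def using b(1) by (simp_all add: inner_add_left inner_diff_left)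
    then have "x n \<bullet> e 0 > 0" unfolding x_def using s[of n] by (simp add: inner_add_left add_pos_pos)
    ultimately show ?thesis unfolding H_iff by simp
  qed
  have "\<exists>A. A \<in> OG \<and> A (e 0) = x n" for n using OG_transitive[OF e0_H xH] by metis
  then obtain A where A: "\<And>n. A n \<in> OG" "\<And>n. A n (e 0) = x n" by metis
  \<comment> \<open>This point is fixed by the stabilizer of \<open>x n\<close>, the conjugate of
    \<open>K\<close> by \<open>A n\<close>; \<open>z\<close> will be a cluster point of the
    sequence.\<close>
  define y where "y n = \<psi> (iso (A n)) y0" for n
  have yY: "y n \<in> topspace Y" for n unfolding y_def by (intro Y.act_closed iso_carrier A y0)
  have "(\<Inter>m\<in>UNIV. Y closure_of (y ` {m..})) \<noteq> {}"
  proof (rule compact_space_fip_image[OF Y.compact])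
    fix I :: "nat set" assume I: "finite I"
    define m where "m = Max (insert 0 I)"
    have "y m \<in> Y closure_of (y ` {i..})" if "i \<in> I" for i
    proof -
      have "i \<le> m" unfolding m_def using I that by simp
      moreover have "y ` {i..} \<subseteq> Y closure_of (y ` {i..})" using yY by (intro closure_of_subset) auto
      ultimately show ?thesis by auto
    qed
    then show "(\<Inter>i\<in>I. Y closure_of (y ` {i..})) \<noteq> {}" by blast
  qed simp
  then obtain z where z: "\<And>m. z \<in> Y closure_of (y ` {m..})" by blast
  have zY: "z \<in> topspace Y" by (rule subsetD[OF closure_of_subset_topspace z[of 0]])
  have "\<psi> g z = z" if g: "g \<in> carrier G" "L g u = u" for g
  proof (rule ccontr)
    assume "\<psi> g z \<noteq> z"
    then obtain V U U' where V: "openin TG V" "\<one>\<^bsub>G\<^esub> \<in> V" "openin Y U" "z \<in> U" "openin Y U'" "\<psi> g z \<in> U'"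
      "\<And>v z. v \<in> V \<Longrightarrow> z \<in> U \<Longrightarrow> \<psi> v z \<notin> U'"
      using Y.separation[OF zY Y.act_closed[OF g(1) zY]] by metis
    define O' where "O' = {z \<in> topspace Y. \<psi> g z \<in> U'} \<inter> U"
    have O': "openin Y O'" "z \<in> O'" unfolding O'_def using Y.openin_preimage[OF g(1) V(5)] V zY by auto
    obtain F \<epsilon> where F: "finite F" "F \<subseteq> H" "\<epsilon> > 0"
      "\<And>A. A \<in> OG \<Longrightarrow> \<forall>p\<in>F. norm (A p - p) < \<epsilon> \<Longrightarrow> iso A \<in> V"
      by (rule TG_nbhd[OF V(1,2)]) (rule that)
    note Lg = L_OG[OF g(1)]
    \<comment> \<open>It interchanges the two ends of the geodesic, so \<open>h (x n)\<close> runs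
      off to the opposite end and is the distant third point.\<close>
    define h where "h = refl b"
    have bn: "b \<noteq> 0" using b(2) by auto
    have hK: "h \<in> K" unfolding h_def by (rule K_refl[OF b(1) bn])
    have hb: "h b = - b" unfolding h_def refl_perp[OF b(1)] bb by (simp add: scaleR_2)
    have hu: "h u = u'" "h u' = u"
      unfolding u_def u'_def using K_linear[OF hK] K_e0[OF hK] hb by (simp_all add: linear_add linear_diff)
    define t where "t n = 1 / (4 * (s n * s n))" for n
    \<comment> \<open>Up to sign and the factor \<open>s n\<close>, the differences of the exchanged
      points, which determine the same reflections. After the rescaling both converge to
      \<open>d = u' - u\<close>, which is spacelike, so the product of the reflections tends to the
      square of one reflection.\<close>
    define a where "a n = (u' + t n *\<^sub>R u) - (u + t n *\<^sub>R u')" for n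
    define c where "c n = (u' + t n *\<^sub>R u) - (u + t n *\<^sub>R L g u')" for n
    have hx: "h (x n) = s n *\<^sub>R (u' + t n *\<^sub>R u)" for n
      unfolding x_def t_def using K_linear[OF hK] hu by (simp add: linear_add linear_scale)
    have gx: "L g (x n) = s n *\<^sub>R (u + t n *\<^sub>R L g u')" for n
      unfolding x_def t_def using OG_linear[OF Lg] g(2) by (simp add: linear_add linear_scale)
    have xs: "x n = s n *\<^sub>R (u + t n *\<^sub>R u')" for n unfolding x_def t_def ..
    have "(\<lambda>n. 1 / s n) \<longlonglongrightarrow> 0"
      unfolding s_def using LIMSEQ_inverse_real_of_nat by (simp add: inverse_eq_divide)
    then have "(\<lambda>n. (1 / 4) * ((1 / s n) * (1 / s n))) \<longlonglongrightarrow> (1 / 4) * (0 * 0)" by (intro tendsto_intros)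
    then have t0: "t \<longlonglongrightarrow> 0" unfolding t_def by simp
    define d where "d = u' - u"
    have "a \<longlonglongrightarrow> (u' + 0 *\<^sub>R u) - (u + 0 *\<^sub>R u')" unfolding a_def by (intro tendsto_intros t0)
    then have alim: "a \<longlonglongrightarrow> d" unfolding d_def by simp
    have "c \<longlonglongrightarrow> (u' + 0 *\<^sub>R u) - (u + 0 *\<^sub>R L g u')" unfolding c_def by (intro tendsto_intros t0)
    then have clim: "c \<longlonglongrightarrow> d" unfolding d_def by simp
    have Bd: "B d d = -4" unfolding d_def by (simp add: B_simps Bu)
    have ev_a: "eventually (\<lambda>n. B (a n) (a n) < 0) sequentially"
      using tendsto_B[OF alim alim] Bd by (intro order_tendstoD(2)) auto
    have ev_c: "eventually (\<lambda>n. B (c n) (c n) < 0) sequentially"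
      using tendsto_B[OF clim clim] Bd by (intro order_tendstoD(2)) auto
    have "eventually (\<lambda>n. norm (refl (c n) (refl (a n) p) - p) < \<epsilon>) sequentially" for p
    proof -
      have "(\<lambda>n. refl (c n) (refl (a n) p)) \<longlonglongrightarrow> refl d (refl d p)"
        using Bd by (intro tendsto_refl clim alim tendsto_const) auto
      then have "(\<lambda>n. refl (c n) (refl (a n) p)) \<longlonglongrightarrow> p" using refl_refl[of d p] Bd by simp
      then show ?thesis using F(3) by (simp add: tendsto_iff dist_norm)
    qed
    then have "eventually (\<lambda>n. \<forall>p\<in>F. norm (refl (c n) (refl (a n) p) - p) < \<epsilon>) sequentially"
      by (simp add: eventually_ball_finite F(1))
    then have "eventually (\<lambda>n. B (a n) (a n) < 0 \<and> B (c n) (c n) < 0 \<and>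
        (\<forall>p\<in>F. norm (refl (c n) (refl (a n) p) - p) < \<epsilon>)) sequentially"
      by (intro eventually_conj ev_a ev_c)
    then obtain m where m: "\<And>n. n \<ge> m \<Longrightarrow> B (a n) (a n) < 0 \<and> B (c n) (c n) < 0 \<and>
        (\<forall>p\<in>F. norm (refl (c n) (refl (a n) p) - p) < \<epsilon>)"
      unfolding eventually_sequentially by blast
    obtain n where n: "n \<ge> m" "y n \<in> O'"
      using closure_of_image_meets[OF z[of m] O'] by (metis atLeast_iff)
    note ac = m[OF n(1)]
    define v where "v = refl (c n) \<circ> refl (a n)"
    have vOG: "v \<in> OG" unfolding v_def using ac by (intro OG_comp refl_OG) auto
    have vV: "iso v \<in> V" using ac by (intro F(4) vOG) (simp add: v_def)
    have "v (x n) = L g (x n)"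
    proof -
      have sn: "s n \<noteq> 0" using s[of n] by simp
      have 1: "x n - h (x n) = (- s n) *\<^sub>R a n" unfolding hx unfolding xs a_def by (simp add: algebra_simps)
      have 2: "h (x n) - L g (x n) = s n *\<^sub>R c n" unfolding hx gx c_def by (simp add: algebra_simps)
      have "refl (x n - h (x n)) (x n) = h (x n)"
        using OG_B[OF K_OG[OF hK], of "x n" "x n"] ac sn by (intro refl_swap) (auto simp: 1 B_simps)
      then have "refl (a n) (x n) = h (x n)" using sn unfolding 1 by (simp add: refl_scale del: scaleR_minus_left)
      moreover have "refl (h (x n) - L g (x n)) (h (x n)) = L g (x n)"
        using OG_B[OF K_OG[OF hK], of "x n" "x n"] OG_B[OF Lg, of "x n" "x n"] ac sn
        by (intro refl_swap) (auto simp: 2 B_simps)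
      then have "refl (c n) (h (x n)) = L g (x n)" using sn unfolding 2 by (simp add: refl_scale)
      ultimately show ?thesis unfolding v_def by simp
    qed
    \<comment> \<open>Both \<open>v\<close> and \<open>g\<close> take \<open>x n\<close> to the same
      point, so they differ by an element of the stabilizer of \<open>x n\<close>; conjugated into
      \<open>K\<close> it fixes \<open>y0\<close>, and hence \<open>v\<close> and \<open>g\<close>
      agree on \<open>y n\<close>.\<close>
    moreover define k where "k = finv (A n) \<circ> (finv (L g) \<circ> (v \<circ> A n))"
    ultimately have "k \<in> K"
      using A(1)[of n] A(2)[of n] OG_inv(3)[OF Lg] OG_inv(3)[OF A(1), of n "e 0"]
        OG_comp OG_inv(1)[OF Lg] OG_inv(1)[OF A(1)[of n]] vOG unfolding K_def by simp
    have "L g \<circ> (A n \<circ> k) = v \<circ> A n"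
      unfolding k_def using OG_inv(2)[OF Lg] OG_inv(2)[OF A(1)[of n]] by (simp add: fun_eq_iff)
    then have "iso v \<otimes>\<^bsub>G\<^esub> iso (A n) = g \<otimes>\<^bsub>G\<^esub> (iso (A n) \<otimes>\<^bsub>G\<^esub> iso k)"
      using iso_comp[OF vOG A(1)[of n]] iso_comp[OF Lg OG_comp[OF A(1)[of n] K_OG[OF \<open>k \<in> K\<close>]]]
        iso_comp[OF A(1)[of n] K_OG[OF \<open>k \<in> K\<close>]] iso_L[OF g(1)] by simp
    then have "\<psi> (iso v \<otimes>\<^bsub>G\<^esub> iso (A n)) y0 = \<psi> (g \<otimes>\<^bsub>G\<^esub> (iso (A n) \<otimes>\<^bsub>G\<^esub> iso k)) y0" by simp
    then have "\<psi> (iso v) (y n) = \<psi> g (y n)"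
      unfolding y_def using y0 g(1) iso_carrier[OF vOG] iso_carrier[OF A(1)[of n]]
        iso_carrier[OF K_OG[OF \<open>k \<in> K\<close>]] \<open>k \<in> K\<close>
      by (simp add: Y.act_mult Y.act_closed)
    then show False using V(7)[OF vV, of "y n"] n(2) unfolding O'_def by simp
  qed
  then show ?thesis using zY unfolding u_def by blast
qed

text \<open>The stabilizer multiplies the isotropic vector \<open>u\<close> by scalars; up to sign,
  the logarithm of the scalar is the Busemann character. Scalars commute, so commutators fix
  \<open>u\<close>, which is the hypothesis of \<open>stabilizer_fixed_point\<close> for the group
  of isometries fixing \<open>u\<close> itself.\<close>

lemma stabilizer_boundary_fixed_point:
  assumes \<xi>: "\<xi> \<in> hyp_boundary e" and Y: "proximal_flow G TG Y \<psi>"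
  shows "\<exists>y\<in>topspace Y. \<forall>p\<in>stabilizer G (hyp_action e) \<xi>. \<psi> p y = y"
proof -
  interpret homogeneous_flow G TG XT "hyp_action e" \<xi> by (rule homogeneous_XT[OF \<xi>])
  obtain b where b: "b \<bullet> e 0 = 0" "norm b = 1" "\<xi> = line b" using \<xi> hyp_boundary_eq by blast
  define u where "u = e 0 + b"
  have bD: "b \<in> D" using b unfolding D_iff by simp
  have eig: "\<exists>c. L p u = c *\<^sub>R u" if p: "p \<in> stabilizer G (hyp_action e) \<xi>" for p
  proof -
    have pG: "p \<in> carrier G" by (rule P_closed[OF p])
    have "line (dact p b) = line b" using P_fix[OF p] hyp_action_line(1)[OF pG bD] b(3) by simp
    then have "dact p b = b" using line_inj hyp_action_line(2)[OF pG bD] bD by blast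
    then have eq: "(1 / (L p u \<bullet> e 0)) *\<^sub>R L p u = u" using e0_proj[of "L p u"] unfolding dact_def u_def by simp
    have "L p u \<bullet> e 0 > 0" using OG_cone(2)[OF L_OG[OF pG] D_cone[OF bD]] unfolding u_def .
    then have "L p u = (L p u \<bullet> e 0) *\<^sub>R ((1 / (L p u \<bullet> e 0)) *\<^sub>R L p u)" by simp
    then show ?thesis unfolding eq by blast
  qed
  define P1 where "P1 = {g \<in> carrier G. L g u = u}"
  show ?thesis
  proof (rule stabilizer_fixed_point[OF Y])
    show "P1 \<subseteq> stabilizer G (hyp_action e) \<xi>"
    proof
      fix g assume g: "g \<in> P1"
      then have "dact g b = b" unfolding dact_def P1_def u_def using proj_e0[OF b(1)] by simp
      then show "g \<in> stabilizer G (hyp_action e) \<xi>"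
        using g hyp_action_line(1)[of g b] bD b(3) unfolding P1_def stabilizer_def by simp
    qed
    show "inv\<^bsub>G\<^esub> (q \<otimes>\<^bsub>G\<^esub> p) \<otimes>\<^bsub>G\<^esub> (p \<otimes>\<^bsub>G\<^esub> q) \<in> P1"
      if pq: "p \<in> stabilizer G (hyp_action e) \<xi>" "q \<in> stabilizer G (hyp_action e) \<xi>" for p q
    proof -
      have carr: "p \<in> carrier G" "q \<in> carrier G" using pq P_closed by auto
      obtain c d where c: "L p u = c *\<^sub>R u" and d: "L q u = d *\<^sub>R u" using eig pq by blast
      have "L (p \<otimes>\<^bsub>G\<^esub> q) u = L (q \<otimes>\<^bsub>G\<^esub> p) u"
        using carr c d OG_linear[OF L_OG] by (simp add: L_mult linear_scale mult.commute)
      then have "L (inv\<^bsub>G\<^esub> (q \<otimes>\<^bsub>G\<^esub> p)) (L (p \<otimes>\<^bsub>G\<^esub> q) u) = u"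
        using L_inv(2)[of "q \<otimes>\<^bsub>G\<^esub> p" u] carr by simp
      then show ?thesis unfolding P1_def using carr L_mult[of "inv\<^bsub>G\<^esub> (q \<otimes>\<^bsub>G\<^esub> p)" "p \<otimes>\<^bsub>G\<^esub> q"] by simp
    qed
    have "G_flow G TG Y \<psi>" using Y unfolding proximal_flow_def by blast
    from horospherical_fixed_point[OF this b(1,2)]
    show "\<exists>y\<in>topspace Y. \<forall>p\<in>P1. \<psi> p y = y" unfolding P1_def u_def by blast
  qed
qed

end

theorem theorem6p5:
  fixes e :: "nat \<Rightarrow> 'a::{real_inner, complete_space}"
    and \<xi> :: "'a set"
  assumes "Hilbert_basis e"
    and "\<xi> \<in> hyp_boundary e"
  shows "universal_proximal_minimal_flow TYPE('y) (hyp_Isom e) (hyp_Isom_topology e)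
           (hyp_closure_topology e) (hyp_action e)
       \<and> isomorphic_flows (hyp_Isom e) (hyp_Isom_topology e)
           (hyp_closure_topology e) (hyp_action e)
           (coset_completion_topology (hyp_Isom e) (hyp_Isom_topology e)
              (stabilizer (hyp_Isom e) (hyp_action e) \<xi>))
           (coset_completion_action (hyp_Isom e) (hyp_Isom_topology e)
              (stabilizer (hyp_Isom e) (hyp_action e) \<xi>))"
proof
  interpret hilbert_basis e by unfold_locales (rule assms(1))
  interpret homogeneous_flow "hyp_Isom e" "hyp_Isom_topology e" "hyp_closure_topology e" "hyp_action e" \<xi>
    by (rule homogeneous_XT[OF assms(2)])
  show "universal_proximal_minimal_flow TYPE('y) (hyp_Isom e) (hyp_Isom_topology e)
           (hyp_closure_topology e) (hyp_action e)"
    unfolding universal_proximal_minimal_flow_def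
  proof (intro conjI allI impI proximal_XT minimal_XT)
    fix Y :: "'y topology" and \<psi>
    assume Y: "proximal_flow (hyp_Isom e) (hyp_Isom_topology e) Y \<psi> \<and>
      minimal_flow (hyp_Isom e) (hyp_Isom_topology e) Y \<psi>"
    obtain y where "y \<in> topspace Y" "\<forall>p\<in>P. \<psi> p y = y"
      using stabilizer_boundary_fixed_point[OF assms(2) conjunct1[OF Y]] by blast
    then show "\<exists>f. continuous_map (hyp_closure_topology e) Y f \<and>
        f ` topspace (hyp_closure_topology e) = topspace Y \<and>
        equivariant_on (hyp_Isom e) (topspace (hyp_closure_topology e)) (hyp_action e) \<psi> f"
      using factor_map[OF conjunct2[OF Y]] by blast
  qed
  show "isomorphic_flows (hyp_Isom e) (hyp_Isom_topology e) (hyp_closure_topology e) (hyp_action e)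
     (coset_completion_topology (hyp_Isom e) (hyp_Isom_topology e) P)
     (coset_completion_action (hyp_Isom e) (hyp_Isom_topology e) P)"
    by (rule isomorphic_completion)
qed

end
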